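(* Let $G_A$, $\xi_0\in\partial G_A$ and the metric $D$ on $\partial G_A\setminus\{\xi_0\}\cong\mathbb{R}^n$ be as in the context, and assume $r\ge 2$. Let $d$ be a visual metric on $\partial G_A$ and let $F:(\partial G_A,d)\to(\partial G_A,d)$ be a quasisymmetric homeomorphism. Then $F$ maps $\partial G_A\setminus\{\xi_0\}$ onto itself, and the restriction of $F$ to $\partial G_A\setminus\{\xi_0\}$ is bilipschitz with respect to $D$, i.e. there is $L\ge1$ with $D(x,y)/L\le D(F(x),F(y))\le L\,D(x,y)$ for all $x,y\in\partial G_A\setminus\{\xi_0\}$.
   Context: Let $r\ge1$, $n_1,\dots,n_r\ge 1$, $n=n_1+\dots+n_r$, and real numbers $0<\alpha_1<\alpha_2<\dots<\alpha_r$. Let $A=\mathrm{diag}(\alpha_1I_{n_1},\dots,\alpha_rI_{n_r})$ ($I_k$ the $k\times k$ identity). $G_A=\mathbb{R}^n\rtimes_A\mathbb{R}$ is $\mathbb{R}^n\times\mathbb{R}$ with product $(x,t)\cdot(y,s)=(x+e^{tA}y,\,t+s)$, equipped with the left-invariant Riemannian metric which is Euclidean at the identity; at $(x,t)$ it is given by the matrix $\begin{pmatrix}e^{-2tA}&0\\0&1\end{pmatrix}$. $G_A$ is simply connected with sectional curvature between $-\alpha_r^2$ and $-\alpha_1^2$, hence Gromov hyperbolic with ideal (Gromov) boundary $\partial G_A$. The vertical geodesics $\gamma_x(t)=(x,t)$, $x\in\mathbb{R}^n$, are all asymptotic as $t\to+\infty$ and define a point $\xi_0\in\partial G_A$; $\partial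 G_A\setminus\{\xi_0\}$ is identified with $\mathbb{R}^n$ by sending $x$ to the endpoint of $\gamma_x$ as $t\to-\infty$. Write $x\in\mathbb{R}^n$ as $x=(x_1,\dots,x_r)$, $x_i\in\mathbb{R}^{n_i}$, and define $D(x,y)=\max\{|x_1-y_1|,|x_2-y_2|^{\alpha_1/\alpha_2},\dots,|x_r-y_r|^{\alpha_1/\alpha_r}\}$ ($|\cdot|$ the Euclidean norm). For $p\in G_A$ and boundary points $\xi,\eta$, the Gromov product is $(\xi|\eta)_p=\frac12\sup\liminf_{i,j\to\infty}(d(p,x_i)+d(p,y_j)-d(x_i,y_j))$, the sup over sequences $x_i\to\xi$, $y_j\to\eta$. A visual metric on $\partial G_A$ is a metric $d$ such that for some $p\in G_A$ and some sufficiently small $\epsilon>0$, $\frac12e^{-\epsilon(\xi|\eta)_p}\le d(\xi,\eta)\le e^{-\epsilon(\xi|\eta)_p}$ for all $\xi,\eta\in\partial G_A$. A homeomorphism $f:X\to Y$ of metric spaces is $\eta$-quasisymmetric ($\eta:[0,\infty)\to[0,\infty)$ a homeomorphism) if $\frac{d(f(x),f(y))}{d(f(x),f(z))}\le\eta\big(\frac{d(x,y)}{d(x,z)}\big)$ for all distinct $x,y,z$; quasisymmetric means $\eta$-quasisymmetric for some $\eta$. *)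

theory Defs
  imports "HOL-Analysis.Analysis"
begin

text \<open>Setting. R^n is modelled as real^'n for a finite index type 'n. The block
structure n = n_1 + ... + n_r is given by a map blk from coordinates to block indices
in {1..r}; alpha i is the exponent of block i. Thus A = diag(alpha (blk j))_j.
Points of G_A are pairs (x,t) in real^'n * real.\<close>

type_synonym 'n point = "(real^'n) \<times> real"

text \<open>Norm of a tangent vector v at the point p for the left-invariant metric
diag(e^{-2tA}, 1).\<close>
definition G_norm :: "('n::finite \<Rightarrow> nat) \<Rightarrow> (nat \<Rightarrow> real) \<Rightarrow> 'n point \<Rightarrow> 'n point \<Rightarrow> real" where
  "G_norm blk \<alpha> p v =
     sqrt ((\<Sum>j\<in>UNIV. (exp (- snd p * \<alpha> (blk j)) * (fst v $ j))\<^sup>2) + (snd v)\<^sup>2)"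

definition G_curve :: "(real \<Rightarrow> 'n::finite point) \<Rightarrow> (real \<Rightarrow> 'n point) \<Rightarrow> 'n point \<Rightarrow> 'n point \<Rightarrow> bool" where
  "G_curve c c' p q \<longleftrightarrow> c 0 = p \<and> c 1 = q \<and>
     (\<forall>s\<in>{0..1}. (c has_vector_derivative c' s) (at s within {0..1})) \<and>
     continuous_on {0..1} c'"

definition G_length :: "('n::finite \<Rightarrow> nat) \<Rightarrow> (nat \<Rightarrow> real) \<Rightarrow> (real \<Rightarrow> 'n point) \<Rightarrow> (real \<Rightarrow> 'n point) \<Rightarrow> real" where
  "G_length blk \<alpha> c c' = integral {0..1} (\<lambda>s. G_norm blk \<alpha> (c s) (c' s))"

definition G_dist :: "('n::finite \<Rightarrow> nat) \<Rightarrow> (nat \<Rightarrow> real) \<Rightarrow> 'n point \<Rightarrow> 'n point \<Rightarrow> real" where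
  "G_dist blk \<alpha> p q = Inf {G_length blk \<alpha> c c' | c c'. G_curve c c' p q}"

definition G_gprod :: "('n::finite \<Rightarrow> nat) \<Rightarrow> (nat \<Rightarrow> real) \<Rightarrow> 'n point \<Rightarrow> 'n point \<Rightarrow> 'n point \<Rightarrow> real" where
  "G_gprod blk \<alpha> p a b = (G_dist blk \<alpha> p a + G_dist blk \<alpha> p b - G_dist blk \<alpha> a b) / 2"

text \<open>The ideal boundary, identified as in the context with R^n \<union> {xi_0}:
None is xi_0 and Some x is the endpoint of the vertical geodesic gamma_x at -infinity.\<close>
type_synonym 'n bdry = "(real^'n) option"

abbreviation xi0 :: "'n bdry" where "xi0 \<equiv> None"

text \<open>Representative sequences: points along the vertical geodesics.\<close>
definition bd_rep :: "'n::finite bdry \<Rightarrow> nat \<Rightarrow> 'n point" where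
  "bd_rep \<xi> i = (case \<xi> of None \<Rightarrow> (0, real i) | Some x \<Rightarrow> (x, - real i))"

definition conv_infty :: "('n::finite \<Rightarrow> nat) \<Rightarrow> (nat \<Rightarrow> real) \<Rightarrow> (nat \<Rightarrow> 'n point) \<Rightarrow> bool" where
  "conv_infty blk \<alpha> q \<longleftrightarrow>
     filterlim (\<lambda>(i,j). G_gprod blk \<alpha> (0,0) (q i) (q j)) at_top (sequentially \<times>\<^sub>F sequentially)"

definition conv_to :: "('n::finite \<Rightarrow> nat) \<Rightarrow> (nat \<Rightarrow> real) \<Rightarrow> (nat \<Rightarrow> 'n point) \<Rightarrow> 'n bdry \<Rightarrow> bool" where
  "conv_to blk \<alpha> q \<xi> \<longleftrightarrow> conv_infty blk \<alpha> q \<and>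
     filterlim (\<lambda>(i,j). G_gprod blk \<alpha> (0,0) (q i) (bd_rep \<xi> j)) at_top (sequentially \<times>\<^sub>F sequentially)"

definition bd_gprod :: "('n::finite \<Rightarrow> nat) \<Rightarrow> (nat \<Rightarrow> real) \<Rightarrow> 'n point \<Rightarrow> 'n bdry \<Rightarrow> 'n bdry \<Rightarrow> ereal" where
  "bd_gprod blk \<alpha> p \<xi> \<eta> =
     (SUP xy \<in> {(xs, ys). conv_to blk \<alpha> xs \<xi> \<and> conv_to blk \<alpha> ys \<eta>}.
        Liminf (sequentially \<times>\<^sub>F sequentially)
          (\<lambda>(i,j). ereal (G_gprod blk \<alpha> p (fst xy i) (snd xy j))))"

definition vis_weight :: "real \<Rightarrow> ereal \<Rightarrow> real" where
  "vis_weight \<epsilon> g = (if g = \<infinity> then 0 else exp (- \<epsilon> * real_of_ereal g))"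

definition visual_metric :: "('n::finite \<Rightarrow> nat) \<Rightarrow> (nat \<Rightarrow> real) \<Rightarrow> ('n bdry \<Rightarrow> 'n bdry \<Rightarrow> real) \<Rightarrow> bool" where
  "visual_metric blk \<alpha> d \<longleftrightarrow> Metric_space UNIV d \<and>
     (\<exists>p \<epsilon>. \<epsilon> > 0 \<and> (\<forall>\<xi> \<eta>.
        vis_weight \<epsilon> (bd_gprod blk \<alpha> p \<xi> \<eta>) / 2 \<le> d \<xi> \<eta> \<and>
        d \<xi> \<eta> \<le> vis_weight \<epsilon> (bd_gprod blk \<alpha> p \<xi> \<eta>)))"

definition quasisymmetric :: "('a \<Rightarrow> 'a \<Rightarrow> real) \<Rightarrow> ('a \<Rightarrow> 'a) \<Rightarrow> bool" where
  "quasisymmetric d F \<longleftrightarrow>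
     homeomorphic_map (Metric_space.mtopology UNIV d) (Metric_space.mtopology UNIV d) F \<and>
     (\<exists>\<eta>. (\<exists>\<eta>'. homeomorphism {0..} {0..} \<eta> \<eta>') \<and>
        (\<forall>x y z. x \<noteq> y \<and> x \<noteq> z \<and> y \<noteq> z \<longrightarrow>
           d (F x) (F y) / d (F x) (F z) \<le> \<eta> (d x y / d x z)))"

definition blk_norm :: "('n::finite \<Rightarrow> nat) \<Rightarrow> nat \<Rightarrow> real^'n \<Rightarrow> real" where
  "blk_norm blk i v = sqrt (\<Sum>j\<in>{j. blk j = i}. (v $ j)\<^sup>2)"

definition D_metric :: "('n::finite \<Rightarrow> nat) \<Rightarrow> nat \<Rightarrow> (nat \<Rightarrow> real) \<Rightarrow> real^'n \<Rightarrow> real^'n \<Rightarrow> real" where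
  "D_metric blk r \<alpha> x y = Max ((\<lambda>i. blk_norm blk i (x - y) powr (\<alpha> 1 / \<alpha> i)) ` {1..r})"

end

theory Submission
  imports Defs
begin

text \<open>
  Up to bounded multiplicative error, a visual metric on the boundary is a chordal version of a
  power of D: d(x,y) is comparable to D(x,y)^k d(x,\<open>\<infinity>\<close>) d(y,\<open>\<infinity>\<close>), because the Riemannian distance of
  (x,t) and (y,s) is 2 max(log D(x,y) / \<open>\<alpha>\<^sub>1\<close>, t, s) - t - s up to a bounded error.

  The leaves, which are the translates of the first block, are the directions in which D is not
  snowflaked. A length-area argument shows that F maps leaves into leaves: images of disjoint D-balls
  of radius \<open>\<rho>\<close> contain disjoint balls of comparable size, so the sum of the Q-th powers of their
  sizes is bounded by a volume, while a coordinate of weight s > 1 oscillates by at most the s-th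
  power of the size; averaging over parallel segments, the variation of that coordinate along
  a leaf is O(\<open>\<rho>\<close>^(s-1)). If F moved \<open>\<infinity>\<close>, all leaves would be mapped into the single leaf through
  F(\<open>\<infinity>\<close>), which is absurd.

  Finally, since distinct leaves stay parallel, a quasisymmetric leaf-preserving map distorts each
  scale uniformly, and geodesics inside the leaves make this distortion linear.
\<close>

subsection \<open>The box metric and its leaves\<close>

text \<open>Two obstacles shape the argument. Quasisymmetry is given for the bounded metric
  \<open>d\<close>, the conclusion concerns the unbounded \<open>D\<close>, and the two are
  comparable only away from infinity. As long as F might move infinity, only local estimates are
  available, on sets that stay away from infinity together with their images; the length-area
  argument therefore works in a thin box around one segment. Once infinity is fixed, cross ratios
  give quasisymmetry for \<open>D\<close> itself. A quasisymmetric map compares distances from one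
  centre only. Comparing different centres uses r \<ge> 2: the gap between two leaves is the same
  from all their points, and preservation of leaves carries it to such a gap again.
  \<open>box_dist\<close> takes single coordinates instead of block norms, so that balls are boxes
  of explicit volume; the factor \<open>CARD('n)\<close> lost in this way is absorbed by L. The
  hypotheses are kept symmetric between the map and its inverse, so every estimate can be applied to
  both.\<close>

definition box_dist :: "('n::finite \<Rightarrow> real) \<Rightarrow> real^'n \<Rightarrow> real^'n \<Rightarrow> real" where
  "box_dist \<beta> x y = Max (range (\<lambda>j. \<bar>x $ j - y $ j\<bar> powr (1 / \<beta> j)))"

definition same_leaf :: "('n::finite \<Rightarrow> real) \<Rightarrow> real^'n \<Rightarrow> real^'n \<Rightarrow> bool" where
  "same_leaf \<beta> x y \<longleftrightarrow> (\<forall>j. \<beta> j > 1 \<longrightarrow> x $ j = y $ j)"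

text \<open>Dividing by \<open>a + b\<close> puts both terms into [0,1], where raising to a power at
  most 1 does not decrease a number.\<close>

lemma powr_subadditive:
  fixes a b e :: real
  assumes "0 \<le> a" "0 \<le> b" "0 < e" "e \<le> 1"
  shows "(a + b) powr e \<le> a powr e + b powr e"
proof (cases "a + b = 0")
  case True
  then show ?thesis by simp
next
  case False
  then have s: "a + b > 0" using assms by linarith
  have *: "c / (a + b) \<le> (c / (a + b)) powr e" if "0 \<le> c" "c \<le> a + b" for c
  proof (cases "c = 0")
    case False
    have "(c / (a + b)) powr 1 \<le> (c / (a + b)) powr e"
      using that s assms False by (intro powr_mono') auto
    then show ?thesis using that s by simp
  qed simp
  have "1 = a / (a + b) + b / (a + b)"
    using s by (simp flip: add_divide_distrib)
  also have "\<dots> \<le> (a / (a + b)) powr e + (b / (a + b)) powr e"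
    using *[of a] *[of b] assms by simp
  also have "\<dots> = (a powr e + b powr e) / (a + b) powr e"
    using assms s by (simp add: powr_divide add_divide_distrib)
  finally show ?thesis using s by (simp add: field_simps)
qed

text \<open>Exponents of the dilations multiplying coordinate j by
  \<open>\<rho> powr \<beta> j\<close>, under which \<open>D\<close> is homogeneous of degree 1. The
  bound on \<beta> makes the powers \<open>1 / \<beta> j\<close> subadditive, so that
  \<open>D\<close> is a metric.\<close>

locale dilation =
  fixes \<beta> :: "'n::finite \<Rightarrow> real"
  assumes beta_ge_1: "\<And>j. 1 \<le> \<beta> j"
begin

lemma beta_pos: "0 < \<beta> j"
  using beta_ge_1[of j] by linarith

abbreviation D :: "real^'n \<Rightarrow> real^'n \<Rightarrow> real" where "D \<equiv> box_dist \<beta>"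

abbreviation leafeq :: "real^'n \<Rightarrow> real^'n \<Rightarrow> bool" (infix "\<simeq>" 50) where "x \<simeq> y \<equiv> same_leaf \<beta> x y"

lemma powr_inverse_beta_le_iff:
  assumes "0 \<le> u" "0 \<le> \<rho>"
  shows "u powr (1 / \<beta> j) \<le> \<rho> \<longleftrightarrow> u \<le> \<rho> powr \<beta> j"
proof
  assume "u powr (1 / \<beta> j) \<le> \<rho>"
  then have "(u powr (1 / \<beta> j)) powr \<beta> j \<le> \<rho> powr \<beta> j"
    using beta_pos[of j] by (intro powr_mono2) auto
  then show "u \<le> \<rho> powr \<beta> j"
    using beta_pos[of j] assms by (simp add: powr_powr)
next
  assume "u \<le> \<rho> powr \<beta> j"
  then have "u powr (1 / \<beta> j) \<le> (\<rho> powr \<beta> j) powr (1 / \<beta> j)"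
    using beta_pos[of j] assms by (intro powr_mono2) auto
  then show "u powr (1 / \<beta> j) \<le> \<rho>"
    using beta_pos[of j] assms by (simp add: powr_powr)
qed

lemma powr_inverse_beta_less_iff:
  assumes "0 \<le> u" "0 \<le> \<rho>"
  shows "u powr (1 / \<beta> j) < \<rho> \<longleftrightarrow> u < \<rho> powr \<beta> j"
proof
  assume *: "u powr (1 / \<beta> j) < \<rho>"
  then have "(u powr (1 / \<beta> j)) powr \<beta> j < \<rho> powr \<beta> j"
    using beta_pos[of j] by (intro powr_less_mono2) auto
  then show "u < \<rho> powr \<beta> j"
    using beta_pos[of j] assms by (simp add: powr_powr)
next
  assume "u < \<rho> powr \<beta> j"
  then have "u powr (1 / \<beta> j) < (\<rho> powr \<beta> j) powr (1 / \<beta> j)"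
    using beta_pos[of j] assms by (intro powr_less_mono2) auto
  then show "u powr (1 / \<beta> j) < \<rho>"
    using beta_pos[of j] assms by (simp add: powr_powr)
qed

lemma D_le_iff: "0 \<le> \<rho> \<Longrightarrow> D x y \<le> \<rho> \<longleftrightarrow> (\<forall>j. \<bar>x $ j - y $ j\<bar> \<le> \<rho> powr \<beta> j)"
  by (simp add: box_dist_def powr_inverse_beta_le_iff)

lemma D_less_iff: "0 \<le> \<rho> \<Longrightarrow> D x y < \<rho> \<longleftrightarrow> (\<forall>j. \<bar>x $ j - y $ j\<bar> < \<rho> powr \<beta> j)"
  by (simp add: box_dist_def powr_inverse_beta_less_iff)

lemma coord_le_D: "\<bar>x $ j - y $ j\<bar> powr (1 / \<beta> j) \<le> D x y"
  by (simp add: box_dist_def)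

lemma D_nonneg [simp]: "0 \<le> D x y"
  using coord_le_D[of x undefined y] powr_ge_zero order_trans by blast

lemma coord_le_D_powr: "\<bar>x $ j - y $ j\<bar> \<le> D x y powr \<beta> j"
  using D_le_iff[of "D x y" x y] by simp

lemma D_commute: "D x y = D y x"
  by (simp add: box_dist_def abs_minus_commute)

lemma D_self [simp]: "D x x = 0"
  by (simp add: box_dist_def)

lemma D_eq_0_iff [simp]: "D x y = 0 \<longleftrightarrow> x = y"
  using D_le_iff[of 0 x y] beta_pos by (auto simp: vec_eq_iff intro: antisym)

lemma D_pos_iff: "0 < D x y \<longleftrightarrow> x \<noteq> y"
  using D_eq_0_iff[of x y] D_nonneg[of x y] by linarith

lemma D_triangle: "D x z \<le> D x y + D y z"
proof -
  have "\<bar>x $ j - z $ j\<bar> powr (1 / \<beta> j) \<le> D x y + D y z" for j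
  proof -
    have "\<bar>x $ j - z $ j\<bar> powr (1 / \<beta> j) \<le> (\<bar>x $ j - y $ j\<bar> + \<bar>y $ j - z $ j\<bar>) powr (1 / \<beta> j)"
      using beta_pos[of j] by (intro powr_mono2) auto
    also have "\<dots> \<le> \<bar>x $ j - y $ j\<bar> powr (1 / \<beta> j) + \<bar>y $ j - z $ j\<bar> powr (1 / \<beta> j)"
      using beta_ge_1[of j] by (intro powr_subadditive) auto
    also have "\<dots> \<le> D x y + D y z"
      by (intro add_mono coord_le_D)
    finally show ?thesis .
  qed
  then show ?thesis
    by (subst (1) box_dist_def) simp
qed

lemma D_add_axis:
  assumes "0 \<le> t" shows "D x (x + axis j (t powr \<beta> j)) = t"
proof (rule antisym)
  show "D x (x + axis j (t powr \<beta> j)) \<le> t"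
    using assms by (simp add: D_le_iff axis_def)
  show "t \<le> D x (x + axis j (t powr \<beta> j))"
    using coord_le_D[of x j "x + axis j (t powr \<beta> j)"] assms beta_pos[of j]
    by (simp add: axis_def powr_powr)
qed

lemma same_leaf_sym: "x \<simeq> y \<Longrightarrow> y \<simeq> x"
  and same_leaf_trans: "x \<simeq> y \<Longrightarrow> y \<simeq> z \<Longrightarrow> x \<simeq> z"
  and same_leaf_refl [simp]: "x \<simeq> x"
  by (auto simp: same_leaf_def)

text \<open>A point nearest to x on the leaf of y: coordinates along the leaf are free and are
  copied from x.\<close>

definition leaf_proj :: "real^'n \<Rightarrow> real^'n \<Rightarrow> real^'n" where
  "leaf_proj x y = (\<chi> j. if \<beta> j > 1 then y $ j else x $ j)"

lemma leaf_proj_same_leaf [simp]: "leaf_proj x y \<simeq> y"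
  by (simp add: same_leaf_def leaf_proj_def)

text \<open>Distinct leaves are parallel: the distance to a leaf is the same from all points
  of another leaf.\<close>

lemma D_leaf_proj_le:
  assumes "x \<simeq> x'" "y \<simeq> y'"
  shows "D x (leaf_proj x y) \<le> D x' y'"
proof -
  have "\<bar>x $ j - leaf_proj x y $ j\<bar> \<le> D x' y' powr \<beta> j" for j
    using assms coord_le_D_powr[of x' j y'] by (auto simp: leaf_proj_def same_leaf_def)
  then show ?thesis by (simp add: D_le_iff)
qed

end

section \<open>Leaf-preserving weakly quasisymmetric bijections are bilipschitz\<close>

locale leaf_map = dilation \<beta> for \<beta> :: "'n::finite \<Rightarrow> real" +
  fixes f g :: "real^'n \<Rightarrow> real^'n" and H :: real and i0 j0 :: 'n
  assumes gf [simp]: "\<And>x. g (f x) = x" and fg [simp]: "\<And>x. f (g x) = x"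
    and leaf: "\<And>x y. f x \<simeq> f y \<longleftrightarrow> x \<simeq> y"
    and H1: "1 \<le> H"
    and weak: "\<And>x y z. D x y \<le> D x z \<Longrightarrow> D (f x) (f y) \<le> H * D (f x) (f z)"
    and weak_inv: "\<And>x y z. D x y \<le> D x z \<Longrightarrow> D (g x) (g y) \<le> H * D (g x) (g z)"
    and i0: "\<beta> i0 = 1" and j0: "\<beta> j0 > 1"
begin

lemma leaf_map_inverse: "leaf_map \<beta> g f H i0 j0"
  by unfold_locales (use leaf[of "g _" "g _"] H1 weak weak_inv i0 j0 in auto)

text \<open>The gap between leaves gauges the scale t. The leaf through v and w lies at distance t
  from every point of the leaf of x; its image is a leaf equally far from \<open>f x\<close> and
  \<open>f x'\<close>, and weak quasisymmetry compares both sides with that distance.\<close>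

lemma same_leaf_compare:
  assumes xx': "x \<simeq> x'" and le: "D x y \<le> D x' y'"
  shows "D (f x) (f y) \<le> H\<^sup>2 * D (f x') (f y')"
proof -
  define t where "t = D x y"
  have t0: "t \<ge> 0" by (simp add: t_def)
  define v where "v = x + axis j0 (t powr \<beta> j0)"
  define w where "w = x' + axis j0 (t powr \<beta> j0)"
  have Dxv: "D x v = t" and Dxw: "D x' w = t"
    using t0 by (simp_all add: v_def w_def D_add_axis)
  have vw: "v \<simeq> w"
    using xx' by (auto simp: v_def w_def same_leaf_def)
  \<comment> \<open>Nearest point to \<open>f x\<close> on the image leaf. Its preimage lies on the
    leaf of v, hence at distance at least t from x.\<close>
  define u where "u = leaf_proj (f x) (f w)"
  have "g u \<simeq> w" using leaf[of "g u" w] by (simp add: u_def)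
  then have gu: "g u \<simeq> v" using vw same_leaf_sym same_leaf_trans by blast
  have "x $ j0 - g u $ j0 = - (t powr \<beta> j0)"
    using gu j0 by (simp add: same_leaf_def v_def axis_def)
  then have "t \<le> D x (g u)"
    using coord_le_D[of x j0 "g u"] t0 beta_pos[of j0] by (simp add: powr_powr)
  then have "D (f x) (f y) \<le> H * D (f x) u"
    using weak[of x y "g u"] by (simp add: t_def)
  also have "D (f x) u \<le> D (f x') (f w)"
    unfolding u_def by (rule D_leaf_proj_le) (use xx' leaf in auto)
  also have "D (f x') (f w) \<le> H * D (f x') (f y')"
    using Dxw le by (intro weak) (simp add: t_def)
  finally show ?thesis using H1 by (simp add: power2_eq_square mult.assoc)
qed

text \<open>In direction \<open>i0\<close> the metric is ordinary distance, so k steps of length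
  \<open>D x' y'\<close> add up exactly. Each step starts on the same leaf and costs
  \<open>H\<^sup>2\<close>; the remaining H compares y with the end of the chain.\<close>

lemma chain_compare:
  assumes xx': "x \<simeq> x'" and le: "D x y \<le> real k * D x' y'"
  shows "D (f x) (f y) \<le> real k * H ^ 3 * D (f x') (f y')"
proof -
  define t where "t = D x' y'"
  have t0: "t \<ge> 0" by (simp add: t_def)
  define p where "p m = x + axis i0 (real m * t)" for m :: nat
  have leafp: "p m \<simeq> x'" for m
    using xx' i0 by (auto simp: p_def same_leaf_def axis_def)
  have step: "D (p m) (p (Suc m)) = t" for m
  proof -
    have "p (Suc m) = p m + axis i0 (t powr \<beta> i0)"
      using i0 t0 by (simp add: p_def vec_eq_iff axis_def algebra_simps)
    then show ?thesis using D_add_axis[OF t0] by simp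
  qed
  have chain: "D (f x) (f (p m)) \<le> real m * (H\<^sup>2 * D (f x') (f y'))" for m
  proof (induction m)
    case 0
    have "axis i0 0 = (0 :: real^'n)" by (simp add: axis_def vec_eq_iff)
    then have "p 0 = x" by (simp add: p_def)
    then show ?case by simp
  next
    case (Suc m)
    have "D (f (p m)) (f (p (Suc m))) \<le> H\<^sup>2 * D (f x') (f y')"
      by (rule same_leaf_compare) (use leafp step in \<open>auto simp: t_def\<close>)
    then show ?case
      using Suc D_triangle[of "f x" "f (p (Suc m))" "f (p m)"] by (simp add: algebra_simps)
  qed
  have "D x (p k) = real k * t"
    using D_add_axis[of "real k * t" x i0] t0 i0 by (simp add: p_def)
  then have "D (f x) (f y) \<le> H * D (f x) (f (p k))"
    using le by (intro weak) (simp add: t_def)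
  also have "\<dots> \<le> H * (real k * (H\<^sup>2 * D (f x') (f y')))"
    using chain[of k] H1 by (intro mult_left_mono) auto
  finally show ?thesis by (simp add: power2_eq_square power3_eq_cube mult_ac)
qed

text \<open>The quotient of the distances is at least 1, so rounding it up to a number of steps at
  most doubles it.\<close>

lemma scale_compare:
  assumes xx': "x \<simeq> x'" and ne: "x' \<noteq> y'" and le: "D x' y' \<le> D x y"
  shows "D (f x) (f y) * D x' y' \<le> 2 * H ^ 3 * D (f x') (f y') * D x y"
proof -
  have pos: "D x' y' > 0" using ne D_pos_iff by blast
  define k where "k = nat \<lceil>D x y / D x' y'\<rceil>"
  have q: "D x y / D x' y' \<ge> 1" using le pos by simp
  then have "real k = of_int \<lceil>D x y / D x' y'\<rceil>"
    unfolding k_def by (intro of_nat_nat) linarith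
  then have k: "D x y / D x' y' \<le> real k" "real k \<le> 2 * (D x y / D x' y')"
    using q by linarith+
  have "D x y \<le> real k * D x' y'"
    using k(1) pos by (simp add: field_simps)
  then have "D (f x) (f y) \<le> real k * H ^ 3 * D (f x') (f y')"
    by (rule chain_compare[OF xx'])
  also have "\<dots> \<le> 2 * (D x y / D x' y') * H ^ 3 * D (f x') (f y')"
    using k(2) H1 by (intro mult_right_mono) auto
  finally show ?thesis
    using pos by (simp add: field_simps)
qed

text \<open>Depending on which distances are larger, \<open>scale_compare\<close> applies to f or to
  its inverse. In the remaining case the closer pair has the more distant images, and
  \<open>same_leaf_compare\<close> forward and \<open>chain_compare\<close> backward give
  \<open>H\<^sup>2\<close> and \<open>H ^ 3\<close>.\<close>

lemma ratio_same_leaf: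
  assumes xx': "x \<simeq> x'" and ne: "x \<noteq> y" "x' \<noteq> y'"
  shows "D (f x) (f y) / D x y \<le> 2 * H ^ 5 * (D (f x') (f y') / D x' y')"
proof -
  interpret inv: leaf_map \<beta> g f H i0 j0 by (rule leaf_map_inverse)
  have inj: "f a = f b \<longleftrightarrow> a = b" for a b using gf by metis
  have pos: "D x y > 0" "D x' y' > 0" "D (f x) (f y) > 0" "D (f x') (f y') > 0"
    using ne inj D_pos_iff by auto
  have fl: "f x' \<simeq> f x" using xx' leaf same_leaf_sym by blast
  have H35: "H ^ 3 \<le> H ^ 5" using H1 by (intro power_increasing) auto
  have "D (f x) (f y) * D x' y' \<le> 2 * H ^ 5 * (D (f x') (f y') * D x y)"
  proof (cases "D x' y' \<le> D x y \<or> D (f x) (f y) \<le> D (f x') (f y')")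
    case True
    then have "D (f x) (f y) * D x' y' \<le> 2 * H ^ 3 * (D (f x') (f y') * D x y)"
      using scale_compare[OF xx' ne(2)] inv.scale_compare[OF fl, of "f y" "f y'"] ne inj
      by (auto simp: mult_ac)
    also have "\<dots> \<le> 2 * H ^ 5 * (D (f x') (f y') * D x y)"
      using H35 pos by (intro mult_right_mono) auto
    finally show ?thesis .
  next
    case False
    then have 1: "D (f x) (f y) \<le> H\<^sup>2 * D (f x') (f y')"
      using same_leaf_compare[OF xx'] by simp
    have 2: "D x' y' \<le> H ^ 3 * D x y"
      using inv.chain_compare[OF fl, of "f y'" 1 "f y"] False by simp
    have "D (f x) (f y) * D x' y' \<le> (H\<^sup>2 * D (f x') (f y')) * (H ^ 3 * D x y)"
      using 1 2 pos H1 by (intro mult_mono) auto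
    also have "\<dots> = H ^ 5 * (D (f x') (f y') * D x y)"
      by (simp add: eval_nat_numeral)
    also have "\<dots> \<le> 2 * H ^ 5 * (D (f x') (f y') * D x y)"
      using pos H1 by (intro mult_right_mono) auto
    finally show ?thesis .
  qed
  then show ?thesis using pos by (simp add: field_simps)
qed

text \<open>The pair of x and its nearest point on the other leaf can be read from either end, which
  moves the base point to the leaf of x'.\<close>

lemma ratio_other_leaf:
  assumes xx': "\<not> x \<simeq> x'"
  obtains y y' where "x \<noteq> y" "x' \<noteq> y'"
    "D (f x) (f y) / D x y \<le> H ^ 3 * (D (f x') (f y') / D x' y')"
proof -
  define x'' where "x'' = leaf_proj x x'"
  define t where "t = D x x''"
  have l: "x'' \<simeq> x'" by (simp add: x''_def)
  then have ne: "x \<noteq> x''" using xx' by auto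
  then have tp: "t > 0" unfolding t_def using D_pos_iff by blast
  define y' where "y' = x' + axis i0 (t powr \<beta> i0)"
  have D': "D x' y' = t" using tp by (simp add: y'_def D_add_axis)
  have "D (f x) (f x'') = D (f x'') (f x)" by (rule D_commute)
  also have "\<dots> \<le> H\<^sup>2 * D (f x') (f y')"
    by (rule same_leaf_compare[OF l]) (simp add: D' t_def D_commute)
  also have "\<dots> \<le> H ^ 3 * D (f x') (f y')"
    using H1 by (intro mult_right_mono power_increasing) auto
  finally have "D (f x) (f x'') / t \<le> H ^ 3 * D (f x') (f y') / t"
    using tp by (simp add: divide_right_mono)
  moreover have "x' \<noteq> y'" using D' tp D_pos_iff by metis
  ultimately show ?thesis
    using that[of x'' y'] ne D' by (simp add: t_def)
qed

theorem bilipschitz: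
  "\<exists>L\<ge>1. \<forall>x y. D x y / L \<le> D (f x) (f y) \<and> D (f x) (f y) \<le> L * D x y"
proof -
  define q where "q x y = D (f x) (f y) / D x y" for x y
  \<comment> \<open>Same leaf, change of leaf, same leaf: the factors of three comparisons.\<close>
  define C where "C = (2 * H ^ 5)\<^sup>2 * H ^ 3"
  have H5: "1 \<le> 2 * H ^ 5" and H3: "1 \<le> H ^ 3"
    using one_le_power[OF H1, of 5] one_le_power[OF H1, of 3] by linarith+
  have C1: "2 * H ^ 5 \<le> C"
  proof -
    have "2 * H ^ 5 * 1 * 1 \<le> 2 * H ^ 5 * (2 * H ^ 5) * H ^ 3"
      using H5 H3 H1 by (intro mult_mono) auto
    then show ?thesis by (simp add: C_def power2_eq_square)
  qed
  have q0: "q x y \<ge> 0" for x y by (simp add: q_def)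
  have compare: "q x y \<le> C * q x' y'" if ne: "x \<noteq> y" "x' \<noteq> y'" for x y x' y'
  proof (cases "x \<simeq> x'")
    case True
    then have "q x y \<le> 2 * H ^ 5 * q x' y'"
      unfolding q_def by (rule ratio_same_leaf) (use ne in auto)
    also have "\<dots> \<le> C * q x' y'" using C1 q0 by (intro mult_right_mono)
    finally show ?thesis .
  next
    case False
    then obtain z z' where z: "x \<noteq> z" "x' \<noteq> z'" "q x z \<le> H ^ 3 * q x' z'"
      unfolding q_def by (rule ratio_other_leaf)
    have "q x y \<le> 2 * H ^ 5 * q x z"
      unfolding q_def by (rule ratio_same_leaf) (use ne z in auto)
    also have "\<dots> \<le> 2 * H ^ 5 * (H ^ 3 * q x' z')"
      using z H1 by (intro mult_left_mono) auto
    also have "\<dots> \<le> 2 * H ^ 5 * (H ^ 3 * (2 * H ^ 5 * q x' y'))"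
      unfolding q_def using H1 z ne
      by (intro mult_left_mono ratio_same_leaf) auto
    finally show ?thesis by (simp add: C_def power2_eq_square mult_ac)
  qed
  \<comment> \<open>All quotients agree up to C, so the quotient of one arbitrary pair determines
    L.\<close>
  define a where "a = (0 :: real^'n)"
  define b where "b = a + axis i0 1"
  have ab: "a \<noteq> b"
    by (auto simp: a_def b_def vec_eq_iff axis_def)
  then have qab: "q a b > 0"
    unfolding q_def using gf D_pos_iff by (metis divide_pos_pos)
  have Cpos: "C > 0" using C1 H5 by linarith
  define L where "L = max 1 (max (C * q a b) (C / q a b))"
  have "D x y / L \<le> D (f x) (f y) \<and> D (f x) (f y) \<le> L * D x y" for x y
  proof (cases "x = y")
    case False
    then have pos: "D x y > 0" using D_pos_iff by blast
    have 1: "D (f x) (f y) = q x y * D x y" using pos by (simp add: q_def)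
    have 2: "q x y \<le> L" using compare[OF False ab] by (simp add: L_def)
    have "q a b / C \<le> q x y"
      using compare[OF ab False] Cpos by (simp add: field_simps)
    moreover have "1 / L \<le> q a b / C"
    proof -
      have "C / q a b \<le> L" by (simp add: L_def)
      then show ?thesis using qab Cpos by (simp add: L_def field_simps max_def split: if_splits)
    qed
    ultimately have 3: "1 / L \<le> q x y" by linarith
    show ?thesis
      using mult_right_mono[OF 2, of "D x y"] mult_right_mono[OF 3, of "D x y"] pos
      unfolding 1 by simp
  qed simp
  moreover have "L \<ge> 1" by (simp add: L_def)
  ultimately show ?thesis by blast
qed

end

subsection \<open>Length-area argument\<close>

lemma half_le_floor:
  fixes v :: real
  assumes "1 \<le> v"
  shows "v / 2 \<le> of_int \<lfloor>v\<rfloor>"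
proof -
  have "1 \<le> \<lfloor>v\<rfloor>" using assms by simp
  then have "1 \<le> real_of_int \<lfloor>v\<rfloor>" by linarith
  then show ?thesis using floor_correct[of v] by linarith
qed

context dilation
begin

text \<open>The homogeneous dimension: a \<open>D\<close>-ball of radius l has volume a constant
  times \<open>l powr Q\<close>.\<close>

definition Q where "Q = (\<Sum>j\<in>UNIV. \<beta> j)"

lemma D_ball_eq_box:
  assumes "0 \<le> l"
  shows "{w. D y w < l} = box (y - (\<chi> j. l powr \<beta> j)) (y + (\<chi> j. l powr \<beta> j))"
proof -
  have "\<bar>y $ j - w $ j\<bar> < l powr \<beta> j \<longleftrightarrow> y $ j - l powr \<beta> j < w $ j \<and> w $ j < y $ j + l powr \<beta> j" for w j
    by linarith
  then show ?thesis using assms by (auto simp: D_less_iff mem_box_cart)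
qed

lemma measure_D_ball:
  assumes "0 < l"
  shows "measure lborel {w. D y w < l} = 2 ^ CARD('n) * l powr Q"
proof -
  have "measure lborel {w. D y w < l} =
      measure lborel (cbox (y - (\<chi> j. l powr \<beta> j)) (y + (\<chi> j. l powr \<beta> j)))"
    using assms by (simp add: D_ball_eq_box measure_lborel_box_eq measure_lborel_cbox_eq)
  also have "\<dots> = (\<Prod>j\<in>UNIV. 2 * l powr \<beta> j)"
    by (subst content_cbox_cart) (auto simp: interval_ne_empty_cart intro!: prod.cong)
  also have "\<dots> = 2 ^ CARD('n) * l powr Q"
    using assms by (simp add: prod.distrib Q_def powr_sum)
  finally show ?thesis .
qed

text \<open>\<open>S\<close> carries the grid of centres and \<open>N\<close> contains all balls
  used. \<open>ball\<close> is the roundness of images: the image of a \<rho>-ball contains a ball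
  of radius l, and grid neighbours move by at most \<open>H * l\<close>. \<open>gap\<close> forces
  each row of the grid to change coordinate \<open>j0\<close> by c, for arbitrarily fine
  grids.\<close>

lemma length_area_contradiction:
  fixes f :: "real^'n \<Rightarrow> real^'n" and p :: "real^'n" and S N :: "(real^'n) set"
  assumes a: "0 < a" and \<delta>: "0 < \<delta>" and c: "0 < c" and H: "0 \<le> H" and \<rho>0: "0 < \<rho>0"
    and i0: "\<beta> i0 = 1" and j0: "1 < \<beta> j0"
    and S: "\<And>x. p $ i0 \<le> x $ i0 \<Longrightarrow> x $ i0 \<le> p $ i0 + a \<Longrightarrow>
              (\<And>j. j \<noteq> i0 \<Longrightarrow> p $ j \<le> x $ j \<and> x $ j \<le> p $ j + \<delta>) \<Longrightarrow> x \<in> S"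
    and N: "\<And>x z. x \<in> S \<Longrightarrow> D x z < \<rho>0 \<Longrightarrow> z \<in> N"
    and inj: "inj_on f N"
    and bdd: "\<And>z j. z \<in> N \<Longrightarrow> \<bar>f z $ j\<bar> \<le> R"
    and ball: "\<And>x \<rho>. x \<in> S \<Longrightarrow> 0 < \<rho> \<Longrightarrow> \<rho> < \<rho>0 \<Longrightarrow> \<exists>l>0.
                 (\<forall>w. D (f x) w < l \<longrightarrow> (\<exists>z. D x z < \<rho> \<and> w = f z)) \<and>
                 (\<forall>y\<in>S. D x y \<le> 2 * \<rho> \<longrightarrow> D (f x) (f y) \<le> H * l)"
    and gap: "\<And>x. x $ i0 = p $ i0 \<Longrightarrow> (\<And>j. j \<noteq> i0 \<Longrightarrow> p $ j \<le> x $ j \<and> x $ j \<le> p $ j + \<delta>) \<Longrightarrow>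
                c \<le> \<bar>f (x + axis i0 a) $ j0 - f x $ j0\<bar>"
  shows False
proof -
  define s where "s = \<beta> j0"
  define V where "V = (2 * R) ^ CARD('n)"
  \<comment> \<open>What the final estimate leaves in front of \<open>\<rho> powr (s - 1)\<close>:
    the first summand comes from radii l at most \<rho>, the second from the volume bound.\<close>
  define K where "K = H powr s * (a / 2 + V / 2 ^ CARD('n) / (\<delta> / 4) ^ (CARD('n) - 1))"
  have s1: "1 < s" by (simp add: s_def j0)
  have sQ: "s \<le> Q"
    unfolding Q_def s_def using beta_pos by (intro member_le_sum) (auto intro: less_imp_le)
  have "(\<lambda>M. a / 2 * inverse (real M)) \<longlonglongrightarrow> a / 2 * 0"
    by (intro tendsto_mult tendsto_const lim_inverse_n)
  then have lim: "(\<lambda>M. a / (2 * real M)) \<longlonglongrightarrow> 0"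
    by (simp add: inverse_eq_divide)
  have "(\<lambda>M. K * (a / (2 * real M)) powr (s - 1)) \<longlonglongrightarrow> K * 0"
    using s1 a by (intro tendsto_mult_left tendsto_zero_powrI[OF lim tendsto_const]) auto
  then have "eventually (\<lambda>M. K * (a / (2 * real M)) powr (s - 1) < c) sequentially"
    using c by (intro order_tendstoD(2)) auto
  moreover have "eventually (\<lambda>M. a / (2 * real M) < min \<rho>0 (min 1 (\<delta> / 2))) sequentially"
    using lim \<rho>0 \<delta> by (intro order_tendstoD(2)) auto
  moreover have "eventually (\<lambda>M. M > (0::nat)) sequentially"
    by (rule eventually_gt_at_top)
  ultimately have "eventually (\<lambda>M. K * (a / (2 * real M)) powr (s - 1) < c \<and>
      a / (2 * real M) < min \<rho>0 (min 1 (\<delta> / 2)) \<and> M > 0) sequentially"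
    by eventually_elim auto
  then obtain M where M: "K * (a / (2 * real M)) powr (s - 1) < c"
      "a / (2 * real M) < min \<rho>0 (min 1 (\<delta> / 2))" "M > 0"
    using eventually_happens sequentially_bot by blast
  \<comment> \<open>M steps of length \<open>2 * \<rho>\<close> cover the segment of length a
    exactly.\<close>
  define \<rho> where "\<rho> = a / (2 * real M)"
  have \<rho>: "0 < \<rho>" "\<rho> < \<rho>0" "\<rho> < 1" "2 * \<rho> < \<delta>"
    using M a by (auto simp: \<rho>_def)
  have M\<rho>: "real M * \<rho> = a / 2" using M(3) by (simp add: \<rho>_def)
  have r: "0 < \<rho> powr \<beta> j" "\<rho> powr \<beta> j \<le> \<rho>" for j
    using \<rho> powr_mono'[of 1 "\<beta> j" \<rho>] beta_ge_1[of j] by auto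
  \<comment> \<open>Number of ball widths that fit into \<delta>, positive because
    \<open>\<rho> < 1\<close> and \<open>2 * \<rho> < \<delta>\<close>. Rounding down costs a factor
    of 2, whence \<delta>/4 below.\<close>
  define m where "m j = nat \<lfloor>\<delta> / (2 * \<rho> powr \<beta> j)\<rfloor>" for j
  have m: "real (m j) * (2 * \<rho> powr \<beta> j) \<le> \<delta>" "\<delta> / 4 * \<rho> powr (- \<beta> j) \<le> real (m j)" for j
  proof -
    have ge1: "1 \<le> \<delta> / (2 * \<rho> powr \<beta> j)" using r[of j] \<rho> by (simp add: field_simps)
    then have fl: "real (m j) = of_int \<lfloor>\<delta> / (2 * \<rho> powr \<beta> j)\<rfloor>"
      unfolding m_def by (intro of_nat_nat) linarith
    have "real (m j) \<le> \<delta> / (2 * \<rho> powr \<beta> j)" unfolding fl by linarith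
    then show "real (m j) * (2 * \<rho> powr \<beta> j) \<le> \<delta>"
      using r(1)[of j] by (simp add: field_simps)
    have "\<delta> / (2 * \<rho> powr \<beta> j) / 2 \<le> real (m j)"
      unfolding fl using ge1 by (rule half_le_floor)
    then show "\<delta> / 4 * \<rho> powr (- \<beta> j) \<le> real (m j)"
      by (simp add: powr_minus_divide)
  qed
  define P where "P = PiE (UNIV - {i0}) (\<lambda>j. {..<m j})"
  define J where "J = {..<M} \<times> P"
  \<comment> \<open>Centres two radii apart in each coordinate, so that the open balls are disjoint;
    \<mu> selects the row and k the position in it.\<close>
  define ctr where "ctr = (\<lambda>(k, \<mu>). \<chi> j. if j = i0 then p $ j + 2 * \<rho> * real k
                                         else p $ j + 2 * \<rho> powr \<beta> j * real (\<mu> j))"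
  have finP: "finite P" by (simp add: P_def finite_PiE)
  then have finJ: "finite J" by (simp add: J_def)
  have cardP: "real (card P) = (\<Prod>j\<in>UNIV - {i0}. real (m j))"
    by (simp add: P_def card_PiE)
  have \<mu>: "\<mu> j < m j" if "\<mu> \<in> P" "j \<noteq> i0" for \<mu> j
    using that by (auto simp: P_def dest: PiE_mem)
  have ctr_bd: "p $ j \<le> ctr (k, \<mu>) $ j \<and> ctr (k, \<mu>) $ j \<le> p $ j + \<delta>" if "\<mu> \<in> P" "j \<noteq> i0" for k \<mu> j
  proof -
    have "2 * \<rho> powr \<beta> j * real (\<mu> j) \<le> 2 * \<rho> powr \<beta> j * real (m j)"
      using \<mu>[OF that] r(1)[of j] by (intro mult_left_mono) auto
    also have "\<dots> \<le> \<delta>" using m(1)[of j] by (simp only: mult.commute)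
    finally have "2 * \<rho> powr \<beta> j * real (\<mu> j) \<le> \<delta>" .
    moreover have "0 \<le> 2 * \<rho> powr \<beta> j * real (\<mu> j)" by simp
    ultimately show ?thesis using that by (simp add: ctr_def)
  qed
  have ctrS: "ctr (k, \<mu>) \<in> S" if "k \<le> M" "\<mu> \<in> P" for k \<mu>
  proof (rule S)
    show "p $ i0 \<le> ctr (k, \<mu>) $ i0" using \<rho> by (simp add: ctr_def)
    have "\<rho> * real k \<le> \<rho> * real M" using that \<rho> by (intro mult_left_mono) auto
    then show "ctr (k, \<mu>) $ i0 \<le> p $ i0 + a" using M\<rho> by (simp add: ctr_def mult_ac)
  qed (use ctr_bd that in auto)
  have "\<forall>x\<in>S. \<exists>l>0. (\<forall>w. D (f x) w < l \<longrightarrow> (\<exists>z. D x z < \<rho> \<and> w = f z)) \<and>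
                 (\<forall>y\<in>S. D x y \<le> 2 * \<rho> \<longrightarrow> D (f x) (f y) \<le> H * l)"
    using ball \<rho> by blast
  then obtain l where l: "\<And>x. x \<in> S \<Longrightarrow> l x > 0"
      "\<And>x w. x \<in> S \<Longrightarrow> D (f x) w < l x \<Longrightarrow> \<exists>z. D x z < \<rho> \<and> w = f z"
      "\<And>x y. x \<in> S \<Longrightarrow> y \<in> S \<Longrightarrow> D x y \<le> 2 * \<rho> \<Longrightarrow> D (f x) (f y) \<le> H * l x"
    by (metis (no_types, lifting))
  define B where "B q = {w. D (f (ctr q)) w < l (ctr q)}" for q
  have JS: "ctr q \<in> S" if "q \<in> J" for q
    using that ctrS by (auto simp: J_def)
  have volume: "(\<Sum>q\<in>J. l (ctr q) powr Q) \<le> V / 2 ^ CARD('n)"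
  proof -
    have Bbox: "B q = box (f (ctr q) - (\<chi> j. l (ctr q) powr \<beta> j)) (f (ctr q) + (\<chi> j. l (ctr q) powr \<beta> j))"
      if "q \<in> J" for q
      unfolding B_def using l(1)[OF JS[OF that]] by (intro D_ball_eq_box) simp
    have disj: "disjoint_family_on B J"
    proof (unfold disjoint_family_on_def, intro ballI impI)
      fix q q' assume q: "q \<in> J" "q' \<in> J" "q \<noteq> q'"
      show "B q \<inter> B q' = {}"
      proof (rule ccontr)
        assume "B q \<inter> B q' \<noteq> {}"
        then obtain w where "D (f (ctr q)) w < l (ctr q)" "D (f (ctr q')) w < l (ctr q')"
          by (auto simp: B_def)
        \<comment> \<open>Injectivity turns a common image point into a common point of two grid
          balls, and grid centres closer than two radii in every coordinate coincide.\<close>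
        then obtain z z' where z: "D (ctr q) z < \<rho>" "w = f z" "D (ctr q') z' < \<rho>" "w = f z'"
          using l(2)[OF JS] q by metis
        have "z \<in> N" "z' \<in> N" using N[OF JS] z q \<rho> by fastforce+
        then have "z = z'" using inj z by (auto simp: inj_on_def)
        then have "\<forall>j. \<bar>ctr q $ j - z $ j\<bar> < \<rho> powr \<beta> j" "\<forall>j. \<bar>ctr q' $ j - z $ j\<bar> < \<rho> powr \<beta> j"
          using z(1,3) \<rho>(1) by (auto simp: D_less_iff)
        then have less: "\<bar>ctr q $ j - ctr q' $ j\<bar> < 2 * \<rho> powr \<beta> j" for j
          by (smt (verit, best))
        obtain k \<mu> k' \<mu>' where kk: "q = (k, \<mu>)" "q' = (k', \<mu>')" by fastforce
        have sep: "u = u'" if "\<bar>2 * e * real u - 2 * e * real u'\<bar> < 2 * e" "e > 0" for e and u u' :: nat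
        proof -
          have "2 * e * \<bar>real u - real u'\<bar> < 2 * e * 1"
            using that by (simp add: abs_mult flip: right_diff_distrib)
          then have "\<bar>real u - real u'\<bar> < 1" using that(2) by simp
          then show ?thesis by linarith
        qed
        have "k = k'" using less[of i0] i0 \<rho> by (intro sep[of \<rho>]) (auto simp: kk ctr_def)
        moreover have "\<mu> j = \<mu>' j" for j
        proof (cases "j = i0")
          case True
          then show ?thesis using q by (auto simp: kk J_def P_def PiE_def extensional_def)
        next
          case False
          then show ?thesis
            using less[of j] r(1)[of j] by (intro sep[of "\<rho> powr \<beta> j"]) (auto simp: kk ctr_def)
        qed
        ultimately show False using q kk by auto
      qed
    qed
    have sub: "(\<Union>q\<in>J. B q) \<subseteq> cbox (\<chi> j. - R) (\<chi> j. R)"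
    proof
      fix w assume "w \<in> (\<Union>q\<in>J. B q)"
      then obtain q where q: "q \<in> J" "D (f (ctr q)) w < l (ctr q)" by (auto simp: B_def)
      then obtain z where "D (ctr q) z < \<rho>" "w = f z" using l(2) JS by blast
      then show "w \<in> cbox (\<chi> j. - R) (\<chi> j. R)"
        using bdd[OF N[OF JS[OF q(1)]], of z] \<rho> by (auto simp: mem_box_cart abs_le_iff minus_le_iff)
    qed
    have "2 ^ CARD('n) * (\<Sum>q\<in>J. l (ctr q) powr Q) = (\<Sum>q\<in>J. measure lborel (B q))"
      unfolding sum_distrib_left B_def using l(1)[OF JS] by (intro sum.cong) (simp_all add: measure_D_ball)
    also have "\<dots> = measure lborel (\<Union>q\<in>J. B q)"
      using Bbox disj finJ by (intro measure_finite_Union[symmetric]) (auto simp: emeasure_lborel_box_eq)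
    also have "\<dots> \<le> measure lborel (cbox (\<chi> j. - R) (\<chi> j. R) :: (real^'n) set)"
      using sub Bbox finJ by (intro measure_mono_fmeasurable) auto
    also have "\<dots> \<le> V"
    proof (cases "0 \<le> R")
      case True
      then show ?thesis
        by (subst content_cbox_cart) (auto simp: interval_ne_empty_cart V_def)
    next
      case False
      then have "cbox (\<chi> j. - R) (\<chi> j. R) = ({} :: (real^'n) set)" by (auto simp: interval_eq_empty_cart)
      \<comment> \<open>A negative bound R cannot occur, since p lies in \<open>N\<close>.\<close>
      moreover have "p \<in> S" using a \<delta> by (intro S) auto
      then have "0 \<le> R" using bdd[OF N[of p p], of i0] \<rho>0 by simp
      ultimately show ?thesis using False by simp
    qed
    finally show ?thesis by (simp add: field_simps)
  qed
  have "c \<le> (\<Sum>k<M. (H * l (ctr (k, \<mu>))) powr s)" if \<mu>P: "\<mu> \<in> P" for \<mu>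
  proof -
    define u where "u k = f (ctr (k, \<mu>)) $ j0" for k
    have "ctr (M, \<mu>) = ctr (0, \<mu>) + axis i0 a"
      using M\<rho> by (auto simp: vec_eq_iff ctr_def axis_def mult_ac)
    then have "c \<le> \<bar>u M - u 0\<bar>"
      using gap[of "ctr (0, \<mu>)"] ctr_bd[OF \<mu>P, of _ 0] by (simp add: u_def) (simp add: ctr_def)
    also have "u M - u 0 = (\<Sum>k<M. u (Suc k) - u k)" by (simp add: sum_lessThan_telescope)
    also have "\<bar>\<dots>\<bar> \<le> (\<Sum>k<M. \<bar>u (Suc k) - u k\<bar>)" by (rule sum_abs)
    also have "\<dots> \<le> (\<Sum>k<M. (H * l (ctr (k, \<mu>))) powr s)"
    proof (rule sum_mono)
      fix k assume k: "k \<in> {..<M}"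
      have "ctr (Suc k, \<mu>) = ctr (k, \<mu>) + axis i0 ((2 * \<rho>) powr \<beta> i0)"
        using i0 \<rho> by (auto simp: vec_eq_iff ctr_def axis_def algebra_simps)
      then have "D (ctr (k, \<mu>)) (ctr (Suc k, \<mu>)) = 2 * \<rho>"
        using D_add_axis[of "2 * \<rho>"] \<rho> by simp
      then have "D (f (ctr (k, \<mu>))) (f (ctr (Suc k, \<mu>))) \<le> H * l (ctr (k, \<mu>))"
        using k \<mu>P by (intro l(3) ctrS) auto
      then have "D (f (ctr (k, \<mu>))) (f (ctr (Suc k, \<mu>))) powr s \<le> (H * l (ctr (k, \<mu>))) powr s"
        using s1 by (intro powr_mono2) auto
      then show "\<bar>u (Suc k) - u k\<bar> \<le> (H * l (ctr (k, \<mu>))) powr s"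
        using coord_le_D_powr[of "f (ctr (k, \<mu>))" j0 "f (ctr (Suc k, \<mu>))"]
        by (simp add: u_def s_def abs_minus_commute)
    qed
    finally show ?thesis .
  qed
  then have "(\<Sum>\<mu>\<in>P. c) \<le> (\<Sum>\<mu>\<in>P. \<Sum>k<M. (H * l (ctr (k, \<mu>))) powr s)"
    by (rule sum_mono)
  also have "\<dots> = (\<Sum>q\<in>J. (H * l (ctr q)) powr s)"
    unfolding J_def by (subst sum.swap) (simp add: sum.cartesian_product)
  also have "\<dots> \<le> (\<Sum>q\<in>J. H powr s * (\<rho> powr s + \<rho> powr (s - Q) * l (ctr q) powr Q))"
  proof (rule sum_mono)
    fix q assume "q \<in> J"
    then have lp: "l (ctr q) > 0" using l(1) JS by blast
    \<comment> \<open>Elementary replacement for Hoelder's inequality: small radii are bounded by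
      \<rho>, and for large ones \<open>s - Q\<close> is nonpositive, so part of the power is traded
      for \<rho>.\<close>
    have "l (ctr q) powr s \<le> \<rho> powr s + \<rho> powr (s - Q) * l (ctr q) powr Q"
    proof (cases "l (ctr q) \<le> \<rho>")
      case True
      then have "l (ctr q) powr s \<le> \<rho> powr s" using lp s1 by (intro powr_mono2) auto
      then show ?thesis by (simp add: add_increasing2)
    next
      case False
      have "l (ctr q) powr s = l (ctr q) powr (s - Q) * l (ctr q) powr Q"
        by (simp flip: powr_add)
      also have "\<dots> \<le> \<rho> powr (s - Q) * l (ctr q) powr Q"
        using False \<rho> sQ lp by (intro mult_right_mono powr_mono2') auto
      finally show ?thesis by (simp add: add_increasing)
    qed
    then show "(H * l (ctr q)) powr s \<le> H powr s * (\<rho> powr s + \<rho> powr (s - Q) * l (ctr q) powr Q)"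
      using H lp by (simp add: powr_mult mult_left_mono)
  qed
  also have "\<dots> = H powr s * (real (card J) * \<rho> powr s + \<rho> powr (s - Q) * (\<Sum>q\<in>J. l (ctr q) powr Q))"
    by (simp add: sum.distrib flip: sum_distrib_left)
  also have "\<dots> \<le> H powr s * (real (card J) * \<rho> powr s + \<rho> powr (s - Q) * (V / 2 ^ CARD('n)))"
    using volume by (intro mult_left_mono add_left_mono) auto
  also have "\<dots> \<le> card P * (K * \<rho> powr (s - 1))"
  proof -
    have \<rho>s: "\<rho> powr s = \<rho> * \<rho> powr (s - 1)" using \<rho> by (simp add: powr_diff)
    have 1: "real (card J) * \<rho> powr s = card P * (a / 2 * \<rho> powr (s - 1))"
      using M\<rho> unfolding \<rho>s by (simp add: J_def card_cartesian_product mult_ac)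
    \<comment> \<open>Counts the rows. Direction \<open>i0\<close> has weight 1, which leaves the
      exponent \<open>1 - Q\<close> for the other coordinates.\<close>
    have "(\<delta> / 4) ^ (CARD('n) - 1) * \<rho> powr (1 - Q) = (\<Prod>j\<in>UNIV - {i0}. \<delta> / 4 * \<rho> powr (- \<beta> j))"
    proof -
      have "1 - Q = (\<Sum>j\<in>UNIV - {i0}. - \<beta> j)"
        using i0 by (simp add: Q_def sum.remove[of UNIV i0] sum_negf)
      then show ?thesis unfolding prod.distrib using \<rho> by (simp add: powr_sum)
    qed
    also have "\<dots> \<le> card P"
      unfolding cardP using m(2) \<delta> by (intro prod_mono) auto
    finally have "\<rho> powr (1 - Q) \<le> card P / (\<delta> / 4) ^ (CARD('n) - 1)"
      using \<delta> by (simp add: field_simps)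
    then have "\<rho> powr (s - 1) * \<rho> powr (1 - Q) \<le> \<rho> powr (s - 1) * (card P / (\<delta> / 4) ^ (CARD('n) - 1))"
      by (intro mult_left_mono) auto
    then have 2: "\<rho> powr (s - Q) \<le> \<rho> powr (s - 1) * (card P / (\<delta> / 4) ^ (CARD('n) - 1))"
      by (simp flip: powr_add)
    have "0 \<le> (\<Sum>q\<in>J. l (ctr q) powr Q)" by (intro sum_nonneg) auto
    then have V0: "0 \<le> V / 2 ^ CARD('n)" using volume by linarith
    have "H powr s * (real (card J) * \<rho> powr s + \<rho> powr (s - Q) * (V / 2 ^ CARD('n))) \<le>
      H powr s * (card P * (a / 2 * \<rho> powr (s - 1)) +
         \<rho> powr (s - 1) * (card P / (\<delta> / 4) ^ (CARD('n) - 1)) * (V / 2 ^ CARD('n)))"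
      unfolding 1 by (intro mult_left_mono add_left_mono mult_right_mono[OF 2 V0]) auto
    also have "\<dots> = card P * (K * \<rho> powr (s - 1))"
      unfolding K_def by (simp add: algebra_simps)
    finally show ?thesis .
  qed
  finally have "card P * c \<le> card P * (K * \<rho> powr (s - 1))" by simp
  moreover have "card P > 0"
  proof -
    have "0 < \<delta> / 4 * \<rho> powr (- \<beta> j)" for j using \<delta> \<rho> by simp
    then have "0 < real (m j)" for j using m(2)[of j] by (rule less_le_trans)
    then have "0 < real (card P)" unfolding cardP by (intro prod_pos) auto
    then show ?thesis by simp
  qed
  ultimately have "c \<le> K * \<rho> powr (s - 1)" by simp
  then show False using M(1) by (simp add: \<rho>_def)
qed

end

subsection \<open>Quasisymmetric maps of the chordal compactification\<close>

text \<open>Every constant C is allowed and not only 1, because passing between \<open>d\<close> and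
  \<open>D\<close> costs a factor before the map is applied.\<close>

definition weakly_qs :: "('a \<Rightarrow> 'a \<Rightarrow> real) \<Rightarrow> ('a \<Rightarrow> 'a) \<Rightarrow> bool" where
  "weakly_qs d F \<longleftrightarrow>
     (\<forall>C. \<exists>H\<ge>1. \<forall>x y z. d x y \<le> C * d x z \<longrightarrow> d (F x) (F y) \<le> H * d (F x) (F z))"

definition eps_cont :: "('a \<Rightarrow> 'a \<Rightarrow> real) \<Rightarrow> ('a \<Rightarrow> 'a) \<Rightarrow> bool" where
  "eps_cont d F \<longleftrightarrow> (\<forall>a. \<forall>\<epsilon>>0. \<exists>\<delta>>0. \<forall>x. d a x < \<delta> \<longrightarrow> d (F a) (F x) < \<epsilon>)"

lemma powr_le_scaleD:
  fixes u v c \<kappa> :: real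
  assumes "0 \<le> u" "0 \<le> v" "0 \<le> c" "0 < \<kappa>" "u powr \<kappa> \<le> c * v powr \<kappa>"
  shows "u \<le> c powr (1 / \<kappa>) * v"
proof -
  have "(u powr \<kappa>) powr (1 / \<kappa>) \<le> (c * v powr \<kappa>) powr (1 / \<kappa>)"
    using assms by (intro powr_mono2) auto
  then show ?thesis using assms by (simp add: powr_powr powr_mult)
qed

text \<open>Here a, b and c, e are opposite sides of a quadrilateral. A product is minimum times
  maximum, and if the minimum of a, b were too large, the triangle inequality would make the maximum
  of c, e at most three times that of a, b.\<close>

lemma min_le_of_prod_le:
  fixes a b c e k :: real
  assumes "0 \<le> a" "0 \<le> b" "0 < c" "0 < e" "1 \<le> k" and prod: "a * b \<le> k * (c * e)"
    and tri: "e \<le> a + b + c" "c \<le> a + b + e"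
  shows "min a b \<le> 3 * k * min c e"
proof (rule ccontr)
  assume *: "\<not> ?thesis"
  then have mn: "3 * k * min c e < min a b" by (simp only: not_le)
  have "1 * min c e \<le> 3 * k * min c e" using assms by (intro mult_right_mono) auto
  then have "min c e \<le> min a b" using mn by linarith
  then have mx: "max c e \<le> 3 * max a b"
    using tri by (auto simp: min_def max_def split: if_splits)
  have "k * (c * e) = (3 * k * min c e) * (max c e / 3)"
    by (auto simp: min_def max_def)
  also have "\<dots> < min a b * max a b"
    using mx mn assms by (intro mult_less_le_imp_less) auto
  also have "\<dots> = a * b" by (auto simp: min_def max_def)
  finally show False using prod by simp
qed

text \<open>The triangle inequality bounds the longer of a, b by the shorter plus twice the longer
  of c, e, which upgrades a bound on minima to one on products.\<close>

lemma prod_le_of_min_le: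
  fixes a b c e k :: real
  assumes "0 \<le> a" "0 \<le> b" "0 \<le> c" "0 \<le> e" "0 \<le> k" and le: "min a b \<le> k * min c e"
    and tri: "b \<le> e + a + c" "a \<le> c + b + e"
  shows "a * b \<le> k * (k + 2) * (c * e)"
proof -
  have k: "k * min c e \<le> k * max c e" using assms by (intro mult_left_mono) auto
  have "max a b \<le> min a b + 2 * max c e"
    using tri assms by (auto simp: min_def max_def)
  also have "\<dots> \<le> (k + 2) * max c e" using le k by (simp add: algebra_simps)
  finally have mx: "max a b \<le> (k + 2) * max c e" .
  have "a * b = min a b * max a b" by (auto simp: min_def max_def)
  also have "\<dots> \<le> (k * min c e) * ((k + 2) * max c e)"
    using le mx assms by (intro mult_mono) auto
  also have "\<dots> = k * (k + 2) * (c * e)" by (auto simp: min_def max_def)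
  finally show ?thesis .
qed

text \<open>Modelled on stereographic projection, where the chordal distance is the Euclidean one
  times a factor at each point, proportional to the distance to infinity.\<close>

locale chordal = dilation \<beta> + m: Metric_space UNIV d
  for \<beta> :: "'n::finite \<Rightarrow> real" and d :: "(real^'n) option \<Rightarrow> (real^'n) option \<Rightarrow> real" +
  fixes \<kappa> K :: real
  assumes \<kappa>: "0 < \<kappa>" and K: "1 \<le> K"
    and upper: "\<And>x y. d (Some x) (Some y) \<le> K * (D x y powr \<kappa> * (d (Some x) None * d (Some y) None))"
    and lower: "\<And>x y. D x y powr \<kappa> * (d (Some x) None * d (Some y) None) \<le> K * d (Some x) (Some y)"
    and bounded: "\<And>x. d (Some x) None \<le> K"
begin

abbreviation h :: "real^'n \<Rightarrow> real" where "h x \<equiv> d (Some x) None"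

lemma h_pos: "0 < h x"
  by simp

lemma d_triangle: "d x z \<le> d x y + d y z"
  by (rule m.triangle) auto

lemma d_zero [simp]: "d x y = 0 \<longleftrightarrow> x = y"
  by (rule m.zero) auto

lemma d_le_2K: "d x y \<le> 2 * K"
proof -
  have 1: "d None z \<le> K" for z
  proof (cases z)
    case (Some x)
    then show ?thesis using bounded[of x] m.commute[of None z] by simp
  qed (use K in simp)
  show ?thesis using d_triangle[of x y None] m.commute[of x None] 1[of x] 1[of y] by linarith
qed

lemma upper': "d (Some x) (Some y) \<le> K ^ 3 * D x y powr \<kappa>"
proof -
  have "h x * h y \<le> K * K" using bounded h_pos K by (intro mult_mono) (auto intro: less_imp_le)
  then have "K * (D x y powr \<kappa> * (h x * h y)) \<le> K * (D x y powr \<kappa> * (K * K))"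
    using K by (intro mult_left_mono) auto
  then show ?thesis using upper[of x y] by (simp add: power3_eq_cube mult_ac)
qed

lemma lower':
  assumes "0 \<le> c" "c \<le> h x" "0 \<le> e" "e \<le> h y"
  shows "D x y powr \<kappa> * (c * e) \<le> K * d (Some x) (Some y)"
proof -
  have "D x y powr \<kappa> * (c * e) \<le> D x y powr \<kappa> * (h x * h y)"
    using assms by (intro mult_left_mono mult_mono) auto
  then show ?thesis using lower[of x y] by linarith
qed

text \<open>The triangle inequality bounds \<open>h y\<close> by the distance of x and y plus
  \<open>h x\<close>, and \<open>upper\<close> makes the former a multiple of \<open>h x\<close>
  while \<open>D y x\<close> is bounded.\<close>

lemma h_lower_bound:
  obtains c where "0 < c" "\<And>x. D y x \<le> R \<Longrightarrow> c \<le> h x"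
proof -
  define B where "B = 1 + K * (R powr \<kappa> * h y)"
  have B: "B > 0" using K h_pos[of y] by (simp add: B_def add_pos_nonneg)
  have "h y / B \<le> h x" if "D y x \<le> R" for x
  proof -
    have "D y x powr \<kappa> \<le> R powr \<kappa>" using that \<kappa> by (intro powr_mono2) auto
    then have "K * (D y x powr \<kappa> * (h y * h x)) \<le> K * (R powr \<kappa> * (h y * h x))"
      using K h_pos by (intro mult_left_mono mult_right_mono) (auto intro: less_imp_le)
    then have "d (Some y) (Some x) \<le> K * (R powr \<kappa> * (h y * h x))"
      using upper[of y x] by linarith
    then have "h y \<le> B * h x"
      using d_triangle[of "Some y" None "Some x"] by (simp add: B_def algebra_simps)
    then show ?thesis using B by (simp add: field_simps)
  qed
  then show ?thesis using that[of "h y / B"] B h_pos by simp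
qed

lemma D_bound:
  assumes "0 < c"
  obtains R where "0 \<le> R" "\<And>x. c \<le> h x \<Longrightarrow> D y x \<le> R"
proof -
  define B where "B = 2 * K * K / (h y * c)"
  have B: "0 \<le> B" using K assms h_pos[of y] by (simp add: B_def)
  have "D y x \<le> B powr (1 / \<kappa>) * 1" if "c \<le> h x" for x
  proof (rule powr_le_scaleD)
    have "D y x powr \<kappa> * (h y * c) \<le> K * d (Some y) (Some x)"
      using that assms h_pos[of y] by (intro lower') auto
    also have "\<dots> \<le> K * (2 * K)" using d_le_2K K by (intro mult_left_mono) auto
    finally have "D y x powr \<kappa> \<le> K * (2 * K) / (h y * c)"
      using assms h_pos[of y] by (simp only: pos_le_divide_eq mult_pos_pos)
    then show "D y x powr \<kappa> \<le> B * 1 powr \<kappa>"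
      by (simp add: B_def mult_ac)
  qed (use B \<kappa> in auto)
  then show ?thesis using that[of "B powr (1 / \<kappa>)"] by simp
qed

lemma d_small:
  assumes "0 < \<epsilon>"
  obtains \<delta> where "0 < \<delta>" "\<And>x y. D x y < \<delta> \<Longrightarrow> d (Some x) (Some y) < \<epsilon>"
proof -
  define \<delta> where "\<delta> = (\<epsilon> / K ^ 3) powr (1 / \<kappa>)"
  have \<delta>: "0 < \<delta>" using assms K by (simp add: \<delta>_def)
  have "d (Some x) (Some y) < \<epsilon>" if "D x y < \<delta>" for x y
  proof -
    have "D x y powr \<kappa> < \<delta> powr \<kappa>" using that \<kappa> by (intro powr_less_mono2) auto
    also have "\<dots> = \<epsilon> / K ^ 3" using assms K \<kappa> by (simp add: \<delta>_def powr_powr)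
    finally have "K ^ 3 * D x y powr \<kappa> < K ^ 3 * (\<epsilon> / K ^ 3)"
      using K by (intro mult_strict_left_mono) auto
    then show ?thesis using upper'[of x y] K by simp
  qed
  then show ?thesis using that \<delta> by blast
qed

lemma D_small:
  assumes "0 < \<epsilon>"
  obtains \<delta> where "0 < \<delta>" "\<And>y. d (Some x) y < \<delta> \<Longrightarrow> \<exists>y'. y = Some y' \<and> D x y' < \<epsilon>"
proof -
  \<comment> \<open>The first entry keeps y at distance at least \<open>h x / 2\<close> from
    infinity, where \<open>lower\<close> is effective; the second is what \<open>lower\<close> then
    requires.\<close>
  define \<delta> where "\<delta> = min (h x / 2) (h x * (h x / 2) * \<epsilon> powr \<kappa> / K)"
  have \<delta>: "0 < \<delta>" using assms h_pos[of x] K by (simp add: \<delta>_def)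
  have "\<exists>y'. y = Some y' \<and> D x y' < \<epsilon>" if y: "d (Some x) y < \<delta>" for y
  proof (cases y)
    case None
    then show ?thesis using y h_pos[of x] by (simp add: \<delta>_def)
  next
    case (Some y')
    have "h x / 2 \<le> h y'"
      using d_triangle[of "Some x" None y] y Some by (simp add: \<delta>_def)
    then have "D x y' powr \<kappa> * (h x * (h x / 2)) \<le> K * d (Some x) y"
      unfolding Some using h_pos[of x] by (intro lower') auto
    also have "\<dots> < K * (h x * (h x / 2) * \<epsilon> powr \<kappa> / K)"
      using y K by (intro mult_strict_left_mono) (auto simp: \<delta>_def)
    also have "\<dots> = \<epsilon> powr \<kappa> * (h x * (h x / 2))" using K by simp
    finally have lt: "D x y' powr \<kappa> < \<epsilon> powr \<kappa>"
      by (rule mult_right_less_imp_less) simp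
    have "D x y' < \<epsilon>"
    proof (rule ccontr)
      assume "\<not> D x y' < \<epsilon>"
      then have "\<epsilon> powr \<kappa> \<le> D x y' powr \<kappa>" using assms \<kappa> by (intro powr_mono2) auto
      then show False using lt by simp
    qed
    then show ?thesis using Some by blast
  qed
  then show ?thesis using that \<delta> by blast
qed

lemma D_translate: "D (x + v) (y + v) = D x y"
  by (simp add: box_dist_def)

end

section \<open>Local estimates for a quasisymmetric map of the compactification\<close>

locale qs_map = chordal \<beta> d \<kappa> K
  for \<beta> :: "'n::finite \<Rightarrow> real" and d :: "(real^'n) option \<Rightarrow> (real^'n) option \<Rightarrow> real"
    and \<kappa> K :: real +
  fixes F G :: "(real^'n) option \<Rightarrow> (real^'n) option" and i0 j0 :: 'n
  assumes GF [simp]: "\<And>x. G (F x) = x" and FG [simp]: "\<And>x. F (G x) = x"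
    and wF: "weakly_qs d F" and wG: "weakly_qs d G"
    and cF: "eps_cont d F" and cG: "eps_cont d G"
    and i0: "\<beta> i0 = 1" and j0: "\<beta> j0 > 1"
begin

lemma qs_map_inverse: "qs_map \<beta> d \<kappa> K G F i0 j0"
  by unfold_locales (auto intro: wF wG cF cG i0 j0)

text \<open>At the preimage of infinity the value is unspecified; \<open>F_finite\<close> covers all
  other points.\<close>

definition f :: "real^'n \<Rightarrow> real^'n" where "f x = the (F (Some x))"

lemma F_SomeD: "F (Some x) = Some w \<Longrightarrow> f x = w"
  by (simp add: f_def)

lemma F_finite: "Some x \<noteq> G None \<Longrightarrow> F (Some x) = Some (f x)"
  using GF[of "Some x"] by (cases "F (Some x)") (auto simp: f_def)

text \<open>Weak quasisymmetry centred at \<open>G None\<close> compares x with one fixed point w,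
  which gives uniformity without a compactness argument.\<close>

lemma image_away:
  assumes "0 < c"
  obtains c' where "0 < c'" "\<And>x. c \<le> d (G None) x \<Longrightarrow> c' \<le> d (F x) None"
proof -
  have "\<exists>w. w \<noteq> G None" by (cases "G None") auto
  then obtain w where w: "w \<noteq> G None" ..
  obtain H where H: "1 \<le> H" "\<And>x y z. d x y \<le> (2 * K / c) * d x z \<Longrightarrow> d (F x) (F y) \<le> H * d (F x) (F z)"
    using wF unfolding weakly_qs_def by metis
  have pos: "0 < d None (F w)"
  proof -
    have "None \<noteq> F w" using w GF[of w] by metis
    then show ?thesis by simp
  qed
  have "d None (F w) / H \<le> d (F x) None" if "c \<le> d (G None) x" for x
  proof -
    have "2 * K / c * c \<le> 2 * K / c * d (G None) x"
      using that K assms by (intro mult_left_mono) auto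
    then have "d (G None) w \<le> 2 * K / c * d (G None) x"
      using d_le_2K[of "G None" w] assms by simp
    then have "d None (F w) \<le> H * d None (F x)"
      using H(2)[of "G None" w x] by simp
    then show ?thesis using H(1) m.commute[of None "F x"] by (simp add: field_simps)
  qed
  then show ?thesis using that[of "d None (F w) / H"] pos H(1) by simp
qed

text \<open>Away from infinity \<open>d\<close> is comparable to a power of \<open>D\<close>, before
  and after the map. The point z is not confined to \<open>N\<close> and may be infinity: it will be
  the preimage of an arbitrary w near \<open>f x\<close>. A far z is harmless because
  \<open>d\<close> is bounded.\<close>

lemma local_quasisymmetry:
  assumes c: "0 < c" and N: "\<And>x. x \<in> N \<Longrightarrow> c \<le> h x" "\<And>x. x \<in> N \<Longrightarrow> c \<le> d (F (Some x)) None"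
  obtains H where "1 \<le> H" "\<And>x y z w. x \<in> N \<Longrightarrow> y \<in> N \<Longrightarrow> F z = Some w \<Longrightarrow>
    (\<And>z'. z = Some z' \<Longrightarrow> D x y \<le> 2 * D x z') \<Longrightarrow> D (f x) (f y) \<le> H * D (f x) w"
proof -
  \<comment> \<open>The first entry serves z at \<open>d\<close>-distance at least
    \<open>c / 2\<close> from x, the second serves z with \<open>c / 2 \<le> h z'\<close>, where
    \<open>lower\<close> applies.\<close>
  define C where "C = max (4 * K / c) (K ^ 3 * 2 powr \<kappa> * (2 * K / (c * c)))"
  obtain H where H: "1 \<le> H" "\<And>x y z. d x y \<le> C * d x z \<Longrightarrow> d (F x) (F y) \<le> H * d (F x) (F z)"
    using wF unfolding weakly_qs_def by metis
  define B where "B = K ^ 4 * H / (c * c)"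
  have N_avoid: "Some x \<noteq> G None" if "x \<in> N" for x
  proof
    assume "Some x = G None"
    then have "F (Some x) = None" by simp
    then show False using N(2)[OF that] c by simp
  qed
  have main: "D (f x) (f y) \<le> B powr (1 / \<kappa>) * D (f x) w"
    if xy: "x \<in> N" "y \<in> N" and z: "F z = Some w" "\<And>z'. z = Some z' \<Longrightarrow> D x y \<le> 2 * D x z'" for x y z w
  proof (rule powr_le_scaleD)
    have far: "d (Some x) (Some y) \<le> C * d (Some x) z" if "c / 2 \<le> d (Some x) z"
    proof -
      have "d (Some x) (Some y) \<le> 4 * K / c * (c / 2)" using d_le_2K[of "Some x"] c by simp
      also have "\<dots> \<le> C * d (Some x) z"
        using that c K by (intro mult_mono) (auto simp: C_def le_max_iff_disj)
      finally show ?thesis .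
    qed
    have "d (Some x) (Some y) \<le> C * d (Some x) z"
    proof (cases z)
      case None
      then show ?thesis using far N(1)[OF xy(1)] c by simp
    next
      case (Some z')
      show ?thesis
      proof (cases "c / 2 \<le> h z'")
        case True
        have "D x y powr \<kappa> \<le> (2 * D x z') powr \<kappa>"
          using z(2)[OF Some] \<kappa> by (intro powr_mono2) auto
        also have "\<dots> = 2 powr \<kappa> * D x z' powr \<kappa>" by (simp add: powr_mult)
        finally have 1: "D x y powr \<kappa> \<le> 2 powr \<kappa> * D x z' powr \<kappa>" .
        have "D x z' powr \<kappa> * (c * (c / 2)) \<le> K * d (Some x) z"
          unfolding Some using True N(1)[OF xy(1)] c by (intro lower') auto
        then have "D x z' powr \<kappa> \<le> K * d (Some x) z / (c * (c / 2))"
          using c by (simp only: pos_le_divide_eq mult_pos_pos half_gt_zero)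
        then have 2: "D x z' powr \<kappa> \<le> 2 * K / (c * c) * d (Some x) z"
          by (simp add: mult_ac)
        have "d (Some x) (Some y) \<le> K ^ 3 * D x y powr \<kappa>" by (rule upper')
        also have "\<dots> \<le> K ^ 3 * (2 powr \<kappa> * (2 * K / (c * c) * d (Some x) z))"
          using 1 2 K by (intro mult_left_mono order_trans[OF 1] mult_left_mono[OF 2]) auto
        also have "\<dots> \<le> C * d (Some x) z"
        proof -
          have "(K ^ 3 * 2 powr \<kappa> * (2 * K / (c * c))) * d (Some x) z \<le> C * d (Some x) z"
            unfolding C_def by (intro mult_right_mono max.cobounded2 m.nonneg)
          then show ?thesis by (simp only: mult.assoc)
        qed
        finally show ?thesis .
      next
        case False
        then show ?thesis
          using far d_triangle[of "Some x" None z] N(1)[OF xy(1)] Some by simp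
      qed
    qed
    then have F1: "d (F (Some x)) (F (Some y)) \<le> H * d (F (Some x)) (F z)" by (rule H(2))
    have Fx: "F (Some x) = Some (f x)" "F (Some y) = Some (f y)"
      using N_avoid xy by (auto intro: F_finite)
    have "D (f x) (f y) powr \<kappa> * (c * c) \<le> K * d (Some (f x)) (Some (f y))"
      using N(2)[OF xy(1)] N(2)[OF xy(2)] c unfolding Fx by (intro lower') auto
    also have "\<dots> \<le> K * (H * d (Some (f x)) (Some w))"
      using F1 K unfolding Fx z(1) by (intro mult_left_mono) auto
    also have "\<dots> \<le> K * (H * (K ^ 3 * D (f x) w powr \<kappa>))"
      using K H(1) upper'[of "f x" w] by (intro mult_left_mono) auto
    also have "\<dots> = K ^ 4 * H * D (f x) w powr \<kappa>" by (simp add: eval_nat_numeral)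
    finally have "D (f x) (f y) powr \<kappa> \<le> K ^ 4 * H * D (f x) w powr \<kappa> / (c * c)"
      using c by (simp only: pos_le_divide_eq mult_pos_pos)
    then show "D (f x) (f y) powr \<kappa> \<le> B * D (f x) w powr \<kappa>"
      by (simp add: B_def)
  qed (use c K H(1) \<kappa> in \<open>auto simp: B_def\<close>)
  have "D (f x) (f y) \<le> max 1 (B powr (1 / \<kappa>)) * D (f x) w"
    if "x \<in> N" "y \<in> N" "F z = Some w" "\<And>z'. z = Some z' \<Longrightarrow> D x y \<le> 2 * D x z'" for x y z w
    using main[OF that] mult_right_mono[OF max.cobounded2[of "B powr (1 / \<kappa>)" 1] D_nonneg[of "f x" w]]
    by linarith
  then show ?thesis using that[of "max 1 (B powr (1 / \<kappa>))"] by simp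
qed

lemma f_cont:
  assumes "Some x \<noteq> G None" "0 < \<epsilon>"
  obtains \<delta> where "0 < \<delta>" "\<And>y. D x y < \<delta> \<Longrightarrow> D (f x) (f y) < \<epsilon>"
proof -
  obtain \<delta>1 where \<delta>1: "0 < \<delta>1" "\<And>y. d (Some (f x)) y < \<delta>1 \<Longrightarrow> \<exists>y'. y = Some y' \<and> D (f x) y' < \<epsilon>"
    using D_small[OF assms(2)] by blast
  obtain \<delta>2 where \<delta>2: "0 < \<delta>2" "\<And>y. d (Some x) y < \<delta>2 \<Longrightarrow> d (F (Some x)) (F y) < \<delta>1"
    using cF \<delta>1(1) unfolding eps_cont_def by blast
  obtain \<delta>3 where \<delta>3: "0 < \<delta>3" "\<And>x y. D x y < \<delta>3 \<Longrightarrow> d (Some x) (Some y) < \<delta>2"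
    using d_small[OF \<delta>2(1)] by blast
  have "D (f x) (f y) < \<epsilon>" if "D x y < \<delta>3" for y
  proof -
    have "d (Some (f x)) (F (Some y)) < \<delta>1"
      using \<delta>2(2)[OF \<delta>3(2)[OF that]] F_finite[OF assms(1)] by simp
    then obtain y' where "F (Some y) = Some y'" "D (f x) y' < \<epsilon>" using \<delta>1(2) by blast
    then show ?thesis using F_SomeD by simp
  qed
  then show ?thesis using that \<delta>3(1) by blast
qed

section \<open>Images of leaves\<close>

definition avoids_pole :: "real^'n \<Rightarrow> bool" where
  "avoids_pole p \<longleftrightarrow> (\<forall>y. y \<simeq> p \<longrightarrow> Some y \<noteq> G None)"

lemma avoids_poleD: "avoids_pole p \<Longrightarrow> y \<simeq> p \<Longrightarrow> F (Some y) = Some (f y)"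
  by (rule F_finite) (simp add: avoids_pole_def)

lemma avoids_pole_same_leaf: "avoids_pole p \<Longrightarrow> y \<simeq> p \<Longrightarrow> avoids_pole y"
  unfolding avoids_pole_def using same_leaf_trans by blast

lemma f_inj:
  assumes "Some x \<noteq> G None" "Some y \<noteq> G None" "f x = f y" shows "x = y"
proof -
  have "G (F (Some x)) = G (F (Some y))" using assms by (simp add: F_finite)
  then show ?thesis by simp
qed

text \<open>A finite pole differs from the whole leaf of p in some transversal coordinate k, so a
  slab around the leaf keeps a fixed \<open>D\<close>-distance to it. The bound
  \<open>D p z \<le> R\<close> converts this into a \<open>d\<close>-distance.\<close>

lemma neighbourhood_avoids_pole:
  assumes p: "avoids_pole p"
  obtains e \<rho>0 where "0 < e" "0 < \<rho>0" "\<rho>0 \<le> 1"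
    "\<And>R. \<exists>c>0. \<forall>x z. (\<forall>j. \<beta> j > 1 \<longrightarrow> \<bar>x $ j - p $ j\<bar> \<le> e) \<longrightarrow> D x z < \<rho>0 \<longrightarrow> D p z \<le> R \<longrightarrow>
        c \<le> d (G None) (Some z)"
proof (cases "G None")
  case None
  have "\<exists>c>0. \<forall>x z. (\<forall>j. \<beta> j > 1 \<longrightarrow> \<bar>x $ j - p $ j\<bar> \<le> 1) \<longrightarrow> D x z < 1 \<longrightarrow> D p z \<le> R \<longrightarrow>
        c \<le> d (G None) (Some z)" for R
  proof -
    obtain c where "0 < c" "\<And>x. D p x \<le> R \<Longrightarrow> c \<le> h x" using h_lower_bound by blast
    then show ?thesis unfolding None using m.commute[of None] by metis
  qed
  then show ?thesis using that[of 1 1] by simp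
next
  case (Some z0)
  then have "\<not> z0 \<simeq> p" using p by (auto simp: avoids_pole_def)
  then obtain k where k: "\<beta> k > 1" "z0 $ k \<noteq> p $ k" by (auto simp: same_leaf_def)
  define e where "e = \<bar>z0 $ k - p $ k\<bar> / 2"
  have e: "e > 0" using k by (simp add: e_def)
  \<comment> \<open>At most half the distance by which coordinate k separates the slab from the
    pole, so the balls around points of the slab still miss it by \<open>\<rho>0\<close>.\<close>
  define \<rho>0 where "\<rho>0 = min 1 (e powr (1 / \<beta> k) / 2)"
  have \<rho>0: "0 < \<rho>0" "\<rho>0 \<le> 1" using e by (auto simp: \<rho>0_def)
  have "\<exists>c>0. \<forall>x z. (\<forall>j. \<beta> j > 1 \<longrightarrow> \<bar>x $ j - p $ j\<bar> \<le> e) \<longrightarrow> D x z < \<rho>0 \<longrightarrow> D p z \<le> R \<longrightarrow>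
        c \<le> d (G None) (Some z)" for R
  proof -
    obtain c where c: "0 < c" "\<And>x. D p x \<le> R \<Longrightarrow> c \<le> h x" using h_lower_bound by blast
    define c' where "c' = \<rho>0 powr \<kappa> * (h z0 * c) / K"
    have "c' \<le> d (G None) (Some z)"
      if x: "\<forall>j. \<beta> j > 1 \<longrightarrow> \<bar>x $ j - p $ j\<bar> \<le> e" "D x z < \<rho>0" "D p z \<le> R" for x z
    proof -
      have "\<bar>x $ k - p $ k\<bar> \<le> e" using x(1) k(1) by blast
      then have "e \<le> \<bar>z0 $ k - x $ k\<bar>" unfolding e_def by argo
      then have "e powr (1 / \<beta> k) \<le> \<bar>z0 $ k - x $ k\<bar> powr (1 / \<beta> k)"
        using e beta_pos[of k] by (intro powr_mono2) auto
      then have "2 * \<rho>0 \<le> D z0 x"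
        using coord_le_D[of z0 k x] by (simp add: \<rho>0_def)
      then have "\<rho>0 \<le> D z0 z"
        using D_triangle[of z0 x z] D_commute[of x z] x(2) by linarith
      then have "\<rho>0 powr \<kappa> \<le> D z0 z powr \<kappa>" using \<rho>0 \<kappa> by (intro powr_mono2) auto
      then have "\<rho>0 powr \<kappa> * (h z0 * c) \<le> D z0 z powr \<kappa> * (h z0 * c)"
        using c(1) by (intro mult_right_mono) auto
      also have "\<dots> \<le> K * d (Some z0) (Some z)"
        using c x(3) by (intro lower') auto
      finally show ?thesis using K unfolding Some c'_def by (simp add: field_simps)
    qed
    moreover have "0 < c'" using c \<rho>0 K h_pos[of z0] unfolding c'_def
      by (intro divide_pos_pos mult_pos_pos) auto
    ultimately show ?thesis by blast
  qed
  then show ?thesis using that e \<rho>0 by blast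
qed

text \<open>If a transversal coordinate changed along the segment, continuity at its two ends would
  keep half of the gap on all nearby parallel segments, against
  \<open>length_area_contradiction\<close>.\<close>

lemma leaf_step:
  assumes p: "avoids_pole p" and i: "\<beta> i = 1" and a: "0 < a"
  shows "f p \<simeq> f (p + axis i a)"
proof (rule ccontr)
  assume "\<not> ?thesis"
  then obtain j1 where j1: "\<beta> j1 > 1" "f p $ j1 \<noteq> f (p + axis i a) $ j1"
    by (auto simp: same_leaf_def)
  define q where "q = p + axis i a"
  define g where "g = \<bar>f p $ j1 - f q $ j1\<bar>"
  have g: "g > 0" using j1 by (simp add: g_def q_def)
  \<comment> \<open>Makes \<open>\<epsilon> powr \<beta> j1\<close> equal to g/4, so that the two
    ends together lose at most half of the gap g.\<close>
  define \<epsilon> where "\<epsilon> = (g / 4) powr (1 / \<beta> j1)"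
  have \<epsilon>: "\<epsilon> > 0" using g by (simp add: \<epsilon>_def)
  have qp: "q \<simeq> p" using i by (auto simp: q_def same_leaf_def axis_def)
  obtain \<delta>1 where \<delta>1: "0 < \<delta>1" "\<And>y. D p y < \<delta>1 \<Longrightarrow> D (f p) (f y) < \<epsilon>"
    using f_cont[OF _ \<epsilon>, of p] p by (auto simp: avoids_pole_def)
  obtain \<delta>2 where \<delta>2: "0 < \<delta>2" "\<And>y. D q y < \<delta>2 \<Longrightarrow> D (f q) (f y) < \<epsilon>"
    using f_cont[OF _ \<epsilon>, of q] p qp by (auto simp: avoids_pole_def)
  obtain e \<rho>0 where e: "0 < e" "0 < \<rho>0" "\<rho>0 \<le> 1"
    "\<And>R. \<exists>c>0. \<forall>x z. (\<forall>j. \<beta> j > 1 \<longrightarrow> \<bar>x $ j - p $ j\<bar> \<le> e) \<longrightarrow> D x z < \<rho>0 \<longrightarrow> D p z \<le> R \<longrightarrow>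
        c \<le> d (G None) (Some z)"
    using neighbourhood_avoids_pole[OF p] by blast
  define \<eta> where "\<eta> = min \<delta>1 \<delta>2 / 2"
  have \<eta>: "0 < \<eta>" "\<eta> < \<delta>1" "\<eta> < \<delta>2" using \<delta>1 \<delta>2 by (auto simp: \<eta>_def)
  \<comment> \<open>Thin enough to stay in the slab that avoids the pole and to keep the ends of the
    segments within \<open>D\<close>-distance \<eta> of p and q.\<close>
  define \<delta> where "\<delta> = min e (Min (range (\<lambda>j. \<eta> powr \<beta> j)))"
  have \<delta>: "0 < \<delta>" "\<delta> \<le> e" "\<And>j. \<delta> \<le> \<eta> powr \<beta> j"
    using e \<eta> by (auto simp: \<delta>_def intro: min.coboundedI2)
  define S where "S = {x. p $ i \<le> x $ i \<and> x $ i \<le> p $ i + a \<and>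
                          (\<forall>j. j \<noteq> i \<longrightarrow> p $ j \<le> x $ j \<and> x $ j \<le> p $ j + \<delta>)}"
  define N where "N = {z. \<exists>x\<in>S. D x z < \<rho>0}"
  define R where "R = max a \<eta> + 1"
  have near: "D p y \<le> R" if y: "y \<in> N" for y
  proof -
    obtain x where x: "x \<in> S" "D x y < \<rho>0" using y by (auto simp: N_def)
    have "\<bar>p $ j - x $ j\<bar> \<le> max a \<eta> powr \<beta> j" for j
    proof (cases "j = i")
      case True
      then show ?thesis using x(1) i a by (auto simp: S_def)
    next
      case False
      have "\<bar>p $ j - x $ j\<bar> \<le> \<eta> powr \<beta> j"
        using x(1) False \<delta>(3)[of j] by (fastforce simp: S_def)
      also have "\<dots> \<le> max a \<eta> powr \<beta> j"
        using \<eta> beta_pos[of j] by (intro powr_mono2) auto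
      finally show ?thesis .
    qed
    then have "D p x \<le> max a \<eta>" using a by (simp add: D_le_iff)
    then show ?thesis using D_triangle[of p y x] x(2) e(3) by (simp add: R_def)
  qed
  obtain c1 where c1: "0 < c1" "\<And>x z. (\<forall>j. \<beta> j > 1 \<longrightarrow> \<bar>x $ j - p $ j\<bar> \<le> e) \<Longrightarrow> D x z < \<rho>0 \<Longrightarrow>
      D p z \<le> R \<Longrightarrow> c1 \<le> d (G None) (Some z)"
    using e(4)[of R] by blast
  have away: "c1 \<le> d (G None) (Some y)" if y: "y \<in> N" for y
  proof -
    obtain x where x: "x \<in> S" "D x y < \<rho>0" using y by (auto simp: N_def)
    have "\<bar>x $ j - p $ j\<bar> \<le> e" if "\<beta> j > 1" for j
    proof -
      have "j \<noteq> i" using that i by auto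
      then show ?thesis using x(1) \<delta>(2) by (fastforce simp: S_def)
    qed
    then show ?thesis using c1(2)[of x y] x near[OF y] by blast
  qed
  obtain c2 where c2: "0 < c2" "\<And>x. c1 \<le> d (G None) x \<Longrightarrow> c2 \<le> d (F x) None"
    using image_away[OF c1(1)] by blast
  obtain c3 where c3: "0 < c3" "\<And>x. D p x \<le> R \<Longrightarrow> c3 \<le> h x"
    using h_lower_bound by blast
  define c where "c = min c2 c3"
  have c: "0 < c" "\<And>x. x \<in> N \<Longrightarrow> c \<le> h x" "\<And>x. x \<in> N \<Longrightarrow> c \<le> d (F (Some x)) None"
    using c2 c3 away near unfolding c_def by (force intro: min.coboundedI1 min.coboundedI2)+
  have avoid: "Some x \<noteq> G None" if "x \<in> N" for x
    using away[OF that] c1(1) by auto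
  obtain H where H: "1 \<le> H" "\<And>x y z w. x \<in> N \<Longrightarrow> y \<in> N \<Longrightarrow> F z = Some w \<Longrightarrow>
    (\<And>z'. z = Some z' \<Longrightarrow> D x y \<le> 2 * D x z') \<Longrightarrow> D (f x) (f y) \<le> H * D (f x) w"
    using local_quasisymmetry[of c N] c by blast
  obtain R' where R': "0 \<le> R'" "\<And>x. c \<le> h x \<Longrightarrow> D 0 x \<le> R'" using D_bound[OF c(1)] by blast
  define B where "B = Max (range (\<lambda>j. R' powr \<beta> j))"
  have SN: "x \<in> N" if "x \<in> S" for x
    unfolding N_def using that e(2) by (intro CollectI bexI[of _ x]) auto
  show False
  proof (rule length_area_contradiction[of a \<delta> "g / 2" "H * H" \<rho>0 i j1 p S N f B])
    show "inj_on f N" using f_inj avoid by (auto simp: inj_on_def)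
    show "\<bar>f z $ j\<bar> \<le> B" if "z \<in> N" for z j
    proof -
      have "D 0 (f z) \<le> R'" using c(3)[OF that] F_finite[OF avoid[OF that]] by (intro R'(2)) simp
      then have "\<bar>f z $ j\<bar> \<le> R' powr \<beta> j" using R'(1) by (simp add: D_le_iff)
      also have "\<dots> \<le> B" by (simp add: B_def)
      finally show ?thesis .
    qed
    show "\<exists>l>0. (\<forall>w. D (f x) w < l \<longrightarrow> (\<exists>z. D x z < \<rho> \<and> w = f z)) \<and>
                 (\<forall>y\<in>S. D x y \<le> 2 * \<rho> \<longrightarrow> D (f x) (f y) \<le> H * H * l)"
      if x: "x \<in> S" and \<rho>: "0 < \<rho>" "\<rho> < \<rho>0" for x \<rho>
    proof -
      \<comment> \<open>A reference point at distance exactly \<rho>, whose image calibrates l. One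
        factor H is lost for the inner ball, the other for neighbours at distance up to
        \<open>2 * \<rho>\<close>.\<close>
      define y0 where "y0 = x + axis i (\<rho> powr \<beta> i)"
      have Dy0: "D x y0 = \<rho>" using \<rho> by (simp add: y0_def D_add_axis)
      have N0: "x \<in> N" "y0 \<in> N" using x \<rho> Dy0 SN by (auto simp: N_def)
      have "x \<noteq> y0" using Dy0 \<rho> by auto
      then have "f x \<noteq> f y0" using f_inj avoid N0 by blast
      then have pos: "0 < D (f x) (f y0)" using D_pos_iff by blast
      show ?thesis
      proof (intro exI[of _ "D (f x) (f y0) / H"] conjI allI impI ballI)
        show "0 < D (f x) (f y0) / H" using pos H(1) by simp
      next
        fix w assume w: "D (f x) w < D (f x) (f y0) / H"
        show "\<exists>z. D x z < \<rho> \<and> w = f z"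
        proof (rule ccontr)
          assume no: "\<not> ?thesis"
          have "D (f x) (f y0) \<le> H * D (f x) w"
          \<comment> \<open>Surjectivity of F gives w a preimage, possibly infinity, where the
            distance condition is void. A preimage outside the \<rho>-ball would put
            \<open>f y0\<close> too close to \<open>f x\<close>.\<close>
          proof (rule H(2)[OF N0, of "G (Some w)"])
            fix z' assume "G (Some w) = Some z'"
            then have "F (Some z') = Some w" by (metis FG)
            then have "\<rho> \<le> D x z'" using no F_SomeD by force
            then show "D x y0 \<le> 2 * D x z'" using Dy0 \<rho> by simp
          qed simp
          then show False using w H(1) by (simp add: field_simps)
        qed
      next
        fix y assume y: "y \<in> S" "D x y \<le> 2 * \<rho>"
        have "D (f x) (f y) \<le> H * D (f x) (f y0)"
          using y Dy0 F_finite[OF avoid[OF N0(2)]] by (intro H(2)[OF N0(1) SN, of y "Some y0"]) auto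
        then show "D (f x) (f y) \<le> H * H * (D (f x) (f y0) / H)" using H(1) by simp
      qed
    qed
    show "g / 2 \<le> \<bar>f (x + axis i a) $ j1 - f x $ j1\<bar>"
      if x: "x $ i = p $ i" "\<And>j. j \<noteq> i \<Longrightarrow> p $ j \<le> x $ j \<and> x $ j \<le> p $ j + \<delta>" for x
    proof -
      have "\<bar>p $ j - x $ j\<bar> \<le> \<eta> powr \<beta> j" for j
        using x \<delta>(3)[of j] by (cases "j = i") fastforce+
      then have px: "D p x \<le> \<eta>" using \<eta> by (simp add: D_le_iff)
      then have "D q (x + axis i a) \<le> \<eta>" by (simp add: q_def D_translate)
      then have "D (f p) (f x) < \<epsilon>" "D (f q) (f (x + axis i a)) < \<epsilon>"
        using \<delta>1(2) \<delta>2(2) px \<eta> by auto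
      then have "\<bar>f p $ j1 - f x $ j1\<bar> < \<epsilon> powr \<beta> j1" "\<bar>f q $ j1 - f (x + axis i a) $ j1\<bar> < \<epsilon> powr \<beta> j1"
        using \<epsilon> by (simp_all add: D_less_iff)
      moreover have "\<epsilon> powr \<beta> j1 = g / 4" using g beta_pos[of j1] by (simp add: \<epsilon>_def powr_powr)
      ultimately have "\<bar>f p $ j1 - f x $ j1\<bar> < g / 4" "\<bar>f q $ j1 - f (x + axis i a) $ j1\<bar> < g / 4"
        by simp_all
      then show ?thesis unfolding g_def by argo
    qed
    show "x \<in> S" if "p $ i \<le> x $ i" "x $ i \<le> p $ i + a"
      "\<And>j. j \<noteq> i \<Longrightarrow> p $ j \<le> x $ j \<and> x $ j \<le> p $ j + \<delta>" for x
      using that by (auto simp: S_def)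
  qed (use a \<delta> g H e i j1 in \<open>auto simp: N_def\<close>)
qed

text \<open>Axis steps are composed by induction on the coordinates in which y and p may differ. All
  intermediate points lie on the leaf of p, so they avoid the pole too.\<close>

lemma leaf_preserved:
  assumes p: "avoids_pole p" and y: "y \<simeq> p"
  shows "f p \<simeq> f y"
proof -
  have "f p \<simeq> f y" if "finite A" "y \<simeq> p" "\<And>j. j \<notin> A \<Longrightarrow> y $ j = p $ j" for A y
    using that
  proof (induction A arbitrary: y rule: finite_induct)
    case empty
    then have "y = p" by (simp add: vec_eq_iff)
    then show ?case by simp
  next
    case (insert i A)
    define y' where "y' = (\<chi> j. if j = i then p $ j else y $ j)"
    have y'p: "y' \<simeq> p" using insert.prems(1) by (auto simp: y'_def same_leaf_def)
    have 1: "f p \<simeq> f y'"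
      by (rule insert.IH[OF y'p]) (use insert.prems(2) in \<open>auto simp: y'_def\<close>)
    define t where "t = y $ i - p $ i"
    have yy': "y = y' + axis i t" by (auto simp: vec_eq_iff y'_def t_def axis_def)
    then have y'y: "y' = y + axis i (- t)" by (auto simp: vec_eq_iff axis_def)
    have "f y' \<simeq> f y"
    proof (cases "t = 0")
      case True
      then have "y' = y" using yy' by (simp add: axis_def vec_eq_iff)
      then show ?thesis by simp
    next
      case False
      then have "\<not> \<beta> i > 1" using insert.prems(1) by (auto simp: same_leaf_def t_def)
      then have i: "\<beta> i = 1" using beta_ge_1[of i] by simp
      show ?thesis
      proof (cases "0 < t")
        case True
        then show ?thesis using leaf_step[OF avoids_pole_same_leaf[OF p y'p] i True] yy' by simp
      next
        case neg: False
        then have "0 < - t" using False by simp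
        then have "f y \<simeq> f y'"
          using leaf_step[OF avoids_pole_same_leaf[OF p insert.prems(1)] i, of "- t"] y'y by simp
        then show ?thesis by (rule same_leaf_sym)
      qed
    qed
    then show ?case using 1 same_leaf_trans by blast
  qed
  then show ?thesis using y by (meson UNIV_I finite)
qed

text \<open>Leaves are closed; the limit is taken in \<open>d\<close> so that \<open>y0\<close> may
  be infinity.\<close>

lemma same_leaf_limit:
  assumes F0: "F y0 = Some w"
    and lim: "\<And>\<epsilon>. 0 < \<epsilon> \<Longrightarrow> \<exists>y v. d y0 y < \<epsilon> \<and> F y = Some v \<and> v \<simeq> b"
  shows "w \<simeq> b"
  unfolding same_leaf_def
proof (intro allI impI, rule ccontr)
  fix j assume j: "1 < \<beta> j" "w $ j \<noteq> b $ j"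
  define \<epsilon> where "\<epsilon> = \<bar>w $ j - b $ j\<bar> powr (1 / \<beta> j)"
  have "\<epsilon> > 0" using j by (simp add: \<epsilon>_def)
  then obtain \<delta>1 where \<delta>1: "0 < \<delta>1" "\<And>y. d (Some w) y < \<delta>1 \<Longrightarrow> \<exists>y'. y = Some y' \<and> D w y' < \<epsilon>"
    using D_small by blast
  obtain \<delta>2 where \<delta>2: "0 < \<delta>2" "\<And>y. d y0 y < \<delta>2 \<Longrightarrow> d (F y0) (F y) < \<delta>1"
    using cF \<delta>1(1) unfolding eps_cont_def by blast
  obtain y v where y: "d y0 y < \<delta>2" "F y = Some v" "v \<simeq> b" using lim[OF \<delta>2(1)] by blast
  then have "D w v < \<epsilon>" using \<delta>1(2)[of "F y"] \<delta>2(2)[OF y(1)] F0 by simp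
  then show False using coord_le_D[of w j v] y(3) j(1) by (simp add: \<epsilon>_def same_leaf_def)
qed

theorem F_fixes_infinity: "F None = None"
proof (rule ccontr)
  assume "F None \<noteq> None"
  then obtain b where b: "F None = Some b" by auto
  have "G None \<noteq> None" using b FG[of None] by (metis option.distinct(1))
  then obtain z0 where z0: "G None = Some z0" by auto
  \<comment> \<open>Every leaf accumulates at infinity, so its image accumulates at b. The leaf of
    the pole \<open>z0\<close> is left out, since \<open>leaf_preserved\<close> does not reach
    it.\<close>
  have img: "f p \<simeq> b" if p: "\<not> p \<simeq> z0" for p
  proof -
    have ap: "avoids_pole p" using p z0 same_leaf_sym by (auto simp: avoids_pole_def)
    have "b \<simeq> f p"
    proof (rule same_leaf_limit[OF b])
      fix \<epsilon> :: real assume "0 < \<epsilon>"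
      then obtain R where R: "0 \<le> R" "\<And>x. \<epsilon> \<le> h x \<Longrightarrow> D 0 x \<le> R" using D_bound by blast
      define y where "y = p + axis i0 (R + 1 - p $ i0)"
      have "y $ i0 = R + 1" by (simp add: y_def axis_def)
      then have "\<not> D 0 y \<le> R" using coord_le_D[of 0 i0 y] R(1) i0 by simp
      then have "d None (Some y) < \<epsilon>" using R(2)[of y] m.commute[of None "Some y"] by force
      moreover have "y \<simeq> p" using i0 by (auto simp: y_def same_leaf_def axis_def)
      ultimately show "\<exists>y v. d None y < \<epsilon> \<and> F y = Some v \<and> v \<simeq> f p"
        using avoids_poleD[OF ap] leaf_preserved[OF ap] same_leaf_sym by blast
    qed
    then show ?thesis by (rule same_leaf_sym)
  qed
  define w where "w = b + axis j0 1"
  have wb: "\<not> w \<simeq> b" using j0 by (auto simp: w_def same_leaf_def axis_def)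
  have "G (Some w) \<noteq> None" using b wb FG[of "Some w"] by (metis option.sel same_leaf_refl)
  then obtain p where p: "F (Some p) = Some w" by (metis FG not_Some_eq)
  \<comment> \<open>A preimage of a point off the leaf of b can only lie on the exceptional leaf of
    \<open>z0\<close>. That leaf has empty interior, so p is approached from outside it.\<close>
  have pz: "p \<simeq> z0" using img[of p] wb F_SomeD[OF p] by auto
  have "w \<simeq> b"
  proof (rule same_leaf_limit[OF p])
    fix \<epsilon> :: real assume "0 < \<epsilon>"
    then obtain \<delta> where \<delta>: "0 < \<delta>" "\<And>x y. D x y < \<delta> \<Longrightarrow> d (Some x) (Some y) < \<epsilon>"
      using d_small by blast
    define y where "y = p + axis j0 ((\<delta> / 2) powr \<beta> j0)"
    have "D p y < \<delta>" using \<delta>(1) by (simp add: y_def D_add_axis)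
    then have "d (Some p) (Some y) < \<epsilon>" by (rule \<delta>(2))
    moreover have "y $ j0 \<noteq> z0 $ j0" using pz j0 \<delta>(1) by (simp add: y_def same_leaf_def)
    then have "\<not> y \<simeq> z0" using j0 by (auto simp: same_leaf_def)
    moreover from this have "F (Some y) = Some (f y)" using z0 by (intro F_finite) auto
    ultimately show "\<exists>y v. d (Some p) y < \<epsilon> \<and> F y = Some v \<and> v \<simeq> b"
      using img by blast
  qed
  then show False using wb by simp
qed

section \<open>Global estimates once infinity is fixed\<close>

lemma F_Some: "F (Some x) = Some (f x)"
  using F_fixes_infinity GF[of None] by (intro F_finite) auto

lemma f_leaf: "x \<simeq> y \<Longrightarrow> f x \<simeq> f y"
  using F_fixes_infinity GF[of None] by (intro leaf_preserved) (auto simp: avoids_pole_def same_leaf_sym)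

text \<open>A weakly quasisymmetric map distorts the quotients
  min (d 1 3) (d 2 4) / min (d 1 4) (d 2 3) boundedly, and these control the cross ratios.
  Putting one of the four points at infinity turns cross ratios into quotients of D.\<close>

lemma global_quasisymmetry:
  obtains H where "1 \<le> H" "\<And>x y z. D x y \<le> D x z \<Longrightarrow> D (f x) (f y) \<le> H * D (f x) (f z)"
proof -
  have K2: "1 \<le> K\<^sup>2" using K by simp
  obtain H where H: "1 \<le> H"
    "\<And>x y z. d x y \<le> (3 * K\<^sup>2) * d x z \<Longrightarrow> d (F x) (F y) \<le> H * d (F x) (F z)"
    using wF unfolding weakly_qs_def by metis
  define B where "B = K\<^sup>2 * (H * (H + 2))"
  have B: "0 \<le> B" using K H(1) by (simp add: B_def)
  have main: "D (f x) (f y) \<le> B powr (1 / \<kappa>) * D (f x) (f z)"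
    if le: "D x y \<le> D x z" and ne: "x \<noteq> y" "x \<noteq> z" for x y z
  proof (rule powr_le_scaleD)
    \<comment> \<open>Opposite sides of the quadrilateral x, y, infinity, z. Up to constants
      \<open>a * b / (c * e)\<close> is a power of \<open>D x y / D x z\<close>, as the distances to
      infinity cancel.\<close>
    define a b c e where "a = d (Some x) (Some y)" and "b = d None (Some z)"
      and "c = d (Some x) (Some z)" and "e = d None (Some y)"
    have pos: "0 < a" "0 < b" "0 < c" "0 < e" using ne by (simp_all add: a_def b_def c_def e_def)
    have hyz: "h y = e" "h z = b" by (simp_all add: b_def e_def m.commute)
    have "a * b \<le> K\<^sup>2 * (c * e)"
    proof -
      have "a * b \<le> K * (D x y powr \<kappa> * (h x * e)) * b"
        unfolding a_def using upper[of x y] pos hyz by (intro mult_right_mono) auto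
      also have "\<dots> \<le> K * (D x z powr \<kappa> * (h x * e)) * b"
        using le \<kappa> K pos by (intro mult_right_mono mult_left_mono powr_mono2) auto
      also have "\<dots> = K * e * (D x z powr \<kappa> * (h x * b))" by simp
      also have "\<dots> \<le> K * e * (K * c)"
        unfolding c_def using lower[of x z] hyz K pos by (intro mult_left_mono) auto
      finally show ?thesis by (simp add: power2_eq_square mult_ac)
    qed
    moreover have "e \<le> a + b + c" "c \<le> a + b + e"
      using d_triangle[of None "Some y" "Some z"] d_triangle[of "Some z" "Some y" "Some x"]
        d_triangle[of "Some x" "Some z" "Some y"] d_triangle[of "Some y" "Some z" None]
        m.commute[of "Some z" "Some x"] m.commute[of "Some y" None]
      by (simp_all add: a_def b_def c_def e_def)
    ultimately have mn: "min a b \<le> 3 * K\<^sup>2 * min c e"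
      using pos K2 by (intro min_le_of_prod_le) auto
    define a' b' c' e' where "a' = d (Some (f x)) (Some (f y))" and "b' = d None (Some (f z))"
      and "c' = d (Some (f x)) (Some (f z))" and "e' = d None (Some (f y))"
    note F = F_Some F_fixes_infinity
    have pos': "0 \<le> a'" "0 \<le> b'" "0 \<le> c'" "0 \<le> e'" by (simp_all add: a'_def b'_def c'_def e'_def)
    have hyz': "h (f y) = e'" "h (f z) = b'" by (simp_all add: b'_def e'_def m.commute)
    \<comment> \<open>Each of the four implications compares two adjacent sides, with their common
      vertex as centre.\<close>
    have "a' \<le> H * c'" if "a \<le> 3 * K\<^sup>2 * c"
      using H(2)[of "Some x" "Some y" "Some z"] that by (simp add: F a_def c_def a'_def c'_def)
    moreover have "a' \<le> H * e'" if "a \<le> 3 * K\<^sup>2 * e"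
      using H(2)[of "Some y" "Some x" None] that m.commute[of "Some y" "Some x"]
        m.commute[of "Some y" None] m.commute[of "Some (f y)" "Some (f x)"] m.commute[of "Some (f y)" None]
      by (simp add: F a_def e_def a'_def e'_def)
    moreover have "b' \<le> H * c'" if "b \<le> 3 * K\<^sup>2 * c"
      using H(2)[of "Some z" None "Some x"] that m.commute[of "Some z" "Some x"]
        m.commute[of "Some z" None] m.commute[of "Some (f z)" "Some (f x)"] m.commute[of "Some (f z)" None]
      by (simp add: F b_def c_def b'_def c'_def)
    moreover have "b' \<le> H * e'" if "b \<le> 3 * K\<^sup>2 * e"
      using H(2)[of None "Some z" "Some y"] that by (simp add: F b_def e_def b'_def e'_def)
    moreover have "min a b \<le> 3 * K\<^sup>2 * c" "min a b \<le> 3 * K\<^sup>2 * e"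
      using mn mult_left_mono[of "min c e" c "3 * K\<^sup>2"] mult_left_mono[of "min c e" e "3 * K\<^sup>2"]
      by auto
    ultimately have "min a' b' \<le> H * c'" "min a' b' \<le> H * e'"
      by (auto simp: min_def split: if_splits)
    then have "min a' b' \<le> H * min c' e'" by (auto simp: min_def)
    moreover have "b' \<le> e' + a' + c'" "a' \<le> c' + b' + e'"
      using d_triangle[of None "Some (f z)" "Some (f y)"] d_triangle[of "Some (f y)" "Some (f z)" "Some (f x)"]
        d_triangle[of "Some (f x)" "Some (f y)" "Some (f z)"] d_triangle[of "Some (f z)" "Some (f y)" None]
        m.commute[of "Some (f y)" "Some (f x)"] m.commute[of "Some (f z)" None]
      by (simp_all add: a'_def b'_def c'_def e'_def)
    ultimately have prod: "a' * b' \<le> H * (H + 2) * (c' * e')"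
      using pos' H(1) by (intro prod_le_of_min_le) auto
    define P where "P = h (f x) * (e' * b')"
    have P: "0 < P"
      unfolding P_def b'_def e'_def by (intro mult_pos_pos) auto
    have "D (f x) (f y) powr \<kappa> * P = D (f x) (f y) powr \<kappa> * (h (f x) * e') * b'"
      by (simp add: P_def)
    also have "\<dots> \<le> K * a' * b'"
      unfolding a'_def using lower[of "f x" "f y"] hyz' pos' by (intro mult_right_mono) auto
    also have "\<dots> \<le> K * (H * (H + 2) * (c' * e'))"
      using prod K by (simp add: mult.assoc mult_left_mono)
    also have "\<dots> \<le> K * (H * (H + 2) * (K * (D (f x) (f z) powr \<kappa> * (h (f x) * b')) * e'))"
      unfolding c'_def using upper[of "f x" "f z"] hyz' pos' K H(1)
      by (intro mult_left_mono mult_right_mono) auto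
    also have "\<dots> = B * D (f x) (f z) powr \<kappa> * P"
      by (simp add: B_def P_def power2_eq_square)
    finally show "D (f x) (f y) powr \<kappa> \<le> B * D (f x) (f z) powr \<kappa>"
      using P by (rule mult_right_le_imp_le)
  qed (use B \<kappa> in auto)
  have "D (f x) (f y) \<le> max 1 (B powr (1 / \<kappa>)) * D (f x) (f z)" if "D x y \<le> D x z" for x y z
  proof (cases "x = y \<or> x = z")
    case True
    then have "D x y \<le> 0" using that by auto
    then have "x = y" using D_nonneg[of x y] D_eq_0_iff[of x y] by (metis antisym)
    then show ?thesis by simp
  next
    case False
    have "B powr (1 / \<kappa>) * D (f x) (f z) \<le> max 1 (B powr (1 / \<kappa>)) * D (f x) (f z)"
      by (intro mult_right_mono max.cobounded2 D_nonneg)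
    then show ?thesis using main[OF that] False by linarith
  qed
  then show ?thesis using that[of "max 1 (B powr (1 / \<kappa>))"] by simp
qed

theorem f_bilipschitz:
  "\<exists>L\<ge>1. \<forall>x y. D x y / L \<le> D (f x) (f y) \<and> D (f x) (f y) \<le> L * D x y"
proof -
  interpret inv: qs_map \<beta> d \<kappa> K G F i0 j0 by (rule qs_map_inverse)
  obtain H1 where H1: "1 \<le> H1" "\<And>x y z. D x y \<le> D x z \<Longrightarrow> D (f x) (f y) \<le> H1 * D (f x) (f z)"
    using global_quasisymmetry by blast
  obtain H2 where H2: "1 \<le> H2" "\<And>x y z. D x y \<le> D x z \<Longrightarrow> D (inv.f x) (inv.f y) \<le> H2 * D (inv.f x) (inv.f z)"
    using inv.global_quasisymmetry by blast
  define H where "H = max H1 H2"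
  have gf: "inv.f (f x) = x" for x
    using GF[of "Some x"] by (simp add: F_Some inv.F_Some)
  have fg: "f (inv.f x) = x" for x
    using FG[of "Some x"] by (simp add: F_Some inv.F_Some)
  have mono: "H1 * D u v \<le> H * D u v" "H2 * D u v \<le> H * D u v" for u v
    by (simp_all add: H_def mult_right_mono)
  interpret leaf_map \<beta> f inv.f H i0 j0
  proof
    show "f x \<simeq> f y \<longleftrightarrow> x \<simeq> y" for x y
      using f_leaf[of x y] inv.f_leaf[of "f x" "f y"] by (auto simp: gf)
    show "1 \<le> H" using H1 by (simp add: H_def)
    show "D (f x) (f y) \<le> H * D (f x) (f z)" if "D x y \<le> D x z" for x y z
      using H1(2)[OF that] mono(1) by (rule order_trans)
    show "D (inv.f x) (inv.f y) \<le> H * D (inv.f x) (inv.f z)" if "D x y \<le> D x z" for x y z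
      using H2(2)[OF that] mono(2) by (rule order_trans)
  qed (auto simp: gf fg i0 j0)
  show ?thesis by (rule bilipschitz)
qed

end

subsection \<open>The Riemannian distance\<close>

text \<open>Truncated square, the building block of C^1 quadratic splines.\<close>

definition pos_square :: "real \<Rightarrow> real" where "pos_square u = (max 0 u)\<^sup>2"

lemma has_real_derivative_pos_square: "(pos_square has_real_derivative 2 * max 0 u) (at u)"
proof -
  consider "u < 0" | "u = 0" | "0 < u" by linarith
  then show ?thesis
  proof cases
    case 1
    have "((\<lambda>u. 0) has_real_derivative 0) (at u)" by simp
    then have "(pos_square has_real_derivative 0) (at u)"
      by (rule has_field_derivative_transform_within_open[of _ _ _ "{..<0}"])
        (use 1 in \<open>auto simp: pos_square_def\<close>)
    then show ?thesis using 1 by simp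
  next
    case 2
    have "((\<lambda>h. pos_square h / h) \<longlongrightarrow> 0) (at 0)"
    proof (rule Lim_null_comparison)
      show "\<forall>\<^sub>F h in at 0. norm (pos_square h / h) \<le> \<bar>h\<bar>"
        by (intro always_eventually allI) (auto simp: pos_square_def max_def power2_eq_square)
      show "((\<lambda>h::real. \<bar>h\<bar>) \<longlongrightarrow> 0) (at 0)" by (intro tendsto_rabs_zero tendsto_ident_at)
    qed
    then show ?thesis using 2 by (simp add: DERIV_def pos_square_def)
  next
    case 3
    have "((\<lambda>u. u\<^sup>2) has_real_derivative 2 * u) (at u)" by (auto intro!: derivative_eq_intros)
    then have "(pos_square has_real_derivative 2 * u) (at u)"
      by (rule has_field_derivative_transform_within_open[of _ _ _ "{0<..}"])
        (use 3 in \<open>auto simp: pos_square_def\<close>)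
    then show ?thesis using 3 by simp
  qed
qed

text \<open>Admissible curves are C^1, so the corners of the path that goes up, across and down again
  are traversed with this reparametrisation.\<close>

definition ramp :: "real \<Rightarrow> real" where
  "ramp u = 2 * pos_square u - 4 * pos_square (u - 1/2) + 2 * pos_square (u - 1)"

definition tent :: "real \<Rightarrow> real" where
  "tent u = 4 * max 0 u - 8 * max 0 (u - 1/2) + 4 * max 0 (u - 1)"

lemma has_real_derivative_ramp: "(ramp has_real_derivative tent u) (at u)"
proof -
  have *: "((\<lambda>u. pos_square (u - k)) has_real_derivative 2 * max 0 (u - k)) (at u)" for k
    using DERIV_chain2[where f = pos_square and g = "\<lambda>u. u - k" and Db = 1, OF has_real_derivative_pos_square]
    by (simp add: DERIV_ident DERIV_diff[OF DERIV_ident DERIV_const, of k, simplified])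
  show ?thesis
    unfolding ramp_def[abs_def] tent_def
    by (rule derivative_eq_intros has_real_derivative_pos_square * refl)+ simp
qed

lemma has_real_derivative_ramp_affine:
  "((\<lambda>\<sigma>. ramp (3 * \<sigma> - k)) has_real_derivative 3 * tent (3 * \<sigma> - k)) (at \<sigma> within S)"
proof -
  have "((\<lambda>\<sigma>. 3 * \<sigma> - k) has_real_derivative 3) (at \<sigma>)" by (auto intro!: derivative_eq_intros)
  then show ?thesis
    using DERIV_chain2[where f = ramp and g = "\<lambda>\<sigma>. 3 * \<sigma> - k" and Db = 3, OF has_real_derivative_ramp]
    by (auto simp: mult.commute intro: has_field_derivative_at_within)
qed

lemma continuous_on_tent [continuous_intros]:
  "continuous_on S g \<Longrightarrow> continuous_on S (\<lambda>x. tent (g x))"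
  unfolding tent_def by (intro continuous_intros)

lemma ramp_le_0: "u \<le> 0 \<Longrightarrow> ramp u = 0"
  by (simp add: ramp_def pos_square_def)

lemma ramp_ge_1: "1 \<le> u \<Longrightarrow> ramp u = 1"
  by (simp add: ramp_def pos_square_def power2_eq_square algebra_simps)

lemma tent_nonneg: "0 \<le> tent u"
  by (auto simp: tent_def max_def)

lemma tent_outside: "u \<le> 0 \<or> 1 \<le> u \<Longrightarrow> tent u = 0"
  by (auto simp: tent_def)

locale heintze =
  fixes blk :: "'n::finite \<Rightarrow> nat" and r :: nat and \<alpha> :: "nat \<Rightarrow> real"
  assumes r2: "2 \<le> r" and blk: "blk ` UNIV = {1..r}"
    and \<alpha>_pos: "\<forall>i\<in>{1..r}. \<alpha> i > 0" and \<alpha>_mono: "strict_mono_on {1..r} \<alpha>"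
begin

abbreviation a :: "'n \<Rightarrow> real" where "a j \<equiv> \<alpha> (blk j)"

lemma blk_mem: "blk j \<in> {1..r}"
  using blk by auto

lemma a_pos: "0 < a j"
  using \<alpha>_pos blk_mem by blast

lemma \<alpha>1_pos: "0 < \<alpha> 1"
  using \<alpha>_pos r2 by simp

lemma \<alpha>1_le: "i \<in> {1..r} \<Longrightarrow> \<alpha> 1 \<le> \<alpha> i"
  using \<alpha>_mono r2 unfolding strict_mono_on_def
  by (cases "i = 1") (auto intro: less_imp_le)

text \<open>Normalised so that exactly the first block has exponent 1.\<close>

definition \<beta> :: "'n \<Rightarrow> real" where "\<beta> j = a j / \<alpha> 1"

sublocale dilation \<beta>
  by unfold_locales (use \<alpha>1_le[OF blk_mem] \<alpha>1_pos in \<open>simp add: \<beta>_def\<close>)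

lemma exp_cancel: "exp (a j * u) * exp (- u * a j) = 1"
  unfolding exp_add[symmetric] by (simp add: mult.commute)

lemma G_norm_ge_snd: "\<bar>snd v\<bar> \<le> G_norm blk \<alpha> p v"
  unfolding G_norm_def by (rule real_le_rsqrt) (simp add: sum_nonneg)

lemma G_norm_ge_fst: "exp (- snd p * a j) * \<bar>fst v $ j\<bar> \<le> G_norm blk \<alpha> p v"
  unfolding G_norm_def
proof (rule real_le_rsqrt)
  have "(exp (- snd p * a j) * \<bar>fst v $ j\<bar>)\<^sup>2 = (exp (- snd p * a j) * (fst v $ j))\<^sup>2"
    by (simp add: power_mult_distrib)
  also have "\<dots> \<le> (\<Sum>j\<in>UNIV. (exp (- snd p * a j) * (fst v $ j))\<^sup>2)"
    by (rule member_le_sum) auto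
  also have "\<dots> \<le> (\<Sum>j\<in>UNIV. (exp (- snd p * a j) * (fst v $ j))\<^sup>2) + (snd v)\<^sup>2" by simp
  finally show "(exp (- snd p * a j) * \<bar>fst v $ j\<bar>)\<^sup>2
      \<le> (\<Sum>j\<in>UNIV. (exp (- snd p * a j) * (fst v $ j))\<^sup>2) + (snd v)\<^sup>2" .
qed

lemma G_norm_le: "G_norm blk \<alpha> p v \<le> (\<Sum>j\<in>UNIV. exp (- snd p * a j) * \<bar>fst v $ j\<bar>) + \<bar>snd v\<bar>"
proof -
  have "G_norm blk \<alpha> p v \<le> sqrt (\<Sum>j\<in>UNIV. (exp (- snd p * a j) * (fst v $ j))\<^sup>2) + sqrt ((snd v)\<^sup>2)"
    unfolding G_norm_def by (intro sqrt_add_le_add_sqrt) (auto intro: sum_nonneg)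
  also have "sqrt (\<Sum>j\<in>UNIV. (exp (- snd p * a j) * (fst v $ j))\<^sup>2)
      \<le> (\<Sum>j\<in>UNIV. \<bar>exp (- snd p * a j) * (fst v $ j)\<bar>)"
    using L2_set_le_sum_abs[of "\<lambda>j. exp (- snd p * a j) * (fst v $ j)" UNIV] by (simp add: L2_set_def)
  finally show ?thesis by (simp add: abs_mult)
qed

lemma G_norm_continuous:
  assumes "continuous_on S c" "continuous_on S c'"
  shows "continuous_on S (\<lambda>\<sigma>. G_norm blk \<alpha> (c \<sigma>) (c' \<sigma>))"
  unfolding G_norm_def by (intro continuous_intros assms)

text \<open>After arc length l the height is at most t + l and, seen from the other end, at most s +
  L - l. Horizontal speed is at most \<open>exp (a j * \<tau>)\<close> times the speed at height
  \<tau>; this is integrated from both ends up to the point where the two height bounds agree, at (t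
  + s + L) / 2.\<close>

lemma G_curve_lower_bounds:
  assumes "G_curve c c' (x, t) (y, s)"
  defines "L \<equiv> G_length blk \<alpha> c c'"
  shows "\<bar>t - s\<bar> \<le> L" and "\<bar>x $ j - y $ j\<bar> \<le> 2 / a j * exp (a j * (t + s + L) / 2)"
proof -
  have c: "c 0 = (x, t)" "c 1 = (y, s)" "continuous_on {0..1} c'"
    "\<And>\<sigma>. \<sigma> \<in> {0..1} \<Longrightarrow> (c has_vector_derivative c' \<sigma>) (at \<sigma> within {0..1})"
    using assms(1) by (auto simp: G_curve_def)
  have contc: "continuous_on {0..1} c"
    using c(4) has_vector_derivative_continuous continuous_on_eq_continuous_within by blast
  define v where "v \<sigma> = G_norm blk \<alpha> (c \<sigma>) (c' \<sigma>)" for \<sigma>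
  have contv: "continuous_on {0..1} v"
    unfolding v_def by (intro G_norm_continuous contc c(3))
  define l where "l \<sigma> = integral {0..\<sigma>} v" for \<sigma>
  define \<tau> where "\<tau> \<sigma> = snd (c \<sigma>)" for \<sigma>
  define X where "X \<sigma> = fst (c \<sigma>) $ j" for \<sigma>
  have l01: "l 0 = 0" "l 1 = L" by (simp_all add: l_def L_def G_length_def v_def[abs_def])
  have dl: "(l has_real_derivative v \<sigma>) (at \<sigma> within {0..1})" if "\<sigma> \<in> {0..1}" for \<sigma>
    unfolding l_def using contv that by (rule integral_has_real_derivative)
  have contl: "continuous_on {0..1} l"
    using dl DERIV_continuous continuous_on_eq_continuous_within by blast
  have cont\<tau>: "continuous_on {0..1} \<tau>" "continuous_on {0..1} X"
    unfolding \<tau>_def X_def by (intro continuous_intros contc)+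
  have at: "at \<sigma> within {0..1} = at \<sigma>" if "0 < \<sigma>" "\<sigma> < 1" for \<sigma> :: real
    using that by (intro at_within_Icc_at) auto
  have dc: "(c has_vector_derivative c' \<sigma>) (at \<sigma>)" if "0 < \<sigma>" "\<sigma> < 1" for \<sigma>
    using c(4)[of \<sigma>] that at[OF that] by simp
  have d\<tau>: "(\<tau> has_vector_derivative snd (c' \<sigma>)) (at \<sigma>)" if "0 < \<sigma>" "\<sigma> < 1" for \<sigma>
    unfolding \<tau>_def using bounded_linear.has_vector_derivative[OF bounded_linear_snd dc[OF that]] .
  have dX: "(X has_vector_derivative fst (c' \<sigma>) $ j) (at \<sigma>)" if "0 < \<sigma>" "\<sigma> < 1" for \<sigma>
    unfolding X_def using bounded_linear.has_vector_derivative[OF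
        bounded_linear_compose[OF bounded_linear_vec_nth bounded_linear_fst] dc[OF that]] by simp
  have dl': "(l has_real_derivative v \<sigma>) (at \<sigma>)" if "0 < \<sigma>" "\<sigma> < 1" for \<sigma>
    using dl[of \<sigma>] that at[OF that] by simp
  have \<tau>l: "\<bar>\<tau> w - \<tau> u\<bar> \<le> l w - l u" if "0 \<le> u" "u \<le> w" "w \<le> 1" for u w
  proof (cases "u = w")
    case False
    have "norm (\<tau> w - \<tau> u) \<le> l w - l u"
    proof (rule differentiable_bound_general[where f' = "\<lambda>\<sigma>. snd (c' \<sigma>)" and \<phi>' = v])
      show "u < w" using False that by simp
      show "continuous_on {u..w} \<tau>" "continuous_on {u..w} l"
        using that by (auto intro: continuous_on_subset[OF cont\<tau>(1)] continuous_on_subset[OF contl])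
      show "norm (snd (c' \<sigma>)) \<le> v \<sigma>" for \<sigma> by (simp add: v_def G_norm_ge_snd)
    qed (use that d\<tau> dl' in \<open>auto simp: has_real_derivative_iff_has_vector_derivative\<close>)
    then show ?thesis by simp
  qed simp
  show ts: "\<bar>t - s\<bar> \<le> L"
    using \<tau>l[of 0 1] by (simp add: \<tau>_def c l01 abs_minus_commute)
  have X': "\<bar>fst (c' \<sigma>) $ j\<bar> \<le> exp (a j * \<tau> \<sigma>) * v \<sigma>" for \<sigma>
  proof -
    have "exp (a j * \<tau> \<sigma>) * (exp (- \<tau> \<sigma> * a j) * \<bar>fst (c' \<sigma>) $ j\<bar>) \<le> exp (a j * \<tau> \<sigma>) * v \<sigma>"
      unfolding v_def \<tau>_def by (intro mult_left_mono G_norm_ge_fst) simp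
    then show ?thesis by (simp only: exp_cancel mult.assoc[symmetric] mult_1_left)
  qed
  have v0: "0 \<le> v \<sigma>" for \<sigma> using G_norm_ge_snd[of "c' \<sigma>" "c \<sigma>"] by (simp add: v_def)
  have "\<exists>\<sigma>\<ge>0. \<sigma> \<le> 1 \<and> l \<sigma> = (s + L - t) / 2"
    using ts l01 contl by (intro IVT') auto
  then obtain \<sigma>0 where \<sigma>0: "0 \<le> \<sigma>0" "\<sigma>0 \<le> 1" "l \<sigma>0 = (s + L - t) / 2" by blast
  \<comment> \<open>Both halves at once: k = 1 for the rising bound on the height, k = -1 for the
    falling one.\<close>
  have half: "\<bar>X w - X u\<bar> \<le> k * exp (a j * (b + k * l w)) / a j - k * exp (a j * (b + k * l u)) / a j"
    if uw: "0 \<le> u" "u \<le> w" "w \<le> 1" and k: "k * k = 1"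
      and le: "\<And>\<sigma>. \<sigma> \<in> {u..w} \<Longrightarrow> \<tau> \<sigma> \<le> b + k * l \<sigma>" for u w k b
  proof (cases "u = w")
    case False
    have "norm (X w - X u) \<le> k * exp (a j * (b + k * l w)) / a j - k * exp (a j * (b + k * l u)) / a j"
    proof (rule differentiable_bound_general[where f' = "\<lambda>\<sigma>. fst (c' \<sigma>) $ j"
            and \<phi>' = "\<lambda>\<sigma>. exp (a j * (b + k * l \<sigma>)) * v \<sigma>"])
      show "u < w" using False uw by simp
      show "continuous_on {u..w} X"
        using uw by (auto intro: continuous_on_subset[OF cont\<tau>(2)])
      have "continuous_on {u..w} l" using uw by (auto intro: continuous_on_subset[OF contl])
      then show "continuous_on {u..w} (\<lambda>\<sigma>. k * exp (a j * (b + k * l \<sigma>)) / a j)"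
        using a_pos[of j] by (intro continuous_intros) auto
      fix \<sigma> assume \<sigma>: "u < \<sigma>" "\<sigma> < w"
      show "(X has_vector_derivative fst (c' \<sigma>) $ j) (at \<sigma>)" using \<sigma> uw by (intro dX) auto
      have "((\<lambda>\<sigma>. k * exp (a j * (b + k * l \<sigma>)) / a j) has_real_derivative
          k * (exp (a j * (b + k * l \<sigma>)) * (a j * (k * v \<sigma>))) / a j) (at \<sigma>)"
        using \<sigma> uw by (auto intro!: derivative_eq_intros dl')
      also have "k * (exp (a j * (b + k * l \<sigma>)) * (a j * (k * v \<sigma>))) / a j
          = (k * k) * exp (a j * (b + k * l \<sigma>)) * v \<sigma>"
        using a_pos[of j] by simp
      finally show "((\<lambda>\<sigma>. k * exp (a j * (b + k * l \<sigma>)) / a j) has_vector_derivative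
          exp (a j * (b + k * l \<sigma>)) * v \<sigma>) (at \<sigma>)"
        using k by (simp add: has_real_derivative_iff_has_vector_derivative)
      have "exp (a j * \<tau> \<sigma>) * v \<sigma> \<le> exp (a j * (b + k * l \<sigma>)) * v \<sigma>"
        using le[of \<sigma>] \<sigma> a_pos[of j] v0 by (intro mult_right_mono) auto
      then show "norm (fst (c' \<sigma>) $ j) \<le> exp (a j * (b + k * l \<sigma>)) * v \<sigma>"
        using X'[of \<sigma>] by simp
    qed
    then show ?thesis by simp
  qed simp
  have mid: "t + l \<sigma>0 = (t + s + L) / 2" "s + L - l \<sigma>0 = (t + s + L) / 2"
    using \<sigma>0(3) by (simp_all add: field_simps)
  have "\<bar>X \<sigma>0 - X 0\<bar> \<le> exp (a j * (t + l \<sigma>0)) / a j - exp (a j * t) / a j"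
  proof -
    have "\<tau> \<sigma> \<le> t + 1 * l \<sigma>" if "\<sigma> \<in> {0..\<sigma>0}" for \<sigma>
      using \<tau>l[of 0 \<sigma>] that \<sigma>0 by (simp add: \<tau>_def c l01)
    then show ?thesis using half[of 0 \<sigma>0 1 t] \<sigma>0(1,2) by (simp add: l01)
  qed
  moreover have "\<bar>X 1 - X \<sigma>0\<bar> \<le> exp (a j * (s + L - l \<sigma>0)) / a j - exp (a j * s) / a j"
  proof -
    have "\<tau> \<sigma> \<le> (s + L) + (- 1) * l \<sigma>" if "\<sigma> \<in> {\<sigma>0..1}" for \<sigma>
      using \<tau>l[of \<sigma> 1] that \<sigma>0 by (simp add: \<tau>_def c l01)
    then show ?thesis using half[of \<sigma>0 1 "-1" "s + L"] \<sigma>0(1,2) by (simp add: l01)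
  qed
  moreover have "0 \<le> exp (a j * t) / a j" "0 \<le> exp (a j * s) / a j" using a_pos[of j] by simp_all
  ultimately have "\<bar>X 1 - X 0\<bar> \<le> exp (a j * ((t + s + L) / 2)) / a j + exp (a j * ((t + s + L) / 2)) / a j"
    unfolding mid by linarith
  then show "\<bar>x $ j - y $ j\<bar> \<le> 2 / a j * exp (a j * (t + s + L) / 2)"
    by (simp add: X_def c abs_minus_commute)
qed

text \<open>At height T each coordinate of \<open>y - x\<close> has length at most 1, so the
  crossing costs at most \<open>CARD('n)\<close>; the vertical parts cost T - t and T - s.\<close>

lemma G_curve_upper_bound:
  assumes T: "t \<le> T" "s \<le> T" and le: "\<And>j. \<bar>x $ j - y $ j\<bar> \<le> exp (a j * T)"
  shows "\<exists>c c'. G_curve c c' (x, t) (y, s) \<and> G_length blk \<alpha> c c' \<le> 2 * T - t - s + CARD('n)"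
proof -
  \<comment> \<open>Each leg takes a third of the parameter interval.\<close>
  define c where "c \<sigma> = (x + ramp (3 * \<sigma> - 1) *\<^sub>R (y - x),
      t + (T - t) * ramp (3 * \<sigma> - 0) + (s - T) * ramp (3 * \<sigma> - 2))" for \<sigma>
  define c' where "c' \<sigma> = ((3 * tent (3 * \<sigma> - 1)) *\<^sub>R (y - x),
      (T - t) * (3 * tent (3 * \<sigma> - 0)) + (s - T) * (3 * tent (3 * \<sigma> - 2)))" for \<sigma>
  \<comment> \<open>A primitive of the pointwise speed bound, so the length is at most its
    increment.\<close>
  define \<psi> where "\<psi> \<sigma> = CARD('n) * ramp (3 * \<sigma> - 1) + (T - t) * ramp (3 * \<sigma> - 0) + (T - s) * ramp (3 * \<sigma> - 2)" for \<sigma>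
  define \<psi>' where "\<psi>' \<sigma> = CARD('n) * (3 * tent (3 * \<sigma> - 1)) + (T - t) * (3 * tent (3 * \<sigma> - 0))
      + (T - s) * (3 * tent (3 * \<sigma> - 2))" for \<sigma>
  note rv = has_real_derivative_ramp_affine[unfolded has_real_derivative_iff_has_vector_derivative]
  have dc: "(c has_vector_derivative c' \<sigma>) (at \<sigma> within S)" for \<sigma> S
  proof -
    have 1: "((\<lambda>\<sigma>. x + ramp (3 * \<sigma> - 1) *\<^sub>R (y - x)) has_vector_derivative (3 * tent (3 * \<sigma> - 1)) *\<^sub>R (y - x))
        (at \<sigma> within S)"
      using has_vector_derivative_add[OF has_vector_derivative_const[of x]
          bounded_linear.has_vector_derivative[OF bounded_linear_scaleR_left[of "y - x"] rv]] by simp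
    have "((\<lambda>\<sigma>. t + (T - t) * ramp (3 * \<sigma> - 0) + (s - T) * ramp (3 * \<sigma> - 2)) has_real_derivative
        0 + (T - t) * (3 * tent (3 * \<sigma> - 0)) + (s - T) * (3 * tent (3 * \<sigma> - 2))) (at \<sigma> within S)"
      by (intro DERIV_add DERIV_const DERIV_cmult has_real_derivative_ramp_affine)
    then show ?thesis unfolding c_def c'_def
      using 1 by (intro has_vector_derivative_Pair) (auto simp: has_real_derivative_iff_has_vector_derivative)
  qed
  have cc': "continuous_on S c'" for S
    unfolding c'_def by (intro continuous_intros)
  have curve: "G_curve c c' (x, t) (y, s)"
    unfolding G_curve_def using dc cc' by (auto simp: c_def ramp_le_0 ramp_ge_1)
  have contc: "continuous_on {0..1} c"
    using has_vector_derivative_continuous[OF dc] by (simp add: continuous_on_eq_continuous_within)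
  have bound: "G_norm blk \<alpha> (c \<sigma>) (c' \<sigma>) \<le> \<psi>' \<sigma>" for \<sigma>
  proof -
    have "exp (- snd (c \<sigma>) * a j) * \<bar>fst (c' \<sigma>) $ j\<bar> \<le> 3 * tent (3 * \<sigma> - 1)" for j
    proof (cases "3 * \<sigma> - 1 \<le> 0 \<or> 1 \<le> 3 * \<sigma> - 1")
      case True
      then show ?thesis by (simp add: c'_def tent_outside)
    next
      case False
      then have "snd (c \<sigma>) = T" by (simp add: c_def ramp_le_0 ramp_ge_1)
      then have "exp (- snd (c \<sigma>) * a j) * \<bar>fst (c' \<sigma>) $ j\<bar>
          = 3 * tent (3 * \<sigma> - 1) * (exp (- T * a j) * \<bar>x $ j - y $ j\<bar>)"
        using tent_nonneg[of "3 * \<sigma> - 1"] by (simp add: c'_def abs_mult abs_minus_commute)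
      also have "\<dots> \<le> 3 * tent (3 * \<sigma> - 1) * (exp (- T * a j) * exp (a j * T))"
        using tent_nonneg[of "3 * \<sigma> - 1"] le[of j] by (intro mult_left_mono) auto
      also have "\<dots> = 3 * tent (3 * \<sigma> - 1)" 
        by (simp only: exp_cancel mult.commute[of "exp (- T * a j)"] mult_1_right)
      finally show ?thesis .
    qed
    then have "(\<Sum>j\<in>UNIV. exp (- snd (c \<sigma>) * a j) * \<bar>fst (c' \<sigma>) $ j\<bar>) \<le> (\<Sum>j\<in>(UNIV :: 'n set). 3 * tent (3 * \<sigma> - 1))"
      by (intro sum_mono)
    moreover have "\<bar>snd (c' \<sigma>)\<bar> \<le> (T - t) * (3 * tent (3 * \<sigma> - 0)) + (T - s) * (3 * tent (3 * \<sigma> - 2))"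
    proof -
      have "\<bar>u + (s - T) * v\<bar> \<le> u + (T - s) * v" if "0 \<le> u" "0 \<le> v" for u v
      proof -
        have "0 \<le> (T - s) * v" using that T by simp
        moreover have "(s - T) * v = - ((T - s) * v)" by (simp add: algebra_simps)
        ultimately show ?thesis using that(1) by linarith
      qed
      then show ?thesis unfolding c'_def using T tent_nonneg by simp
    qed
    ultimately show ?thesis
      using G_norm_le[of "c \<sigma>" "c' \<sigma>"] unfolding \<psi>'_def by simp
  qed
  have "(\<psi> has_real_derivative \<psi>' \<sigma>) (at \<sigma> within {0..1})" for \<sigma>
    unfolding \<psi>_def \<psi>'_def by (intro DERIV_add DERIV_cmult has_real_derivative_ramp_affine)
  then have "(\<psi>' has_integral \<psi> 1 - \<psi> 0) {0..1}"
    by (intro fundamental_theorem_of_calculus) (auto simp: has_real_derivative_iff_has_vector_derivative)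
  then have int: "\<psi>' integrable_on {0..1}" "integral {0..1} \<psi>' = \<psi> 1 - \<psi> 0"
    by (auto simp: has_integral_iff)
  have "G_length blk \<alpha> c c' \<le> integral {0..1} \<psi>'"
    unfolding G_length_def
    by (intro integral_le integrable_continuous_real G_norm_continuous contc cc' int(1) bound)
  also have "\<dots> = 2 * T - t - s + CARD('n)"
    unfolding int(2) by (simp add: \<psi>_def ramp_le_0 ramp_ge_1)
  finally show ?thesis using curve by blast
qed

text \<open>\<open>ln (E p q) / \<alpha> 1\<close> is the height to which a nearly shortest path
  climbs: above both endpoints and high enough for the horizontal distance to become
  bounded.\<close>

definition E :: "'n point \<Rightarrow> 'n point \<Rightarrow> real" where
  "E p q = max (D (fst p) (fst q)) (max (exp (\<alpha> 1 * snd p)) (exp (\<alpha> 1 * snd q)))"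

lemma E_pos: "0 < E p q"
  by (simp add: E_def less_max_iff_disj)

lemma E_nonneg [simp]: "0 \<le> E p q"
  using E_pos[of p q] by linarith

lemma D_attained: "\<exists>j. D x y = \<bar>x $ j - y $ j\<bar> powr (1 / \<beta> j)"
proof -
  have "D x y \<in> range (\<lambda>j. \<bar>x $ j - y $ j\<bar> powr (1 / \<beta> j))"
    unfolding box_dist_def by (intro Max_in) auto
  then show ?thesis by auto
qed

text \<open>If a height attains the maximum in \<open>E\<close>, the bound on height differences
  suffices. If \<open>D\<close> attains it, its maximal coordinate goes into the exponential
  estimate; the sum over j makes the error uniform.\<close>

lemma G_length_ge:
  assumes c: "G_curve c c' p q"
  shows "2 / \<alpha> 1 * ln (E p q) - snd p - snd q - (\<Sum>j\<in>UNIV. \<bar>2 / a j * ln (2 / a j)\<bar>) \<le> G_length blk \<alpha> c c'"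
    (is "_ - ?C \<le> ?L")
proof -
  obtain x t y s where pq: "p = (x, t)" "q = (y, s)" by fastforce
  note lb = G_curve_lower_bounds[OF c[unfolded pq]]
  have C0: "0 \<le> ?C" by (intro sum_nonneg) auto
  consider "E p q = exp (\<alpha> 1 * t)" | "E p q = exp (\<alpha> 1 * s)" | "E p q = D x y"
    unfolding E_def pq fst_conv snd_conv by (metis max_def)
  then show ?thesis
  proof cases
    case 3
    obtain j where j: "D x y = \<bar>x $ j - y $ j\<bar> powr (1 / \<beta> j)" using D_attained by blast
    have pos: "0 < \<bar>x $ j - y $ j\<bar>" using E_pos[of p q] 3 j by (metis abs_ge_zero less_eq_real_def powr_0 abs_zero)
    have "ln \<bar>x $ j - y $ j\<bar> \<le> ln (2 / a j * exp (a j * (t + s + ?L) / 2))"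
      using lb(2)[of j] pos a_pos[of j] by (intro ln_mono) auto
    also have "\<dots> = ln (2 / a j) + a j * (t + s + ?L) / 2"
      using a_pos[of j] by (subst ln_mult) auto
    finally have 1: "2 / a j * ln \<bar>x $ j - y $ j\<bar> \<le> 2 / a j * (ln (2 / a j) + a j * (t + s + ?L) / 2)"
      using a_pos[of j] by (intro mult_left_mono) auto
    have "2 / \<alpha> 1 * ln (E p q) = 2 / a j * ln \<bar>x $ j - y $ j\<bar>"
      unfolding 3 j using pos \<alpha>1_pos a_pos[of j] by (simp add: ln_powr \<beta>_def)
    also have "\<dots> \<le> 2 / a j * (ln (2 / a j) + a j * (t + s + ?L) / 2)" by (rule 1)
    also have "\<dots> = 2 / a j * ln (2 / a j) + (t + s + ?L)"
      using a_pos[of j] by (simp add: field_simps)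
    also have "2 / a j * ln (2 / a j) \<le> ?C"
      by (rule order_trans[OF abs_ge_self], rule member_le_sum[where f = "\<lambda>j. \<bar>2 / a j * ln (2 / a j)\<bar>"]) auto
    finally show ?thesis by (simp add: pq)
  qed (use lb(1) C0 \<alpha>1_pos in \<open>auto simp: pq\<close>)
qed

lemma G_length_attained:
  "\<exists>c c'. G_curve c c' p q \<and> G_length blk \<alpha> c c' \<le> 2 / \<alpha> 1 * ln (E p q) - snd p - snd q + CARD('n)"
proof -
  obtain x t y s where pq: "p = (x, t)" "q = (y, s)" by fastforce
  define T where "T = ln (E p q) / \<alpha> 1"
  have ET: "exp (\<alpha> 1 * T) = E p q" using \<alpha>1_pos E_pos by (simp add: T_def)
  have "exp (\<alpha> 1 * t) \<le> exp (\<alpha> 1 * T)" "exp (\<alpha> 1 * s) \<le> exp (\<alpha> 1 * T)"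
    unfolding ET by (simp_all add: E_def pq)
  then have T: "t \<le> T" "s \<le> T" using \<alpha>1_pos by simp_all
  have "\<bar>x $ j - y $ j\<bar> \<le> exp (a j * T)" for j
  proof -
    have "D x y \<le> E p q" by (simp add: E_def pq)
    then have "\<bar>x $ j - y $ j\<bar> \<le> E p q powr \<beta> j" using E_pos[of p q] by (simp add: D_le_iff)
    also have "\<dots> = exp (a j * T)"
      using E_pos[of p q] by (simp add: powr_def \<beta>_def T_def)
    finally show ?thesis .
  qed
  from G_curve_upper_bound[OF T this] show ?thesis by (simp add: pq T_def)
qed

lemma G_dist_estimate:
  "\<exists>C. \<forall>p q. \<bar>G_dist blk \<alpha> p q - (2 / \<alpha> 1 * ln (E p q) - snd p - snd q)\<bar> \<le> C"
proof -
  define C0 where "C0 = (\<Sum>j\<in>UNIV. \<bar>2 / a j * ln (2 / a j)\<bar>)"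
  define C where "C = max C0 CARD('n)"
  have "\<bar>G_dist blk \<alpha> p q - (2 / \<alpha> 1 * ln (E p q) - snd p - snd q)\<bar> \<le> C" for p q
  proof -
    define A where "A = {G_length blk \<alpha> c c' | c c'. G_curve c c' p q}"
    have lower: "2 / \<alpha> 1 * ln (E p q) - snd p - snd q - C0 \<le> L" if "L \<in> A" for L
      using that G_length_ge unfolding A_def C0_def by blast
    obtain L where L: "L \<in> A" "L \<le> 2 / \<alpha> 1 * ln (E p q) - snd p - snd q + CARD('n)"
      using G_length_attained[of p q] unfolding A_def by blast
    have "2 / \<alpha> 1 * ln (E p q) - snd p - snd q - C0 \<le> Inf A"
      using L(1) lower by (intro cInf_greatest) auto
    moreover have "Inf A \<le> L"
      using L(1) lower by (intro cInf_lower bdd_belowI) auto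
    moreover have "G_dist blk \<alpha> p q = Inf A" by (simp add: G_dist_def A_def)
    ultimately show ?thesis using L(2) unfolding C_def by linarith
  qed
  then show ?thesis by blast
qed

end

subsection \<open>Gromov products on the boundary\<close>

context heintze
begin

text \<open>A uniform additive error, fixed once so that later bounds can refer to it.\<close>

definition gprod_err :: real where
  "gprod_err = (SOME C. \<forall>p q s. \<bar>G_gprod blk \<alpha> p q s - (ln (E p q * E p s / E q s) / \<alpha> 1 - snd p)\<bar> \<le> C)"

lemma gprod_estimate:
  "\<bar>G_gprod blk \<alpha> p q s - (ln (E p q * E p s / E q s) / \<alpha> 1 - snd p)\<bar> \<le> gprod_err"
proof -
  obtain C where C: "\<And>p q. \<bar>G_dist blk \<alpha> p q - (2 / \<alpha> 1 * ln (E p q) - snd p - snd q)\<bar> \<le> C"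
    using G_dist_estimate by blast
  have "\<bar>G_gprod blk \<alpha> p q s - (ln (E p q * E p s / E q s) / \<alpha> 1 - snd p)\<bar> \<le> 3 * C / 2" for p q s
  proof -
    have "ln (E p q * E p s / E q s) / \<alpha> 1 = ln (E p q) / \<alpha> 1 + ln (E p s) / \<alpha> 1 - ln (E q s) / \<alpha> 1"
      using E_pos by (simp add: ln_mult ln_div less_imp_neq[symmetric] add_divide_distrib diff_divide_distrib)
    then show ?thesis
      using C[of p q] C[of p s] C[of q s] unfolding G_gprod_def by (simp add: field_simps abs_le_iff)
  qed
  then show ?thesis unfolding gprod_err_def by (rule_tac someI2[of _ "3 * C / 2"]) blast+
qed

lemma E_commute: "E p q = E q p"
  by (simp add: E_def D_commute max.commute max.left_commute)

lemma E_ge_fst: "exp (\<alpha> 1 * snd p) \<le> E p q" and E_ge_snd: "exp (\<alpha> 1 * snd q) \<le> E p q"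
  and E_ge_D: "D (fst p) (fst q) \<le> E p q"
  by (simp_all add: E_def)

lemma E_triangle: "E p s \<le> E p q + E q s"
proof -
  have "D (fst p) (fst s) \<le> E p q + E q s"
    using D_triangle[of "fst p" "fst s" "fst q"] E_ge_D[of p q] E_ge_D[of q s] by linarith
  moreover have "exp (\<alpha> 1 * snd p) \<le> E p q + E q s" "exp (\<alpha> 1 * snd s) \<le> E p q + E q s"
    using E_ge_fst[of p q] E_ge_snd[of s q] E_pos[of q s] E_pos[of p q] by linarith+
  ultimately show ?thesis by (subst E_def) simp
qed

text \<open>Up to a bounded factor, the exponential of \<open>\<alpha> 1\<close> times the sum of
  the Gromov product and the height of p.\<close>

definition ratio :: "'n point \<Rightarrow> 'n point \<Rightarrow> 'n point \<Rightarrow> real" where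
  "ratio p q s = E p q * E p s / E q s"

lemma ratio_pos: "0 < ratio p q s"
  using E_pos by (simp add: ratio_def)

lemma ratio_ge_of_gprod_ge:
  assumes "0 < M" "ln M / \<alpha> 1 + gprod_err - snd p \<le> G_gprod blk \<alpha> p q s"
  shows "M \<le> ratio p q s"
proof -
  have "ln M / \<alpha> 1 \<le> ln (ratio p q s) / \<alpha> 1"
    using gprod_estimate[of p q s] assms(2) unfolding ratio_def by linarith
  then show ?thesis using \<alpha>1_pos assms(1) ratio_pos by (simp add: divide_le_cancel)
qed

lemma gprod_ge_of_ratio_ge:
  assumes "0 < M" "M \<le> ratio p q s"
  shows "ln M / \<alpha> 1 - snd p - gprod_err \<le> G_gprod blk \<alpha> p q s"
proof -
  have "ln M / \<alpha> 1 \<le> ln (ratio p q s) / \<alpha> 1"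
    using \<alpha>1_pos assms ratio_pos by (simp add: divide_le_cancel)
  then show ?thesis using gprod_estimate[of p q s] unfolding ratio_def by linarith
qed

lemma gprod_le_of_ratio_le:
  assumes "ratio p q s \<le> M"
  shows "G_gprod blk \<alpha> p q s \<le> ln M / \<alpha> 1 - snd p + gprod_err"
proof -
  have "0 < M" using assms ratio_pos[of p q s] by linarith
  then have "ln (ratio p q s) / \<alpha> 1 \<le> ln M / \<alpha> 1"
    using \<alpha>1_pos assms ratio_pos by (simp add: divide_le_cancel)
  then show ?thesis using gprod_estimate[of p q s] unfolding ratio_def by linarith
qed

lemma conv_to_ratio:
  assumes "conv_to blk \<alpha> q \<xi>" "0 < M"
  obtains N where "\<And>i j. N \<le> i \<Longrightarrow> N \<le> j \<Longrightarrow> M \<le> ratio (0, 0) (q i) (bd_rep \<xi> j)"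
proof -
  define Z where "Z = ln M / \<alpha> 1 + gprod_err - snd (0 :: real^'n, 0 :: real)"
  obtain N where "\<forall>m\<ge>N. \<forall>n\<ge>N. Z \<le> G_gprod blk \<alpha> (0, 0) (q n) (bd_rep \<xi> m)"
    using assms(1) unfolding conv_to_def filterlim_at_top eventually_prod_sequentially prod.case by blast
  then show ?thesis
    using ratio_ge_of_gprod_ge[OF assms(2)] that[of N] unfolding Z_def by blast
qed

lemma conv_to_Some:
  assumes q: "conv_to blk \<alpha> q (Some x)" and \<epsilon>: "0 < \<epsilon>"
  obtains N where "\<And>i. N \<le> i \<Longrightarrow> D (fst (q i)) x < \<epsilon> \<and> exp (\<alpha> 1 * snd (q i)) < \<epsilon>"
proof -
  define m0 where "m0 = max (D 0 x) 1"
  have m0: "1 \<le> m0" by (simp add: m0_def)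
  \<comment> \<open>The summand \<open>m0\<close> absorbs the term \<open>m0 * E (q i) s\<close>
    from the triangle inequality; the rest forces
    \<open>2 * E (q i) s \<le> \<epsilon>\<close>.\<close>
  define M where "M = m0 + 2 * m0 * m0 / \<epsilon>"
  have M: "0 < M" using m0 \<epsilon> by (simp add: M_def add_pos_nonneg)
  obtain N where N: "\<And>i j. N \<le> i \<Longrightarrow> N \<le> j \<Longrightarrow> M \<le> ratio (0, 0) (q i) (bd_rep (Some x) j)"
    using conv_to_ratio[OF q M] by blast
  have "D (fst (q i)) x < \<epsilon> \<and> exp (\<alpha> 1 * snd (q i)) < \<epsilon>" if i: "N \<le> i" for i
  proof -
    define s where "s = bd_rep (Some x) N"
    have s: "s = (x, - real N)" by (simp add: s_def bd_rep_def)
    have Es: "E (0, 0) s \<le> m0" using \<alpha>1_pos by (auto simp: s E_def m0_def)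
    have tri: "E (0, 0) (q i) \<le> m0 + E (q i) s"
      using E_triangle[of "(0, 0)" "q i" s] Es E_commute[of s "q i"] by linarith
    have "M * E (q i) s \<le> E (0, 0) (q i) * E (0, 0) s"
      using N[OF i order_refl] E_pos[of "q i" s] by (simp add: ratio_def s_def field_simps)
    also have "\<dots> \<le> (m0 + E (q i) s) * m0"
      using Es tri m0 by (intro mult_mono) auto
    finally have "2 * m0 * m0 / \<epsilon> * E (q i) s \<le> m0 * m0"
      by (simp add: M_def algebra_simps)
    then have "2 * E (q i) s \<le> \<epsilon>" using m0 \<epsilon> by (simp add: field_simps)
    then have "E (q i) s < \<epsilon>" using \<epsilon> E_pos[of "q i" s] by linarith
    then show ?thesis using E_ge_D[of "q i" s] E_ge_fst[of "q i" s] s by simp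
  qed
  then show ?thesis using that by blast
qed

text \<open>Seen from the representative at height N, the base point is no farther than
  \<open>q i\<close> in the sense of \<open>E\<close>, so \<open>E (0, 0) (q i)\<close> dominates
  the ratio.\<close>

lemma conv_to_None:
  assumes q: "conv_to blk \<alpha> q None" and B: "0 < B"
  obtains N where "\<And>i. N \<le> i \<Longrightarrow> B \<le> E (0, 0) (q i)"
proof -
  obtain N where N: "\<And>i j. N \<le> i \<Longrightarrow> N \<le> j \<Longrightarrow> B \<le> ratio (0, 0) (q i) (bd_rep None j)"
    using conv_to_ratio[OF q B] by blast
  have "B \<le> E (0, 0) (q i)" if i: "N \<le> i" for i
  proof -
    define s where "s = bd_rep (None :: 'n bdry) N"
    have s: "s = (0, real N)" by (simp add: s_def bd_rep_def)
    have "E (0, 0) s = exp (\<alpha> 1 * real N)" using \<alpha>1_pos by (simp add: s E_def)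
    also have "\<dots> \<le> E (q i) s" using E_ge_snd[of s "q i"] by (simp add: s)
    finally have "E (0, 0) (q i) * E (0, 0) s \<le> E (0, 0) (q i) * E (q i) s"
      by (intro mult_left_mono) auto
    then have "ratio (0, 0) (q i) s \<le> E (0, 0) (q i)"
      using E_pos[of "q i" s] by (simp add: ratio_def field_simps)
    then show ?thesis using N[OF i order_refl] by (simp add: s_def)
  qed
  then show ?thesis using that by blast
qed

text \<open>Makes vertical rays available as test sequences in the supremum defining
  \<open>bd_gprod\<close>.\<close>

lemma conv_to_bd_rep: "conv_to blk \<alpha> (bd_rep \<xi>) \<xi>"
proof -
  have "\<exists>N. \<forall>m\<ge>N. \<forall>n\<ge>N. Z \<le> G_gprod blk \<alpha> (0, 0) (bd_rep \<xi> n) (bd_rep \<xi> m)" for Z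
  proof -
    define N where "N = nat \<lceil>Z + gprod_err\<rceil>"
    have NZ: "Z + gprod_err \<le> real N" by (simp add: N_def of_nat_ceiling)
    have "Z \<le> G_gprod blk \<alpha> (0, 0) (bd_rep \<xi> n) (bd_rep \<xi> m)" if nm: "N \<le> n" "N \<le> m" for n m
    proof -
      have "exp (\<alpha> 1 * real N) \<le> ratio (0, 0) (bd_rep \<xi> n) (bd_rep \<xi> m)"
      proof (cases \<xi>)
        case None
        then have rep: "bd_rep \<xi> k = (0, real k)" for k by (simp add: bd_rep_def)
        have ex: "exp (\<alpha> 1 * real N) \<le> exp (\<alpha> 1 * real n)" "exp (\<alpha> 1 * real N) \<le> exp (\<alpha> 1 * real m)"
          using nm \<alpha>1_pos by auto
        have "exp (\<alpha> 1 * real N) * E (bd_rep \<xi> n) (bd_rep \<xi> m)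
            = exp (\<alpha> 1 * real N) * max (exp (\<alpha> 1 * real n)) (exp (\<alpha> 1 * real m))"
          by (simp add: E_def rep le_max_iff_disj max_absorb2)
        also have "\<dots> \<le> exp (\<alpha> 1 * real n) * exp (\<alpha> 1 * real m)"
          using ex by (auto simp: max_def mult.commute)
        also have "\<dots> \<le> E (0, 0) (bd_rep \<xi> n) * E (0, 0) (bd_rep \<xi> m)"
          using E_ge_snd[of "bd_rep \<xi> n" "(0, 0)"] E_ge_snd[of "bd_rep \<xi> m" "(0, 0)"]
          by (intro mult_mono) (auto simp: rep)
        finally show ?thesis
          unfolding ratio_def using E_pos by (simp add: pos_le_divide_eq)
      next
        case (Some x)
        then have rep: "bd_rep \<xi> k = (x, - real k)" for k by (simp add: bd_rep_def)
        have "E (bd_rep \<xi> n) (bd_rep \<xi> m) \<le> exp (- (\<alpha> 1 * real N))"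
          using nm \<alpha>1_pos by (simp add: E_def rep)
        then have "exp (\<alpha> 1 * real N) * E (bd_rep \<xi> n) (bd_rep \<xi> m) \<le> exp (\<alpha> 1 * real N) * exp (- (\<alpha> 1 * real N))"
          by (intro mult_left_mono) auto
        also have "\<dots> = 1 * 1" by (simp flip: exp_add)
        also have "\<dots> \<le> E (0, 0) (bd_rep \<xi> n) * E (0, 0) (bd_rep \<xi> m)"
          using E_ge_fst[of "(0, 0)" "bd_rep \<xi> n"] E_ge_fst[of "(0, 0)" "bd_rep \<xi> m"]
          by (intro mult_mono) auto
        finally show ?thesis
          unfolding ratio_def using E_pos by (simp add: pos_le_divide_eq)
      qed
      then have "ln (exp (\<alpha> 1 * real N)) / \<alpha> 1 - snd (0 :: real^'n, 0 :: real) - gprod_err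
          \<le> G_gprod blk \<alpha> (0, 0) (bd_rep \<xi> n) (bd_rep \<xi> m)"
        by (intro gprod_ge_of_ratio_ge) auto
      then show ?thesis using NZ \<alpha>1_pos by simp
    qed
    then show ?thesis by blast
  qed
  then have "filterlim (\<lambda>(i, j). G_gprod blk \<alpha> (0, 0) (bd_rep \<xi> i) (bd_rep \<xi> j)) at_top
      (sequentially \<times>\<^sub>F sequentially)"
    unfolding filterlim_at_top eventually_prod_sequentially by simp
  then show ?thesis by (simp add: conv_to_def conv_infty_def)
qed

text \<open>The supremum is bounded below by one pair of vertical rays and above by all pairs of
  sequences. The factor 8 leaves room for the factors of 2 lost when points of a sequence replace
  their limits.\<close>

lemma bd_gprod_bounds:
  assumes W: "0 < W"
    and low: "\<exists>N. \<forall>m\<ge>N. \<forall>n\<ge>N. W \<le> ratio p (bd_rep \<xi> n) (bd_rep \<eta> m)"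
    and up: "\<And>xs ys. conv_to blk \<alpha> xs \<xi> \<Longrightarrow> conv_to blk \<alpha> ys \<eta> \<Longrightarrow>
       \<exists>N. \<forall>m\<ge>N. \<forall>n\<ge>N. ratio p (xs n) (ys m) \<le> 8 * W"
  shows "ereal (ln W / \<alpha> 1 - snd p - gprod_err) \<le> bd_gprod blk \<alpha> p \<xi> \<eta>"
    and "bd_gprod blk \<alpha> p \<xi> \<eta> \<le> ereal (ln (8 * W) / \<alpha> 1 - snd p + gprod_err)"
proof -
  let ?F = "sequentially \<times>\<^sub>F sequentially :: (nat \<times> nat) filter"
  have bot: "?F \<noteq> bot" by (simp add: prod_filter_eq_bot)
  obtain N where N: "\<forall>m\<ge>N. \<forall>n\<ge>N. W \<le> ratio p (bd_rep \<xi> n) (bd_rep \<eta> m)" using low by blast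
  have "eventually (\<lambda>z. ereal (ln W / \<alpha> 1 - snd p - gprod_err) \<le>
      (\<lambda>(i, j). ereal (G_gprod blk \<alpha> p (bd_rep \<xi> i) (bd_rep \<eta> j))) z) ?F"
    unfolding eventually_prod_sequentially using N gprod_ge_of_ratio_ge[OF W] by (intro exI[of _ N]) auto
  then have "ereal (ln W / \<alpha> 1 - snd p - gprod_err) \<le>
      Liminf ?F (\<lambda>(i, j). ereal (G_gprod blk \<alpha> p (bd_rep \<xi> i) (bd_rep \<eta> j)))"
    by (rule Liminf_bounded)
  also have "\<dots> \<le> bd_gprod blk \<alpha> p \<xi> \<eta>"
    unfolding bd_gprod_def
    by (rule SUP_upper2[of "(bd_rep \<xi>, bd_rep \<eta>)"]) (auto intro: conv_to_bd_rep)
  finally show "ereal (ln W / \<alpha> 1 - snd p - gprod_err) \<le> bd_gprod blk \<alpha> p \<xi> \<eta>" .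
  show "bd_gprod blk \<alpha> p \<xi> \<eta> \<le> ereal (ln (8 * W) / \<alpha> 1 - snd p + gprod_err)"
    unfolding bd_gprod_def
  proof (rule SUP_least, clarify)
    fix xs ys assume "conv_to blk \<alpha> xs \<xi>" "conv_to blk \<alpha> ys \<eta>"
    then obtain N where N: "\<forall>m\<ge>N. \<forall>n\<ge>N. ratio p (xs n) (ys m) \<le> 8 * W" using up by blast
    have "eventually (\<lambda>z. (\<lambda>(i, j). ereal (G_gprod blk \<alpha> p (xs i) (ys j))) z
        \<le> ereal (ln (8 * W) / \<alpha> 1 - snd p + gprod_err)) ?F"
      unfolding eventually_prod_sequentially using N gprod_le_of_ratio_le by (intro exI[of _ N]) auto
    then have "Limsup ?F (\<lambda>(i, j). ereal (G_gprod blk \<alpha> p (xs i) (ys j)))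
        \<le> ereal (ln (8 * W) / \<alpha> 1 - snd p + gprod_err)"
      by (rule Limsup_bounded)
    then show "Liminf ?F (\<lambda>(i, j). ereal (G_gprod blk \<alpha> p (fst (xs, ys) i) (snd (xs, ys) j)))
        \<le> ereal (ln (8 * W) / \<alpha> 1 - snd p + gprod_err)"
      unfolding fst_conv snd_conv by (rule order_trans[OF Liminf_le_Limsup[OF bot]])
  qed
qed

text \<open>The value of \<open>E p (x, t)\<close> for all sufficiently low t.\<close>

definition mag :: "'n point \<Rightarrow> real^'n \<Rightarrow> real" where
  "mag p x = max (D (fst p) x) (exp (\<alpha> 1 * snd p))"

lemma mag_pos: "0 < mag p x" and mag_ge: "exp (\<alpha> 1 * snd p) \<le> mag p x"
  by (simp_all add: mag_def less_max_iff_disj)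

lemma mag_nonneg [simp]: "0 \<le> mag p x"
  using mag_pos[of p x] by linarith

lemma mag_le_E: "mag p x \<le> E p (x, t)"
  unfolding mag_def E_def by (intro max.mono) auto

lemma E_le_mag:
  assumes "conv_to blk \<alpha> q (Some x)"
  obtains N where "\<And>i. N \<le> i \<Longrightarrow> E p (q i) \<le> 2 * mag p x"
proof -
  obtain N where N: "\<And>i. N \<le> i \<Longrightarrow> D (fst (q i)) x < mag p x \<and> exp (\<alpha> 1 * snd (q i)) < mag p x"
    using conv_to_Some[OF assms mag_pos] by blast
  have "E p (q i) \<le> 2 * mag p x" if "N \<le> i" for i
  proof -
    have "D (fst p) (fst (q i)) \<le> D (fst p) x + D x (fst (q i))" by (rule D_triangle)
    also have "\<dots> \<le> mag p x + mag p x"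
      using N[OF that] by (intro add_mono) (auto simp: mag_def D_commute[of x])
    finally show ?thesis using N[OF that] mag_ge[of p x] mag_pos[of p x] by (auto simp: E_def)
  qed
  then show ?thesis using that by blast
qed

lemma exp_unbounded: "\<exists>N. \<forall>n\<ge>N. B \<le> exp (\<alpha> 1 * real n)"
proof -
  define N where "N = nat \<lceil>ln (max B 1) / \<alpha> 1\<rceil>"
  have "B \<le> exp (\<alpha> 1 * real n)" if "N \<le> n" for n
  proof -
    have "ln (max B 1) / \<alpha> 1 \<le> real N" by (simp add: N_def of_nat_ceiling)
    also have "\<dots> \<le> real n" using that by simp
    finally have "ln (max B 1) \<le> \<alpha> 1 * real n" using \<alpha>1_pos by (simp add: field_simps)
    then have "max B 1 \<le> exp (\<alpha> 1 * real n)" by (metis exp_ln exp_le_cancel_iff max.strict_coboundedI2 zero_less_one)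
    then show ?thesis by simp
  qed
  then show ?thesis by blast
qed

lemma bd_gprod_Some_Some:
  fixes p :: "'n point" and x y :: "real^'n"
  assumes "x \<noteq> y"
  defines "W \<equiv> mag p x * mag p y / D x y"
  shows "ereal (ln W / \<alpha> 1 - snd p - gprod_err) \<le> bd_gprod blk \<alpha> p (Some x) (Some y)"
    and "bd_gprod blk \<alpha> p (Some x) (Some y) \<le> ereal (ln (8 * W) / \<alpha> 1 - snd p + gprod_err)"
proof -
  have Dp: "0 < D x y" using assms(1) D_pos_iff by blast
  have W: "0 < W" unfolding W_def using Dp mag_pos by simp
  have low: "\<exists>N. \<forall>m\<ge>N. \<forall>n\<ge>N. W \<le> ratio p (bd_rep (Some x) n) (bd_rep (Some y) m)"
  proof -
    obtain N where N: "\<And>n. N \<le> n \<Longrightarrow> 1 / D x y \<le> exp (\<alpha> 1 * real n)" using exp_unbounded by blast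
    have small: "exp (- (\<alpha> 1 * real n)) \<le> D x y" if "N \<le> n" for n
      using N[OF that] Dp by (simp add: exp_minus field_simps)
    have "W \<le> ratio p (bd_rep (Some x) n) (bd_rep (Some y) m)" if "N \<le> m" "N \<le> n" for m n
    proof -
      have "E (x, - real n) (y, - real m) = D x y"
        using small[OF that(1)] small[OF that(2)] by (simp add: E_def)
      moreover have "mag p x * mag p y \<le> E p (x, - real n) * E p (y, - real m)"
        by (intro mult_mono mag_le_E) auto
      ultimately show ?thesis
        unfolding W_def ratio_def bd_rep_def using Dp by (simp add: divide_right_mono)
    qed
    then show ?thesis by blast
  qed
  have up: "\<exists>N. \<forall>m\<ge>N. \<forall>n\<ge>N. ratio p (xs n) (ys m) \<le> 8 * W"
    if xs: "conv_to blk \<alpha> xs (Some x)" and ys: "conv_to blk \<alpha> ys (Some y)" for xs ys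
  proof -
    obtain N1 where N1: "\<And>i. N1 \<le> i \<Longrightarrow> E p (xs i) \<le> 2 * mag p x" using E_le_mag[OF xs] by blast
    obtain N2 where N2: "\<And>i. N2 \<le> i \<Longrightarrow> E p (ys i) \<le> 2 * mag p y" using E_le_mag[OF ys] by blast
    have D4: "0 < D x y / 4" using Dp by simp
    obtain N3 where N3: "\<And>i. N3 \<le> i \<Longrightarrow> D (fst (xs i)) x < D x y / 4" using conv_to_Some[OF xs D4] by metis
    obtain N4 where N4: "\<And>i. N4 \<le> i \<Longrightarrow> D (fst (ys i)) y < D x y / 4" using conv_to_Some[OF ys D4] by metis
    have "ratio p (xs n) (ys m) \<le> 8 * W"
      if "max (max N1 N2) (max N3 N4) \<le> m" "max (max N1 N2) (max N3 N4) \<le> n" for m n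
    proof -
      have "D x y \<le> D x (fst (xs n)) + D (fst (xs n)) (fst (ys m)) + D (fst (ys m)) y"
        using D_triangle[of x y "fst (xs n)"] D_triangle[of "fst (xs n)" y "fst (ys m)"] by linarith
      then have "D x y / 2 \<le> D (fst (xs n)) (fst (ys m))"
        using N3[of n] N4[of m] that D_commute[of x "fst (xs n)"] by simp
      then have lowE: "D x y / 2 \<le> E (xs n) (ys m)" using E_ge_D[of "xs n" "ys m"] by linarith
      have "ratio p (xs n) (ys m) \<le> (2 * mag p x) * (2 * mag p y) / (D x y / 2)"
        unfolding ratio_def using N1[of n] N2[of m] that lowE Dp
        by (intro frac_le mult_mono) auto
      also have "\<dots> = 8 * W" by (simp add: W_def)
      finally show ?thesis .
    qed
    then show ?thesis by blast
  qed
  show "ereal (ln W / \<alpha> 1 - snd p - gprod_err) \<le> bd_gprod blk \<alpha> p (Some x) (Some y)"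
    and "bd_gprod blk \<alpha> p (Some x) (Some y) \<le> ereal (ln (8 * W) / \<alpha> 1 - snd p + gprod_err)"
    using bd_gprod_bounds[OF W low up] by blast+
qed

lemma bd_gprod_None_Some:
  "ereal (ln (mag p y) / \<alpha> 1 - snd p - gprod_err) \<le> bd_gprod blk \<alpha> p None (Some y)"
  "bd_gprod blk \<alpha> p None (Some y) \<le> ereal (ln (8 * mag p y) / \<alpha> 1 - snd p + gprod_err)"
proof -
  have low: "\<exists>N. \<forall>m\<ge>N. \<forall>n\<ge>N. mag p y \<le> ratio p (bd_rep None n) (bd_rep (Some y) m)"
  proof -
    obtain N where N: "\<And>n. N \<le> n \<Longrightarrow> max (D 0 y) 1 \<le> exp (\<alpha> 1 * real n)" using exp_unbounded by blast
    have "mag p y \<le> ratio p (bd_rep None n) (bd_rep (Some y) m)" if "N \<le> m" "N \<le> n" for m n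
    proof -
      have "exp (- (\<alpha> 1 * real m)) \<le> 1" using \<alpha>1_pos by simp
      then have "exp (- (\<alpha> 1 * real m)) \<le> exp (\<alpha> 1 * real n)" "D 0 y \<le> exp (\<alpha> 1 * real n)"
        using N[OF that(2)] by linarith+
      then have En: "E (0, real n) (y, - real m) = exp (\<alpha> 1 * real n)" by (simp add: E_def)
      have "exp (\<alpha> 1 * real n) * mag p y \<le> E p (0, real n) * E p (y, - real m)"
        using E_ge_snd[of "(0, real n)" p] by (intro mult_mono mag_le_E) auto
      then show ?thesis
        unfolding ratio_def bd_rep_def by (simp add: En pos_le_divide_eq mult.commute)
    qed
    then show ?thesis by blast
  qed
  have up: "\<exists>N. \<forall>m\<ge>N. \<forall>n\<ge>N. ratio p (xs n) (ys m) \<le> 8 * mag p y"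
    if xs: "conv_to blk \<alpha> xs None" and ys: "conv_to blk \<alpha> ys (Some y)" for xs ys
  proof -
    obtain N1 where N1: "\<And>i. N1 \<le> i \<Longrightarrow> E p (ys i) \<le> 2 * mag p y" using E_le_mag[OF ys] by blast
    \<comment> \<open>Large enough that \<open>E (xs n) (ys m)\<close> is eventually at least
      \<open>2 * mag p y\<close>; then \<open>E p (xs n)\<close> is at most twice that
      quantity.\<close>
    define B where "B = E (0, 0) p + 4 * mag p y"
    have B: "0 < B" using E_pos mag_pos by (simp add: B_def add_pos_pos)
    obtain N2 where N2: "\<And>i. N2 \<le> i \<Longrightarrow> B \<le> E (0, 0) (xs i)" using conv_to_None[OF xs B] by blast
    have "ratio p (xs n) (ys m) \<le> 8 * mag p y" if "max N1 N2 \<le> m" "max N1 N2 \<le> n" for m n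
    proof -
      have y: "E p (ys m) \<le> 2 * mag p y" using N1 that by simp
      have "E (0, 0) (xs n) \<le> E (0, 0) p + E p (ys m) + E (ys m) (xs n)"
        using E_triangle[of "(0, 0)" "xs n" "ys m"] E_triangle[of "(0, 0)" "ys m" p] by linarith
      then have big: "2 * mag p y \<le> E (xs n) (ys m)"
        using N2[of n] that y E_commute[of "ys m" "xs n"] by (simp add: B_def)
      have "E p (xs n) \<le> 2 * E (xs n) (ys m)"
        using E_triangle[of p "xs n" "ys m"] E_commute[of "ys m" "xs n"] y big by linarith
      then have "E p (xs n) * E p (ys m) \<le> (2 * E (xs n) (ys m)) * (2 * mag p y)"
        using y by (intro mult_mono) auto
      also have "\<dots> \<le> 8 * mag p y * E (xs n) (ys m)"
        using mag_pos[of p y] E_pos[of "xs n" "ys m"] by simp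
      finally show ?thesis
        unfolding ratio_def using E_pos by (simp add: pos_divide_le_eq)
    qed
    then show ?thesis by blast
  qed
  show "ereal (ln (mag p y) / \<alpha> 1 - snd p - gprod_err) \<le> bd_gprod blk \<alpha> p None (Some y)"
    "bd_gprod blk \<alpha> p None (Some y) \<le> ereal (ln (8 * mag p y) / \<alpha> 1 - snd p + gprod_err)"
    using bd_gprod_bounds[OF mag_pos low up] by blast+
qed

section \<open>Visual metrics as chordal metrics\<close>

lemma vis_weight_bounds:
  assumes \<epsilon>: "0 < \<epsilon>" and W: "0 < W"
    and g: "ereal (ln W / \<alpha> 1 - u - C) \<le> g" "g \<le> ereal (ln (8 * W) / \<alpha> 1 - u + C)"
  shows "vis_weight \<epsilon> g \<le> exp (\<epsilon> * (u + C)) * W powr (- (\<epsilon> / \<alpha> 1))"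
    and "8 powr (- (\<epsilon> / \<alpha> 1)) * exp (\<epsilon> * (u - C)) * W powr (- (\<epsilon> / \<alpha> 1)) \<le> vis_weight \<epsilon> g"
proof -
  obtain \<gamma> where \<gamma>: "g = ereal \<gamma>"
    using g by (cases g) auto
  have v: "vis_weight \<epsilon> g = exp (- \<epsilon> * \<gamma>)" by (simp add: vis_weight_def \<gamma>)
  have "exp (- \<epsilon> * \<gamma>) \<le> exp (- \<epsilon> * (ln W / \<alpha> 1 - u - C))"
    using g(1) \<epsilon> unfolding \<gamma> by simp
  also have "\<dots> = exp (\<epsilon> * (u + C)) * W powr (- (\<epsilon> / \<alpha> 1))"
    using W by (simp add: powr_def algebra_simps flip: exp_add)
  finally show "vis_weight \<epsilon> g \<le> exp (\<epsilon> * (u + C)) * W powr (- (\<epsilon> / \<alpha> 1))" by (simp only: v)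
  have "8 powr (- (\<epsilon> / \<alpha> 1)) * exp (\<epsilon> * (u - C)) * W powr (- (\<epsilon> / \<alpha> 1))
      = (8 * W) powr (- (\<epsilon> / \<alpha> 1)) * exp (\<epsilon> * (u - C))"
    using W by (simp add: powr_mult)
  also have "\<dots> = exp (- \<epsilon> * (ln (8 * W) / \<alpha> 1 - u + C))"
    using W by (simp add: powr_def algebra_simps flip: exp_add)
  also have "\<dots> \<le> exp (- \<epsilon> * \<gamma>)"
    using g(2) \<epsilon> unfolding \<gamma> by simp
  finally show "8 powr (- (\<epsilon> / \<alpha> 1)) * exp (\<epsilon> * (u - C)) * W powr (- (\<epsilon> / \<alpha> 1)) \<le> vis_weight \<epsilon> g"
    by (simp only: v)
qed

lemma visual_metric_chordal:
  assumes "visual_metric blk \<alpha> d"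
  shows "\<exists>\<kappa> K. chordal \<beta> d \<kappa> K"
proof -
  have met: "Metric_space UNIV d" using assms by (simp add: visual_metric_def)
  interpret m: Metric_space UNIV d by (rule met)
  obtain p \<epsilon> where \<epsilon>: "0 < \<epsilon>" and vis: "\<And>\<xi> \<eta>. vis_weight \<epsilon> (bd_gprod blk \<alpha> p \<xi> \<eta>) / 2 \<le> d \<xi> \<eta>"
      "\<And>\<xi> \<eta>. d \<xi> \<eta> \<le> vis_weight \<epsilon> (bd_gprod blk \<alpha> p \<xi> \<eta>)"
    using assms unfolding visual_metric_def by blast
  define \<kappa> where "\<kappa> = \<epsilon> / \<alpha> 1"
  have \<kappa>: "0 < \<kappa>" using \<epsilon> \<alpha>1_pos by (simp add: \<kappa>_def)
  define u where "u = snd p"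
  define A where "A = max (exp (\<epsilon> * (u + gprod_err))) (2 / (8 powr (- \<kappa>) * exp (\<epsilon> * (u - gprod_err))))"
  have A0: "0 < A" by (simp add: A_def less_max_iff_disj)
  have general: "d \<xi> \<eta> \<le> A * W powr (- \<kappa>)" "W powr (- \<kappa>) \<le> A * d \<xi> \<eta>"
    if W: "0 < W" "ereal (ln W / \<alpha> 1 - u - gprod_err) \<le> bd_gprod blk \<alpha> p \<xi> \<eta>"
      "bd_gprod blk \<alpha> p \<xi> \<eta> \<le> ereal (ln (8 * W) / \<alpha> 1 - u + gprod_err)" for W \<xi> \<eta>
  proof -
    note b = vis_weight_bounds[OF \<epsilon> W, folded \<kappa>_def]
    have "exp (\<epsilon> * (u + gprod_err)) * W powr (- \<kappa>) \<le> A * W powr (- \<kappa>)"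
      by (intro mult_right_mono) (auto simp: A_def)
    then show "d \<xi> \<eta> \<le> A * W powr (- \<kappa>)" using b(1) vis(2)[of \<xi> \<eta>] by linarith
    define s where "s = 8 powr (- \<kappa>) * exp (\<epsilon> * (u - gprod_err))"
    have s: "0 < s" by (simp add: s_def)
    have "s * W powr (- \<kappa>) \<le> 2 * d \<xi> \<eta>" using b(2) vis(1)[of \<xi> \<eta>] by (simp add: s_def)
    then have "W powr (- \<kappa>) \<le> 2 / s * d \<xi> \<eta>" using s by (simp add: field_simps)
    also have "\<dots> \<le> A * d \<xi> \<eta>" by (intro mult_right_mono) (auto simp: A_def s_def)
    finally show "W powr (- \<kappa>) \<le> A * d \<xi> \<eta>" .
  qed
  \<comment> \<open>Stands for the distance to infinity until the two are exchanged at the cost of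
    one factor A per point.\<close>
  define \<mu> where "\<mu> x = mag p x powr (- \<kappa>)" for x
  have \<mu>: "0 < \<mu> x" for x using mag_pos[of p x] by (simp add: \<mu>_def)
  have h: "d (Some x) None \<le> A * \<mu> x" "\<mu> x \<le> A * d (Some x) None" for x
    using general[OF mag_pos bd_gprod_None_Some[of p x, folded u_def]] m.commute[of "Some x" None]
    by (simp_all add: \<mu>_def)
  have xy: "d (Some x) (Some y) \<le> A * (D x y powr \<kappa> * (\<mu> x * \<mu> y))"
    "D x y powr \<kappa> * (\<mu> x * \<mu> y) \<le> A * d (Some x) (Some y)" for x y
  proof -
    have "d (Some x) (Some y) \<le> A * (D x y powr \<kappa> * (\<mu> x * \<mu> y)) \<and>
      D x y powr \<kappa> * (\<mu> x * \<mu> y) \<le> A * d (Some x) (Some y)"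
    \<comment> \<open>On the diagonal all terms vanish, so the Gromov product does not enter
      there.\<close>
    proof (cases "x = y")
      case False
      define W where "W = mag p x * mag p y / D x y"
      have Dp: "0 < D x y" using False D_pos_iff by blast
      have W: "0 < W" unfolding W_def using Dp mag_pos by simp
      have "W powr (- \<kappa>) = D x y powr \<kappa> * (\<mu> x * \<mu> y)"
        unfolding W_def \<mu>_def using mag_pos[of p x] mag_pos[of p y] Dp
        by (simp add: powr_divide powr_mult powr_minus field_simps)
      then show ?thesis
        using general[OF W bd_gprod_Some_Some[OF False, of p, folded W_def u_def]] by simp
    qed simp
    then show "d (Some x) (Some y) \<le> A * (D x y powr \<kappa> * (\<mu> x * \<mu> y))"
      "D x y powr \<kappa> * (\<mu> x * \<mu> y) \<le> A * d (Some x) (Some y)" by blast+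
  qed
  \<comment> \<open>Three factors A: one for the distance of x and y, two for exchanging \<mu>. The
    last entry bounds the distance to infinity, since \<open>mag\<close> is at least
    \<open>exp (\<alpha> 1 * u)\<close>.\<close>
  define K where "K = max 1 (max (A * A * A) (A * exp (\<alpha> 1 * u) powr (- \<kappa>)))"
  have K: "1 \<le> K" "A * A * A \<le> K" "A * exp (\<alpha> 1 * u) powr (- \<kappa>) \<le> K" by (auto simp: K_def)
  have "chordal \<beta> d \<kappa> K"
  proof unfold_locales
    fix x y
    have "A * (D x y powr \<kappa> * (\<mu> x * \<mu> y)) \<le> A * (D x y powr \<kappa> * ((A * d (Some x) None) * (A * d (Some y) None)))"
      using h(2) A0 \<mu> by (intro mult_left_mono mult_mono) (auto intro: less_imp_le)
    also have "\<dots> = A * A * A * (D x y powr \<kappa> * (d (Some x) None * d (Some y) None))" by simp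
    also have "\<dots> \<le> K * (D x y powr \<kappa> * (d (Some x) None * d (Some y) None))"
      using K by (intro mult_right_mono) auto
    finally show "d (Some x) (Some y) \<le> K * (D x y powr \<kappa> * (d (Some x) None * d (Some y) None))"
      using xy(1)[of x y] by linarith
    have "D x y powr \<kappa> * (d (Some x) None * d (Some y) None) \<le> D x y powr \<kappa> * ((A * \<mu> x) * (A * \<mu> y))"
      using h(1) A0 \<mu> by (intro mult_left_mono mult_mono) (auto intro: less_imp_le)
    also have "\<dots> = A * A * (D x y powr \<kappa> * (\<mu> x * \<mu> y))" by simp
    also have "\<dots> \<le> A * A * (A * d (Some x) (Some y))"
      using xy(2)[of x y] A0 by (intro mult_left_mono) auto
    also have "\<dots> = A * A * A * d (Some x) (Some y)" by simp
    also have "\<dots> \<le> K * d (Some x) (Some y)" using K by (intro mult_right_mono) auto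
    finally show "D x y powr \<kappa> * (d (Some x) None * d (Some y) None) \<le> K * d (Some x) (Some y)" .
    have "\<mu> x \<le> exp (\<alpha> 1 * u) powr (- \<kappa>)"
      unfolding \<mu>_def u_def using mag_ge[of p x] \<kappa> by (intro powr_mono2') auto
    then have "A * \<mu> x \<le> A * exp (\<alpha> 1 * u) powr (- \<kappa>)" using A0 by (intro mult_left_mono) auto
    then show "d (Some x) None \<le> K" using h(1)[of x] K(3) by linarith
  qed (use \<kappa> K in auto)
  then show ?thesis by blast
qed

section \<open>Comparison of the box metric with the block metric\<close>

lemma D_le_D_metric: "D x y \<le> D_metric blk r \<alpha> x y"
proof -
  have "\<bar>x $ j - y $ j\<bar> powr (1 / \<beta> j) \<le> D_metric blk r \<alpha> x y" for j
  proof -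
    have "(x $ j - y $ j)\<^sup>2 \<le> (\<Sum>k\<in>{k. blk k = blk j}. ((x - y) $ k)\<^sup>2)"
      using member_le_sum[of j "{k. blk k = blk j}" "\<lambda>k. ((x - y) $ k)\<^sup>2"] by simp
    then have "\<bar>x $ j - y $ j\<bar> \<le> blk_norm blk (blk j) (x - y)"
      unfolding blk_norm_def using real_sqrt_le_mono by fastforce
    then have "\<bar>x $ j - y $ j\<bar> powr (1 / \<beta> j) \<le> blk_norm blk (blk j) (x - y) powr (1 / \<beta> j)"
      using beta_pos[of j] by (intro powr_mono2) auto
    also have "\<dots> = blk_norm blk (blk j) (x - y) powr (\<alpha> 1 / \<alpha> (blk j))" by (simp add: \<beta>_def)
    also have "\<dots> \<le> D_metric blk r \<alpha> x y"
      unfolding D_metric_def using blk_mem[of j] by (intro Max_ge) auto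
    finally show ?thesis .
  qed
  then show ?thesis by (subst box_dist_def) simp
qed

lemma D_metric_le_D: "D_metric blk r \<alpha> x y \<le> CARD('n) * D x y"
  unfolding D_metric_def
proof (subst Max_le_iff, goal_cases)
  case 3
  have "blk_norm blk i (x - y) powr (\<alpha> 1 / \<alpha> i) \<le> CARD('n) * D x y" if i: "i \<in> {1..r}" for i
  proof -
    have \<alpha>i: "0 < \<alpha> i" "\<alpha> 1 \<le> \<alpha> i" using i \<alpha>_pos \<alpha>1_le by auto
    have "blk_norm blk i (x - y) \<le> (\<Sum>j\<in>{j. blk j = i}. \<bar>(x - y) $ j\<bar>)"
      using L2_set_le_sum_abs[of "\<lambda>j. (x - y) $ j"] by (simp add: blk_norm_def L2_set_def)
    also have "\<dots> \<le> (\<Sum>j\<in>{j. blk j = i}. D x y powr (\<alpha> i / \<alpha> 1))"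
      using coord_le_D_powr[of x _ y] by (intro sum_mono) (auto simp: \<beta>_def)
    also have "\<dots> \<le> CARD('n) * D x y powr (\<alpha> i / \<alpha> 1)"
      by (simp add: mult_right_mono card_mono)
    finally have "blk_norm blk i (x - y) powr (\<alpha> 1 / \<alpha> i) \<le> (CARD('n) * D x y powr (\<alpha> i / \<alpha> 1)) powr (\<alpha> 1 / \<alpha> i)"
      using \<alpha>i \<alpha>1_pos by (intro powr_mono2) (auto simp: blk_norm_def sum_nonneg)
    also have "\<dots> = CARD('n) powr (\<alpha> 1 / \<alpha> i) * D x y"
      using \<alpha>i \<alpha>1_pos by (simp add: powr_mult powr_powr)
    \<comment> \<open>The exponent is at most 1 and the base at least 1, so one constant serves all
      blocks.\<close>
    also have "\<dots> \<le> CARD('n) powr 1 * D x y"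
      using \<alpha>i by (intro mult_right_mono powr_mono) (auto simp: Suc_le_eq)
    finally show ?thesis by simp
  qed
  then show ?case by auto
qed (use r2 in auto)

end

section \<open>Weak quasisymmetry of the map and its inverse\<close>

lemma homeomorphism_ray_fixes_0:
  fixes \<eta> \<eta>' :: "real \<Rightarrow> real"
  assumes "homeomorphism {0..} {0..} \<eta> \<eta>'"
  shows "\<eta> 0 = 0"
proof (rule ccontr)
  have inv: "\<And>t. 0 \<le> t \<Longrightarrow> \<eta>' (\<eta> t) = t" "\<And>t. 0 \<le> t \<Longrightarrow> \<eta> (\<eta>' t) = t"
    and cont: "continuous_on {0..} \<eta>"
    and nn: "\<And>t. 0 \<le> t \<Longrightarrow> 0 \<le> \<eta> t" "\<And>t. 0 \<le> t \<Longrightarrow> 0 \<le> \<eta>' t"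
    using assms by (auto simp: homeomorphism_def)
  assume ne: "\<eta> 0 \<noteq> 0"
  define b where "b = \<eta>' 0"
  have b: "0 \<le> b" "\<eta> b = 0" using nn inv by (auto simp: b_def)
  have inj: "\<eta> t = \<eta> t' \<Longrightarrow> t = t'" if "0 \<le> t" "0 \<le> t'" for t t' using inv(1) that by metis
  \<comment> \<open>A level that continuity makes \<eta> take on both sides of its zero b, against
    injectivity.\<close>
  define c where "c = min (\<eta> 0) (\<eta> (b + 1)) / 2"
  have "\<eta> (b + 1) \<noteq> \<eta> b" using inj[of "b + 1" b] b by auto
  then have c: "0 < c" "c < \<eta> 0" "c < \<eta> (b + 1)"
    using ne nn(1)[of 0] nn(1)[of "b + 1"] b by (auto simp: c_def min_def)
  have "\<exists>t\<ge>0. t \<le> b \<and> \<eta> t = c"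
    using b c by (intro IVT2') (auto intro: continuous_on_subset[OF cont])
  then obtain t1 where t1: "0 \<le> t1" "t1 \<le> b" "\<eta> t1 = c" by blast
  have "\<exists>t\<ge>b. t \<le> b + 1 \<and> \<eta> t = c"
    using b c by (intro IVT') (auto intro: continuous_on_subset[OF cont])
  then obtain t2 where t2: "b \<le> t2" "t2 \<le> b + 1" "\<eta> t2 = c" by blast
  have "t1 = t2" using inj[of t1 t2] t1 t2 b by simp
  then have "t1 = b" using t1 t2 by simp
  then show False using t1 b c by simp
qed

lemma quasisymmetric_weakly_qs:
  fixes d :: "'a \<Rightarrow> 'a \<Rightarrow> real"
  assumes met: "Metric_space UNIV d" and qs: "quasisymmetric d F"
  shows "bij F" "weakly_qs d F" "weakly_qs d (inv F)" "eps_cont d F" "eps_cont d (inv F)"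
proof -
  interpret m: Metric_space UNIV d by (rule met)
  have hom: "homeomorphic_map m.mtopology m.mtopology F"
    using qs by (simp add: quasisymmetric_def)
  show bij: "bij F"
    using homeomorphic_imp_surjective_map[OF hom] homeomorphic_imp_injective_map[OF hom]
    by (simp add: bij_def)
  then have FG [simp]: "F (inv F x) = x" "inv F (F x) = x" for x
    by (auto simp: bij_is_surj surj_f_inv_f bij_is_inj)
  obtain G where G: "homeomorphic_maps m.mtopology m.mtopology F G"
    using hom homeomorphic_map_maps by blast
  have "G = inv F"
    using G bij by (intro ext) (metis FG(1) UNIV_I homeomorphic_maps_def m.topspace_mtopology)
  then have "continuous_map m.mtopology m.mtopology F" "continuous_map m.mtopology m.mtopology (inv F)"
    using G by (auto simp: homeomorphic_maps_def)
  then show "eps_cont d F" "eps_cont d (inv F)"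
    unfolding m.metric_continuous_map[OF met] eps_cont_def by auto
  obtain \<eta> \<eta>' where \<eta>: "homeomorphism {0..} {0..} \<eta> \<eta>'"
    and q: "\<And>x y z. x \<noteq> y \<Longrightarrow> x \<noteq> z \<Longrightarrow> y \<noteq> z \<Longrightarrow> d (F x) (F y) / d (F x) (F z) \<le> \<eta> (d x y / d x z)"
    using qs unfolding quasisymmetric_def by blast
  have cont: "continuous_on {0..} \<eta>" using \<eta> by (simp add: homeomorphism_def)
  have pos: "0 < d x y" if "x \<noteq> y" for x y using that by simp
  have Fne: "F x \<noteq> F y" if "x \<noteq> y" for x y using that bij by (metis FG(2))
  show "weakly_qs d F"
    unfolding weakly_qs_def
  proof
    fix C :: real
    have "compact (\<eta> ` {0..C})"
      by (intro compact_continuous_image continuous_on_subset[OF cont]) auto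
    then obtain M where M: "\<And>t. t \<in> {0..C} \<Longrightarrow> \<eta> t \<le> M"
      by (metis bdd_above.E bounded_imp_bdd_above compact_imp_bounded imageI)
    have "d (F x) (F y) \<le> max 1 M * d (F x) (F z)" if le: "d x y \<le> C * d x z" for x y z
    proof (cases "x = y \<or> x = z \<or> y = z")
      case True
      \<comment> \<open>Quasisymmetry speaks of distinct triples only. Here x = z forces x = y, and
        y = z needs the constant 1, hence the maximum with 1.\<close>
      have "x = y" if "x = z" using le that m.nonneg[of x y] by (metis UNIV_I m.zero mult_zero_right order_antisym)
      then consider "x = y" | "y = z" using True by blast
      then show ?thesis
      proof cases
        case 2
        have "1 * d (F x) (F z) \<le> max 1 M * d (F x) (F z)" by (intro mult_right_mono) auto
        then show ?thesis using 2 by simp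
      qed simp
    next
      case False
      then have "0 < d x z" using pos by blast
      then have "\<eta> (d x y / d x z) \<le> M" using le by (intro M) (auto simp: field_simps)
      then have "d (F x) (F y) / d (F x) (F z) \<le> max 1 M" using q[of x y z] False by simp
      moreover have "0 < d (F x) (F z)" using pos Fne False by blast
      ultimately show ?thesis by (simp only: pos_divide_le_eq)
    qed
    then show "\<exists>H\<ge>1. \<forall>x y z. d x y \<le> C * d x z \<longrightarrow> d (F x) (F y) \<le> H * d (F x) (F z)"
      by (intro exI[of _ "max 1 M"]) auto
  qed
  show "weakly_qs d (inv F)"
    unfolding weakly_qs_def
  proof
    fix C :: real
    define C' where "C' = max C 1"
    have "(0::real) \<in> {0..}" "0 < 1 / C'" by (auto simp: C'_def less_max_iff_disj)
    then have "\<exists>\<delta>>0. \<forall>t\<in>{0..}. dist t 0 < \<delta> \<longrightarrow> dist (\<eta> t) (\<eta> 0) < 1 / C'"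
      using cont unfolding continuous_on_iff by blast
    then obtain \<delta> where \<delta>: "0 < \<delta>" "\<And>t. 0 \<le> t \<Longrightarrow> t < \<delta> \<Longrightarrow> \<eta> t < 1 / C'"
      using homeomorphism_ray_fixes_0[OF \<eta>] by (fastforce simp: dist_real_def)
    \<comment> \<open>Quasisymmetry with b and c exchanged: as \<eta> vanishes at 0, a small
      quotient \<open>d a c / d a b\<close> would make the image of b too far from that of
      a.\<close>
    have main: "d a b \<le> max 1 (1 / \<delta>) * d a c" if le: "d (F a) (F b) \<le> C * d (F a) (F c)" for a b c
    proof (cases "a = b \<or> a = c \<or> b = c")
      case True
      have "a = b" if "a = c" using le that m.nonneg[of "F a" "F b"]
        by (metis UNIV_I m.zero mult_zero_right order_antisym Fne)
      then consider "a = b" | "b = c" using True by blast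
      then show ?thesis
      proof cases
        case 2
        have "1 * d a c \<le> max 1 (1 / \<delta>) * d a c" by (intro mult_right_mono) auto
        then show ?thesis using 2 by simp
      qed simp
    next
      case False
      then have p: "0 < d a b" "0 < d a c" "0 < d (F a) (F b)" "0 < d (F a) (F c)"
        using pos Fne by blast+
      have "\<delta> \<le> d a c / d a b"
      proof (rule ccontr)
        assume "\<not> ?thesis"
        then have "\<eta> (d a c / d a b) < 1 / C'" using p by (intro \<delta>(2)) auto
        then have "d (F a) (F c) / d (F a) (F b) < 1 / C'" using q[of a c b] False by force
        then have "C' * d (F a) (F c) < d (F a) (F b)" using p by (simp add: C'_def field_simps)
        moreover have "C * d (F a) (F c) \<le> C' * d (F a) (F c)"
          using p by (intro mult_right_mono) (auto simp: C'_def)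
        ultimately show False using le by linarith
      qed
      then have "d a b \<le> 1 / \<delta> * d a c" using \<delta>(1) p by (simp add: field_simps)
      also have "\<dots> \<le> max 1 (1 / \<delta>) * d a c" by (intro mult_right_mono) auto
      finally show ?thesis .
    qed
    have "d (inv F x) (inv F y) \<le> max 1 (1 / \<delta>) * d (inv F x) (inv F z)" if "d x y \<le> C * d x z" for x y z
      using main[of "inv F x" "inv F y" "inv F z"] that by simp
    then show "\<exists>H\<ge>1. \<forall>x y z. d x y \<le> C * d x z \<longrightarrow> d (inv F x) (inv F y) \<le> H * d (inv F x) (inv F z)"
      by (intro exI[of _ "max 1 (1 / \<delta>)"]) auto
  qed
qed

theorem theorem1p1:
  fixes blk :: "'n::finite \<Rightarrow> nat" and r :: nat and \<alpha> :: "nat \<Rightarrow> real"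
    and d :: "'n bdry \<Rightarrow> 'n bdry \<Rightarrow> real" and F :: "'n bdry \<Rightarrow> 'n bdry"
  assumes "r \<ge> 2"
    and "blk ` UNIV = {1..r}"
    and "\<forall>i\<in>{1..r}. \<alpha> i > 0"
    and "strict_mono_on {1..r} \<alpha>"
    and "visual_metric blk \<alpha> d"
    and "quasisymmetric d F"
  shows "F ` (range Some) = range Some \<and>
    (\<exists>L\<ge>1. \<forall>x y.
       D_metric blk r \<alpha> x y / L \<le> D_metric blk r \<alpha> (the (F (Some x))) (the (F (Some y))) \<and>
       D_metric blk r \<alpha> (the (F (Some x))) (the (F (Some y))) \<le> L * D_metric blk r \<alpha> x y)"
proof -
  interpret heintze blk r \<alpha> by unfold_locales (use assms in auto)
  obtain \<kappa> K where "chordal \<beta> d \<kappa> K" using visual_metric_chordal[OF assms(5)] by blast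
  then interpret chordal \<beta> d \<kappa> K .
  note F = quasisymmetric_weakly_qs[OF m.Metric_space_axioms assms(6)]
  \<comment> \<open>A direction along the leaves and one transversal to them; the latter exists
    because r is at least 2.\<close>
  obtain i0 where i0: "blk i0 = 1" using assms(1,2) by (metis atLeastAtMost_iff imageE le_trans one_le_numeral order_refl)
  obtain j0 where j0: "blk j0 = 2" using assms(1,2) by (metis atLeastAtMost_iff imageE one_le_numeral)
  have "\<alpha> 1 < \<alpha> 2" using assms(1,4) by (auto simp: strict_mono_on_def)
  then have "\<beta> i0 = 1" "1 < \<beta> j0" using \<alpha>1_pos by (simp_all add: \<beta>_def i0 j0)
  moreover have "inv F (F \<xi>) = \<xi>" "F (inv F \<xi>) = \<xi>" for \<xi>
    using F(1) by (simp_all add: bij_is_inj bij_is_surj surj_f_inv_f)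
  ultimately interpret qs_map \<beta> d \<kappa> K F "inv F" i0 j0
    using F(2-5) by unfold_locales
  have None: "F None = None" by (rule F_fixes_infinity)
  have "F ` range Some = range Some"
  proof -
    have "range (Some :: real^'n \<Rightarrow> _) = UNIV - {None}"  by (auto simp: image_iff)
    then show ?thesis
      using F(1) None by (simp add: image_set_diff[OF bij_is_inj[OF F(1)]] bij_is_surj)
  qed
  moreover obtain L where L: "1 \<le> L" "\<And>x y. D x y / L \<le> D (f x) (f y)" "\<And>x y. D (f x) (f y) \<le> L * D x y"
    using f_bilipschitz by blast
  \<comment> \<open>\<open>D_metric\<close> lies between \<open>D\<close> and
    \<open>CARD('n) * D\<close>, and either inequality uses each of these bounds once, so one factor
    suffices.\<close>
  define L' where "L' = CARD('n) * L"
  have n: "1 \<le> real CARD('n)" by (simp add: Suc_le_eq)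
  have L': "1 \<le> L'" using mult_mono[OF n L(1)] by (simp add: L'_def)
  have "D_metric blk r \<alpha> x y / L' \<le> D_metric blk r \<alpha> (f x) (f y) \<and>
       D_metric blk r \<alpha> (f x) (f y) \<le> L' * D_metric blk r \<alpha> x y" for x y
  proof
    have "D_metric blk r \<alpha> x y / L' \<le> CARD('n) * D x y / L'"
      using D_metric_le_D[of x y] L' by (intro divide_right_mono) auto
    also have "\<dots> = D x y / L" by (simp add: L'_def)
    also have "\<dots> \<le> D_metric blk r \<alpha> (f x) (f y)" using L(2) D_le_D_metric by (rule order_trans)
    finally show "D_metric blk r \<alpha> x y / L' \<le> D_metric blk r \<alpha> (f x) (f y)" .
    have "D_metric blk r \<alpha> (f x) (f y) \<le> CARD('n) * D (f x) (f y)" by (rule D_metric_le_D)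
    also have "\<dots> \<le> CARD('n) * (L * D_metric blk r \<alpha> x y)"
      using L(3)[of x y] L(1) D_le_D_metric[of x y]
      by (intro mult_left_mono order_trans[OF L(3)]) auto
    finally show "D_metric blk r \<alpha> (f x) (f y) \<le> L' * D_metric blk r \<alpha> x y" by (simp add: L'_def)
  qed
  ultimately show ?thesis using L' unfolding f_def by blast
qed

end
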